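(* Let $P\subset\mathbb{R}^d$ be a lattice polytope. Then the following are equivalent. (i) $P$ is a zonotope (up to translation). (ii) For every $c\in\mathbb{Q}^d$, the Ehrhart quasi-polynomial $L_{c+P}(t)$ of the translated polytope $c+P$ satisfies the GCD-property.
   Context: A polytope is the convex hull of finitely many points of $\mathbb{R}^d$ (at least one point); it need not be full-dimensional. It is a lattice polytope (resp. rational polytope) if all its vertices lie in $\mathbb{Z}^d$ (resp. $\mathbb{Q}^d$). For $u_1,\dots,u_n\in\mathbb{R}^d$ put $\mathcal{Z}(u_1,\dots,u_n)=\{\lambda_1u_1+\dots+\lambda_nu_n \mid 0\le\lambda_i\le 1\}$, the Minkowski sum of the segments $[0,u_i]$ (equal to $\{0\}$ if $n=0$). A polytope is a zonotope (up to translation) if it equals $v+\mathcal{Z}(u_1,\dots,u_n)$ for some $v\in\mathbb{R}^d$, some $n\ge 0$ and some $u_1,\dots,u_n\in\mathbb{R}^d$. A quasi-polynomial is a function $L$ on the positive integers for which there are an integer $\rho>0$ (a period) and polynomials $f_1,\dots,f_\rho\in\mathbb{Q}[x]$ (the constituents) such that $L(t)=f_k(t)$ whenever $t\equiv k \pmod \rho$, for $1\le k\le\rho$; one also writes $f_0:=f_\rho$. The minimal period is the smallest possible period. For a rational polytope $Q\subset\mathbb{R}^d$, the function $L_Q(t):=\#(tQ\cap\mathbb{Z}^d)$, $t\in\mathbb{Z}_{>0}$, is a quasi-polynomial, called the Ehrhart quasi-polynomial of $Q$. A quasi-polynomial with period $\rho$ and constituents $f_1,\dots,f_\rho$ has the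 GCD-property if $f_k=f_\ell$ whenever $\gcd(\rho,k)=\gcd(\rho,\ell)$. By convention $\rho$ is the minimal period (the notion does not depend on which period is used). *)

theory Defs
  imports
    "HOL-Analysis.Analysis"
    "HOL-Computational_Algebra.Polynomial"
    "HOL-Number_Theory.Cong"
begin

definition integer_points :: "(real ^ 'd) set" where
  "integer_points = {x. \<forall>i. x $ i \<in> \<int>}"

definition rational_points :: "(real ^ 'd) set" where
  "rational_points = {x. \<forall>i. x $ i \<in> \<rat>}"

text \<open>The library predicate \<open>polytope\<close> also holds of the empty set, which is excluded here.
  The vertices of a polytope are its extreme points.\<close>

definition lattice_polytope :: "(real ^ 'd) set \<Rightarrow> bool" where
  "lattice_polytope P \<longleftrightarrow>
     polytope P \<and> P \<noteq> {} \<and> {x. x extreme_point_of P} \<subseteq> integer_points"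

text \<open>The zonotope generated by \<open>u 0, \<dots>, u (n - 1)\<close>; it is \<open>{0}\<close> for \<open>n = 0\<close>.\<close>

definition zonotope_gen :: "nat \<Rightarrow> (nat \<Rightarrow> real ^ 'd) \<Rightarrow> (real ^ 'd) set" where
  "zonotope_gen n u = {\<Sum>i<n. a i *\<^sub>R u i | a :: nat \<Rightarrow> real. \<forall>i<n. 0 \<le> a i \<and> a i \<le> 1}"

definition zonotope_up_to_translation :: "(real ^ 'd) set \<Rightarrow> bool" where
  "zonotope_up_to_translation P \<longleftrightarrow> (\<exists>v n u. P = (\<lambda>x. v + x) ` zonotope_gen n u)"

text \<open>Quasi-polynomials are functions on the positive integers: the value \<open>L 0\<close> is never
  used, nor are the values \<open>f k\<close> for \<open>k\<close> outside \<open>{1..\<rho>}\<close>.\<close>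

definition constituents :: "(nat \<Rightarrow> rat) \<Rightarrow> nat \<Rightarrow> (nat \<Rightarrow> rat poly) \<Rightarrow> bool" where
  "constituents L \<rho> f \<longleftrightarrow>
     \<rho> > 0 \<and> (\<forall>t>0. \<forall>k\<in>{1..\<rho>}. [t = k] (mod \<rho>) \<longrightarrow> L t = poly (f k) (of_nat t))"

definition quasi_period :: "(nat \<Rightarrow> rat) \<Rightarrow> nat \<Rightarrow> bool" where
  "quasi_period L \<rho> \<longleftrightarrow> (\<exists>f. constituents L \<rho> f)"

definition quasi_polynomial :: "(nat \<Rightarrow> rat) \<Rightarrow> bool" where
  "quasi_polynomial L \<longleftrightarrow> (\<exists>\<rho>. quasi_period L \<rho>)"

definition minimal_period :: "(nat \<Rightarrow> rat) \<Rightarrow> nat" where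
  "minimal_period L = (LEAST \<rho>. quasi_period L \<rho>)"

text \<open>For a given period the constituents \<open>f 1, \<dots>, f \<rho>\<close> are uniquely determined, since
  each of them is prescribed at infinitely many arguments; so the existential quantifier over
  \<open>f\<close> below involves no choice.\<close>

definition GCD_property :: "(nat \<Rightarrow> rat) \<Rightarrow> bool" where
  "GCD_property L \<longleftrightarrow>
     quasi_polynomial L \<and>
     (\<exists>f. constituents L (minimal_period L) f \<and>
          (\<forall>k\<in>{1..minimal_period L}. \<forall>l\<in>{1..minimal_period L}.
             gcd (minimal_period L) k = gcd (minimal_period L) l \<longrightarrow> f k = f l))"

definition ehrhart :: "(real ^ 'd) set \<Rightarrow> nat \<Rightarrow> rat" where
  "ehrhart Q t = of_nat (card ((\<lambda>x. real t *\<^sub>R x) ` Q \<inter> integer_points))"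

end

theory Submission
  imports Defs "HOL-Analysis.Kronecker_Approximation_Theorem"
begin

text \<open>
  Let \<open>g\<^sub>t(w)\<close> be the number of lattice points in \<open>w + t P\<close>. For a lattice polytope \<open>P\<close> this is a
  polynomial in \<open>t \<ge> 1\<close> that depends on \<open>w\<close> modulo the lattice, so these polynomials for \<open>w = k c\<close>
  are the constituents of the Ehrhart quasi-polynomial of \<open>c + P\<close>, and the GCD-property for all \<open>c\<close>
  says that \<open>g\<^sub>t(k w) = g\<^sub>t(w)\<close> whenever \<open>k\<close> is coprime to the denominator of \<open>w\<close>.

  A lattice zonotope is a disjoint union of open lattice parallelepipeds. The count of a half-open
  one is either zero or a constant, according to whether \<open>w\<close> lies in a subgroup, and this is
  not affected by multiplication with \<open>k\<close>.

  Conversely, by the Chinese remainder theorem \<open>k\<close> can be chosen so that it fixes \<open>w\<close> and negates a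
  small perturbation \<open>\<eta>\<close>; hence \<open>g\<^sub>1(w + \<eta>) = g\<^sub>1(w - \<eta>)\<close>. Taking Euler characteristics
  over a small section \<open>y \<bullet> \<eta> = \<delta>\<close> shows that all faces inherit the invariance and that the
  faces minimising \<open>y\<close> and \<open>- y\<close> contain equally many lattice points. Applied to faces met along a
  segment of directions, this makes all edges selected by generic directions in the hyperplane
  \<open>u\<^sup>\<bottom>\<close> equally long, and so \<open>P\<close> has the same vertices, up to translation, as the zonotope spanned
  by its edge vectors.
\<close>

subsection \<open>Lattice point counts of translates\<close>

text \<open>The multiplier \<open>k\<close> is a unit modulo the denominator of \<open>w\<close>, so
  the hypothesis by itself relates only rational vectors and says nothing about a real perturbation.
  The bridge is that the count near \<open>w\<close> depends only on the signs of the perturbation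
  against the normals of \<open>P\<close>; a real \<eta> can thus be exchanged for a rational one
  whose denominator is coprime to that of \<open>w\<close>, and the two denominators can be served
  independently.

  A single perturbation sees the lattice points whose tangent cones contain its negative, mixed over
  many faces. The Euler characteristic of a whole section removes this dependence and isolates the
  lattice points on one face. Since the property passes to faces, only edges have to be compared in
  the end, where counting lattice points measures length.

  The two directions use different dilates. The converse evaluates the polynomials at 1 only, while
  the forward direction needs the invariance for every \<open>t P\<close>, because constituents are
  compared as polynomials; it also has to replace arbitrary real generators by lattice vectors
  first.\<close>

lemma integer_points_add: "x \<in> integer_points \<Longrightarrow> y \<in> integer_points \<Longrightarrow> x + y \<in> integer_points"
  by (simp add: integer_points_def)

lemma integer_points_diff: "x \<in> integer_points \<Longrightarrow> y \<in> integer_points \<Longrightarrow> x - y \<in> integer_points"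
  by (simp add: integer_points_def)

lemma integer_points_0: "0 \<in> integer_points"
  by (simp add: integer_points_def)

lemma integer_points_scale: "x \<in> integer_points \<Longrightarrow> c \<in> \<int> \<Longrightarrow> c *\<^sub>R x \<in> integer_points"
  by (simp add: integer_points_def)

lemma integer_points_sum: "(\<And>i. i \<in> I \<Longrightarrow> f i \<in> integer_points) \<Longrightarrow> sum f I \<in> integer_points"
  by (induction I rule: infinite_finite_induct)
    (auto simp: integer_points_0 intro: integer_points_add)

lemma finite_integer_points_bounded:
  fixes S :: "(real ^ 'd) set"
  assumes "bounded S"
  shows "finite (S \<inter> integer_points)"
proof -
  obtain B where B: "\<And>x. x \<in> S \<Longrightarrow> norm x \<le> B"
    using assms by (auto simp: bounded_iff)
  define T where "T = (of_int ` {-\<lceil>B\<rceil>..\<lceil>B\<rceil>} :: real set)"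
  have "S \<inter> integer_points \<subseteq> vec_lambda ` (PiE UNIV (\<lambda>_. T))"
  proof
    fix x assume x: "x \<in> S \<inter> integer_points"
    have "x $ i \<in> T" for i
    proof -
      obtain k where k: "x $ i = of_int k"
        using x by (auto simp: integer_points_def Ints_def)
      have "\<bar>x $ i\<bar> \<le> B"
        using B[of x] x component_le_norm_cart[of x i] by auto
      hence "k \<in> {-\<lceil>B\<rceil>..\<lceil>B\<rceil>}"
        unfolding k by (auto; linarith)
      thus ?thesis by (auto simp: T_def k)
    qed
    hence "vec_nth x \<in> PiE UNIV (\<lambda>_. T)" by auto
    thus "x \<in> vec_lambda ` (PiE UNIV (\<lambda>_. T))"
      by (metis image_eqI vec_nth_inverse)
  qed
  moreover have "finite (vec_lambda ` (PiE (UNIV :: 'd set) (\<lambda>_. T)))"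
    by (intro finite_imageI finite_PiE) (auto simp: T_def)
  ultimately show ?thesis by (rule finite_subset)
qed

definition count_shift :: "(real ^ 'd) set \<Rightarrow> real ^ 'd \<Rightarrow> nat" where
  "count_shift S w = card {x \<in> integer_points. x - w \<in> S}"

lemma in_translation_image_iff: "x \<in> (+) v ` S \<longleftrightarrow> x - v \<in> S" for x v :: "'a::ab_group_add"
proof
  assume "x - v \<in> S"
  hence "v + (x - v) \<in> (+) v ` S" by (rule imageI)
  thus "x \<in> (+) v ` S" by simp
qed auto

lemma finite_count_shift:
  fixes S :: "(real ^ 'd) set"
  assumes "bounded S"
  shows "finite {x \<in> integer_points. x - w \<in> S}"
proof -
  have "{x \<in> integer_points. x - w \<in> S} \<subseteq> (+) w ` S \<inter> integer_points"
    by (auto simp: in_translation_image_iff)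
  moreover have "bounded ((+) w ` S)"
    using assms by (rule bounded_translation)
  ultimately show ?thesis
    using finite_integer_points_bounded finite_subset by blast
qed

lemma count_shift_periodic:
  assumes "z \<in> integer_points"
  shows "count_shift S (w + z) = count_shift S w"
proof -
  have "bij_betw (\<lambda>x. x + z) {x \<in> integer_points. x - w \<in> S} {x \<in> integer_points. x - (w + z) \<in> S}"
    by (rule bij_betw_byWitness[where f' = "\<lambda>x. x - z"])
       (auto simp: assms integer_points_add integer_points_diff diff_diff_eq add.commute)
  thus ?thesis
    unfolding count_shift_def by (rule bij_betw_same_card[symmetric])
qed

lemma count_shift_cong_integer:
  assumes "w - w' \<in> integer_points"
  shows "count_shift S w = count_shift S w'"
  using count_shift_periodic[OF assms, of S w'] by simp

lemma count_shift_translate: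
  assumes "v \<in> integer_points"
  shows "count_shift ((+) v ` S) w = count_shift S w"
proof -
  have "x - w \<in> (+) v ` S \<longleftrightarrow> x - (w + v) \<in> S" for x
    by (simp add: in_translation_image_iff diff_diff_eq)
  hence "count_shift ((+) v ` S) w = count_shift S (w + v)"
    by (simp add: count_shift_def)
  thus ?thesis using assms by (simp add: count_shift_periodic)
qed

text \<open>\<open>k\<close> is a unit modulo \<open>m\<close>, so multiplication by it permutes the
  finite cyclic group that \<open>w\<close> generates modulo the lattice. Any \<open>m\<close>
  clearing the denominators may be used; vectors with irrational coordinates are not
  constrained.\<close>

definition unit_invariant :: "(real ^ 'd) set \<Rightarrow> bool" where
  "unit_invariant S \<longleftrightarrow> (\<forall>w m k. m > 0 \<longrightarrow> real m *\<^sub>R w \<in> integer_points \<longrightarrow> coprime k m \<longrightarrow>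
     count_shift S (real k *\<^sub>R w) = count_shift S w)"

text \<open>\<open>V\<close> may contain points that are not vertices, so a face is described by a
  subset of \<open>V\<close> without discussing its extreme points.\<close>

definition lattice_hull :: "(real ^ 'd) set \<Rightarrow> bool" where
  "lattice_hull P \<longleftrightarrow> (\<exists>V. finite V \<and> V \<noteq> {} \<and> V \<subseteq> integer_points \<and> P = convex hull V)"

lemma lattice_polytope_imp_lattice_hull:
  assumes "lattice_polytope P"
  shows "lattice_hull P"
proof -
  have P: "polytope P" "P \<noteq> {}" "{x. x extreme_point_of P} \<subseteq> integer_points"
    using assms by (auto simp: lattice_polytope_def)
  have "P = convex hull {x. x extreme_point_of P}"
    by (rule Krein_Milman_Minkowski) (use P(1) polytope_imp_compact polytope_imp_convex in auto)
  moreover have "finite {x. x extreme_point_of P}"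
    using P(1) by (simp add: finite_polyhedron_extreme_points polytope_imp_polyhedron)
  ultimately show ?thesis
    unfolding lattice_hull_def using P by (metis convex_hull_empty)
qed

lemma rational_points_common_denominator:
  assumes "(c :: real ^ 'd) \<in> rational_points"
  obtains m :: nat where "m > 0" "real m *\<^sub>R c \<in> integer_points"
proof -
  have "\<forall>i. \<exists>n::nat. n > 0 \<and> real n * c $ i \<in> \<int>"
  proof
    fix i
    have "c $ i \<in> \<rat>" using assms by (simp add: rational_points_def)
    then obtain a b :: int where ab: "b > 0" "c $ i = of_int a / of_int b"
      by (metis Rats_cases')
    have "real (nat b) * c $ i = of_int a" using ab by simp
    thus "\<exists>n::nat. n > 0 \<and> real n * c $ i \<in> \<int>"
      using ab by (intro exI[of _ "nat b"]) simp
  qed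
  then obtain n where n: "\<And>i. n i > (0::nat)" "\<And>i. real (n i) * c $ i \<in> \<int>" by metis
  define m where "m = (\<Prod>i\<in>UNIV. n i)"
  show ?thesis
  proof (rule that)
    show "m > 0" unfolding m_def using n(1) by (intro prod_pos) auto
    have "real m * c $ i \<in> \<int>" for i
    proof -
      have "n i dvd m" unfolding m_def by (rule dvd_prodI) auto
      then obtain q where "m = n i * q" by (rule dvdE)
      hence "real m * c $ i = real q * (real (n i) * c $ i)" by simp
      thus ?thesis using n(2) by (metis Ints_mult Ints_of_nat)
    qed
    thus "real m *\<^sub>R c \<in> integer_points" by (simp add: integer_points_def)
  qed
qed

subsection \<open>Counts near a rational translation vector\<close>

text \<open>Extends integrality beyond \<open>integer_points\<close>, because the cone over a
  lattice polytope lives in a product with the real line.\<close>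

definition intvec :: "'a::euclidean_space \<Rightarrow> bool" where
  "intvec x \<longleftrightarrow> (\<forall>b\<in>Basis. x \<bullet> b \<in> \<int>)"

lemma intvec_inner: "intvec x \<Longrightarrow> intvec y \<Longrightarrow> x \<bullet> y \<in> \<int>"
  unfolding euclidean_inner[of x y] intvec_def by (intro Ints_sum Ints_mult) auto

lemma intvec_iff_integer_points: "intvec x \<longleftrightarrow> x \<in> integer_points"
  by (auto simp: intvec_def integer_points_def Basis_vec_def inner_axis)

lemma intvec_Pair: "intvec (x, y) \<longleftrightarrow> intvec x \<and> intvec y"
  by (auto simp: intvec_def Basis_prod_def ball_Un)

lemma intvec_real: "intvec (x :: real) \<longleftrightarrow> x \<in> \<int>"
  by (simp add: intvec_def)

lemma integer_points_inner: "x \<in> integer_points \<Longrightarrow> y \<in> integer_points \<Longrightarrow> x \<bullet> y \<in> \<int>"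
  using intvec_inner intvec_iff_integer_points by blast

text \<open>One step of Fourier--Motzkin elimination.\<close>

lemma integer_cone_add_ray:
  fixes A :: "'a::euclidean_space set"
  assumes A: "finite A" "\<And>a. a \<in> A \<Longrightarrow> intvec a" and r: "intvec r"
  shows "\<exists>B. finite B \<and> (\<forall>b\<in>B. intvec b) \<and>
    {y. \<exists>\<tau>\<ge>0. \<forall>a\<in>A. 0 \<le> a \<bullet> (y - \<tau> *\<^sub>R r)} = {y. \<forall>b\<in>B. 0 \<le> b \<bullet> y}"
proof -
  define Pos where "Pos = {a\<in>A. a \<bullet> r > 0}"
  define Neg where "Neg = {a\<in>A. a \<bullet> r < 0}"
  \<comment> \<open>Constraints with \<open>a \<bullet> r > 0\<close> bound \<tau> from above by
    \<open>(a \<bullet> y) / (a \<bullet> r)\<close>, those with a negative product bound it from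
    below. A combined row says that a lower bound does not exceed an upper one, and the rows that
    are kept do the same for the lower bound 0. The products with \<open>r\<close> are integers, so
    the rows stay integral.\<close>
  define B where "B = {a\<in>A. a \<bullet> r \<ge> 0} \<union> (\<lambda>(a, b). (a \<bullet> r) *\<^sub>R b - (b \<bullet> r) *\<^sub>R a) ` (Pos \<times> Neg)"
  have fin: "finite Pos" "finite Neg" using A by (auto simp: Pos_def Neg_def)
  have "finite B" unfolding B_def using fin A by auto
  moreover have "intvec b" if "b \<in> B" for b
  proof -
    have "intvec ((a \<bullet> r) *\<^sub>R b - (b \<bullet> r) *\<^sub>R a)" if "a \<in> A" "b \<in> A" for a b
      using intvec_inner[OF A(2)[OF that(1)] r] intvec_inner[OF A(2)[OF that(2)] r] A(2)[OF that(1)] A(2)[OF that(2)]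
      unfolding intvec_def by (auto simp: inner_diff_left intro!: Ints_diff Ints_mult)
    thus ?thesis using that A by (auto simp: B_def Pos_def Neg_def)
  qed
  moreover have "(\<exists>\<tau>\<ge>0. \<forall>a\<in>A. 0 \<le> a \<bullet> (y - \<tau> *\<^sub>R r)) \<longleftrightarrow> (\<forall>b\<in>B. 0 \<le> b \<bullet> y)" for y
  proof
    assume "\<exists>\<tau>\<ge>0. \<forall>a\<in>A. 0 \<le> a \<bullet> (y - \<tau> *\<^sub>R r)"
    then obtain \<tau> where t: "\<tau> \<ge> 0" "\<And>a. a \<in> A \<Longrightarrow> \<tau> * (a \<bullet> r) \<le> a \<bullet> y"
      by (auto simp: inner_diff_right)
    show "\<forall>b\<in>B. 0 \<le> b \<bullet> y"
    proof
      fix b assume "b \<in> B"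
      then consider "b \<in> A" "b \<bullet> r \<ge> 0"
        | a c where "a \<in> Pos" "c \<in> Neg" "b = (a \<bullet> r) *\<^sub>R c - (c \<bullet> r) *\<^sub>R a"
        by (auto simp: B_def)
      thus "0 \<le> b \<bullet> y"
      proof cases
        case 1
        thus ?thesis using t by (meson mult_nonneg_nonneg order_trans)
      next
        case 2
        have "(a \<bullet> r) * (\<tau> * (c \<bullet> r)) \<le> (a \<bullet> r) * (c \<bullet> y)"
          using 2 t(2)[of c] by (intro mult_left_mono) (auto simp: Pos_def Neg_def)
        moreover have "(- (c \<bullet> r)) * (\<tau> * (a \<bullet> r)) \<le> (- (c \<bullet> r)) * (a \<bullet> y)"
          using 2 t(2)[of a] by (intro mult_left_mono) (auto simp: Pos_def Neg_def)
        ultimately show ?thesis by (simp add: 2 inner_diff_left algebra_simps)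
      qed
    qed
  next
    assume B: "\<forall>b\<in>B. 0 \<le> b \<bullet> y"
    define Lo where "Lo = insert 0 ((\<lambda>b. (b \<bullet> y) / (b \<bullet> r)) ` Neg)"
    have Lo: "finite Lo" "Lo \<noteq> {}" using fin by (auto simp: Lo_def)
    define \<tau> where "\<tau> = Max Lo"
    have "0 \<le> \<tau>" unfolding \<tau>_def using Lo by (intro Max_ge) (auto simp: Lo_def)
    moreover have "0 \<le> a \<bullet> (y - \<tau> *\<^sub>R r)" if "a \<in> A" for a
    proof -
      consider "a \<bullet> r = 0" | "a \<bullet> r < 0" | "a \<bullet> r > 0" by linarith
      thus ?thesis
      proof cases
        case 1
        thus ?thesis using B that by (auto simp: B_def inner_diff_right)
      next
        case 2
        have "(a \<bullet> y) / (a \<bullet> r) \<le> \<tau>"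
          unfolding \<tau>_def using Lo 2 that by (intro Max_ge) (auto simp: Lo_def Neg_def)
        thus ?thesis using 2 by (simp add: inner_diff_right field_simps)
      next
        case 3
        have "l \<le> (a \<bullet> y) / (a \<bullet> r)" if "l \<in> Lo" for l
          using that unfolding Lo_def
        proof safe
          have "0 \<le> a \<bullet> y" using B 3 \<open>a \<in> A\<close> by (auto simp: B_def)
          thus "0 \<le> (a \<bullet> y) / (a \<bullet> r)" using 3 by simp
        next
          fix b assume b: "b \<in> Neg"
          have "(a \<bullet> r) *\<^sub>R b - (b \<bullet> r) *\<^sub>R a \<in> B"
            using b 3 \<open>a \<in> A\<close> by (auto simp: B_def Pos_def)
          hence "0 \<le> (a \<bullet> r) * (b \<bullet> y) - (b \<bullet> r) * (a \<bullet> y)"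
            using B by (fastforce simp: inner_diff_left)
          thus "(b \<bullet> y) / (b \<bullet> r) \<le> (a \<bullet> y) / (a \<bullet> r)"
            using 3 b by (simp add: Neg_def field_simps)
        qed
        hence "\<tau> \<le> (a \<bullet> y) / (a \<bullet> r)" unfolding \<tau>_def using Lo by simp
        thus ?thesis using 3 by (simp add: inner_diff_right field_simps)
      qed
    qed
    ultimately show "\<exists>\<tau>\<ge>0. \<forall>a\<in>A. 0 \<le> a \<bullet> (y - \<tau> *\<^sub>R r)" by blast
  qed
  ultimately show ?thesis by (intro exI[of _ B]) auto
qed

text \<open>Adding a generator sweeps the cone along a ray, so the inequalities are found by
  eliminating one coefficient at a time. The induction starts at the zero cone, which is cut out by
  the unit vectors and their negatives.\<close>

lemma integer_cone_halfspaces: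
  fixes f :: "'i \<Rightarrow> 'a::euclidean_space"
  assumes "finite V" "\<And>v. v \<in> V \<Longrightarrow> intvec (f v)"
  shows "\<exists>B. finite B \<and> (\<forall>b\<in>B. intvec b) \<and>
    {y. \<exists>l. (\<forall>v\<in>V. 0 \<le> l v) \<and> y = (\<Sum>v\<in>V. l v *\<^sub>R f v)} = {y. \<forall>b\<in>B. 0 \<le> b \<bullet> y}"
  using assms
proof (induction V rule: finite_induct)
  case empty
  let ?B = "Basis \<union> uminus ` Basis :: 'a set"
  have "intvec b" if "b \<in> ?B" for b
    using that by (auto simp: intvec_def inner_Basis)
  moreover have "(y = 0) \<longleftrightarrow> (\<forall>b\<in>?B. 0 \<le> b \<bullet> y)" for y :: 'a
  proof
    assume r: "\<forall>b\<in>?B. 0 \<le> b \<bullet> y"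
    have "y \<bullet> b = 0" if "b \<in> Basis" for b
    proof -
      have "0 \<le> b \<bullet> y" "0 \<le> (- b) \<bullet> y" using r that by blast+
      thus ?thesis by (simp add: inner_commute)
    qed
    thus "y = 0" by (intro euclidean_eqI[of y 0]) auto
  qed auto
  ultimately show ?case by (intro exI[of _ ?B]) auto
next
  case (insert v V)
  then obtain A where A: "finite A" "\<And>b. b \<in> A \<Longrightarrow> intvec b"
    "{y. \<exists>l. (\<forall>v\<in>V. 0 \<le> l v) \<and> y = (\<Sum>v\<in>V. l v *\<^sub>R f v)} = {y. \<forall>b\<in>A. 0 \<le> b \<bullet> y}"
  proof -
    have "\<exists>B. finite B \<and> (\<forall>b\<in>B. intvec b) \<and>
        {y. \<exists>l. (\<forall>v\<in>V. 0 \<le> l v) \<and> y = (\<Sum>v\<in>V. l v *\<^sub>R f v)} = {y. \<forall>b\<in>B. 0 \<le> b \<bullet> y}"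
      using insert.prems by (intro insert.IH) auto
    thus ?thesis using that by blast
  qed
  obtain B where B: "finite B" "\<And>b. b \<in> B \<Longrightarrow> intvec b"
    "{y. \<exists>\<tau>\<ge>0. \<forall>a\<in>A. 0 \<le> a \<bullet> (y - \<tau> *\<^sub>R f v)} = {y. \<forall>b\<in>B. 0 \<le> b \<bullet> y}"
  proof -
    have "intvec (f v)" using insert.prems by simp
    from integer_cone_add_ray[OF A(1,2) this] show ?thesis using that by blast
  qed
  have "(\<exists>l. (\<forall>v\<in>insert v V. 0 \<le> l v) \<and> y = (\<Sum>v\<in>insert v V. l v *\<^sub>R f v))
     \<longleftrightarrow> (\<exists>\<tau>\<ge>0. y - \<tau> *\<^sub>R f v \<in> {y. \<exists>l. (\<forall>v\<in>V. 0 \<le> l v) \<and> y = (\<Sum>v\<in>V. l v *\<^sub>R f v)})" (is "?L \<longleftrightarrow> ?R") for y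
  proof
    assume ?L
    then obtain l where "\<forall>v\<in>insert v V. 0 \<le> l v" "y = (\<Sum>v\<in>insert v V. l v *\<^sub>R f v)" by blast
    thus ?R using insert.hyps by (intro exI[of _ "l v"]) auto
  next
    assume ?R
    then obtain \<tau> l where l: "\<tau> \<ge> 0" "\<forall>v\<in>V. 0 \<le> l v" "y - \<tau> *\<^sub>R f v = (\<Sum>v\<in>V. l v *\<^sub>R f v)" by blast
    have "(\<Sum>x\<in>V. (l(v := \<tau>)) x *\<^sub>R f x) = (\<Sum>v\<in>V. l v *\<^sub>R f v)"
      using insert.hyps by (intro sum.cong) auto
    hence "y = (\<Sum>x\<in>insert v V. (l(v := \<tau>)) x *\<^sub>R f x)"
      using l insert.hyps by (simp add: algebra_simps)
    thus ?L using l by (intro exI[of _ "l(v := \<tau>)"]) auto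
  qed
  thus ?case using A(3) B by (intro exI[of _ B]) auto
qed

text \<open>A point lies in the hull of \<open>V\<close> exactly if its lift to height 1 lies in the
  cone over the lifted \<open>V\<close>. Integrality of the inequalities later keeps their values at
  lattice points in a discrete set.\<close>

lemma lattice_hull_halfspaces:
  assumes "lattice_hull (P :: (real ^ 'd) set)"
  obtains A where "finite A" "A \<subseteq> integer_points \<times> \<int>" "P = {x. \<forall>(a, b)\<in>A. b \<le> a \<bullet> x}"
proof -
  obtain V where V: "finite V" "V \<subseteq> integer_points" "P = convex hull V"
    using assms by (auto simp: lattice_hull_def)
  obtain B where B: "finite B" "\<And>b. b \<in> B \<Longrightarrow> intvec b"
    "{y. \<exists>l. (\<forall>v\<in>V. 0 \<le> l v) \<and> y = (\<Sum>v\<in>V. l v *\<^sub>R (v, 1::real))} = {y. \<forall>b\<in>B. 0 \<le> b \<bullet> y}"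
  proof -
    have "intvec (v, 1::real)" if "v \<in> V" for v
      using that V(2) by (auto simp: intvec_Pair intvec_iff_integer_points intvec_real)
    thus ?thesis using integer_cone_halfspaces[OF V(1), of "\<lambda>v. (v, 1::real)"] that by blast
  qed
  define A where "A = (\<lambda>(a, b). (a, - b)) ` B"
  have "x \<in> P \<longleftrightarrow> (x, 1) \<in> {y. \<exists>l. (\<forall>v\<in>V. 0 \<le> l v) \<and> y = (\<Sum>v\<in>V. l v *\<^sub>R (v, 1::real))}" for x
    unfolding V convex_hull_finite[OF V(1)] by (auto simp: sum_prod)
  hence "x \<in> P \<longleftrightarrow> (\<forall>(a, b)\<in>A. b \<le> a \<bullet> x)" for x
    unfolding B(3) by (auto simp: A_def inner_Pair split: prod.splits)
  hence "P = {x. \<forall>(a, b)\<in>A. b \<le> a \<bullet> x}" by blast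
  moreover have "A \<subseteq> integer_points \<times> \<int>"
    using B(2) by (auto simp: A_def intvec_Pair intvec_iff_integer_points intvec_real)
  moreover have "finite A" using B by (simp add: A_def)
  ultimately show ?thesis using that by blast
qed

section \<open>Perturbations of a rational vector\<close>

text \<open>Simultaneous approximation puts a positive integer multiple of \<eta> very close to a
  lattice point \<open>z\<close>. Where \<open>a \<bullet> \<eta> = 0\<close>, the integer
  \<open>a \<bullet> z\<close> is less than 1 in absolute value, hence 0; elsewhere the error is too
  small to change the sign.\<close>

lemma integer_vector_same_signs:
  fixes A :: "(real ^ 'd) set" and \<eta> :: "real ^ 'd"
  assumes A: "finite A" "A \<subseteq> integer_points"
  obtains z where "z \<in> integer_points" "\<And>a. a \<in> A \<Longrightarrow> sgn (a \<bullet> z) = sgn (a \<bullet> \<eta>)"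
proof -
  obtain e :: "nat \<Rightarrow> 'd" where e: "bij_betw e {..<CARD('d)} UNIV"
    using ex_bij_betw_nat_finite[of "UNIV :: 'd set"] by (auto simp: lessThan_atLeast0)
  define s where "s a = (\<Sum>i\<in>UNIV. \<bar>a $ i\<bar>)" for a :: "real ^ 'd"
  \<comment> \<open>\<open>s a / N\<close> will bound the error in \<open>a \<bullet> z\<close>. The
    first family makes it less than 1, the second less than
    \<open>\<bar>a \<bullet> \<eta>\<bar>\<close>.\<close>
  define R where "R = insert 1 ((\<lambda>a. s a) ` A \<union> (\<lambda>a. s a / \<bar>a \<bullet> \<eta>\<bar>) ` A)"
  have R: "finite R" using A by (simp add: R_def)
  obtain N :: nat where N: "Max R < real N" using reals_Archimedean2 by blast
  have RN: "r < real N" if "r \<in> R" for r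
    using Max_ge[OF R that] N by linarith
  have N0: "N > 0" using RN[of 1] by (simp add: R_def)
  obtain q p where q: "0 < q" and p: "\<And>i. i < CARD('d) \<Longrightarrow> \<bar>of_int q * (\<eta> $ e i) - of_int (p i)\<bar> < 1 / N"
    using Dirichlet_approx_simult[OF N0, of "CARD('d)" "\<lambda>i. \<eta> $ e i"] by blast
  define z :: "real ^ 'd" where "z = (\<chi> j. of_int (p (inv_into {..<CARD('d)} e j)))"
  have z: "\<bar>of_int q * (\<eta> $ j) - z $ j\<bar> \<le> 1 / N" for j
    using p[of "inv_into {..<CARD('d)} e j"] bij_betw_inv_into_right[OF e, of j]
      bij_betw_apply[OF bij_betw_inv_into[OF e], of j]
    by (auto simp: z_def)
  have zint: "z \<in> integer_points" by (auto simp: z_def integer_points_def)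
  have "sgn (a \<bullet> z) = sgn (a \<bullet> \<eta>)" if "a \<in> A" for a
  proof -
    have "of_int q * (a \<bullet> \<eta>) - a \<bullet> z = (\<Sum>i\<in>UNIV. a $ i * (of_int q * \<eta> $ i - z $ i))"
      by (simp add: inner_vec_def sum_distrib_left sum_subtractf algebra_simps)
    also have "\<bar>\<dots>\<bar> \<le> (\<Sum>i\<in>UNIV. \<bar>a $ i\<bar> * (1 / N))"
    proof (intro order_trans[OF sum_abs] sum_mono)
      show "\<bar>a $ i * (of_int q * \<eta> $ i - z $ i)\<bar> \<le> \<bar>a $ i\<bar> * (1 / N)" for i
        unfolding abs_mult using z by (intro mult_left_mono) auto
    qed
    finally have b: "\<bar>of_int q * (a \<bullet> \<eta>) - a \<bullet> z\<bar> \<le> s a / N"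
      by (simp add: s_def sum_divide_distrib)
    show ?thesis
    proof (cases "a \<bullet> \<eta> = 0")
      case True
      have "s a < N" using RN that by (auto simp: R_def)
      hence "s a / N < 1" using N0 by simp
      hence "\<bar>a \<bullet> z\<bar> < 1" using b True by simp
      moreover have "a \<bullet> z \<in> \<int>" using A that zint by (intro integer_points_inner) auto
      ultimately have "a \<bullet> z = 0" by (rule Ints_nonzero_abs_less1[rotated])
      thus ?thesis using True by simp
    next
      case False
      have "s a / \<bar>a \<bullet> \<eta>\<bar> < N" using RN that by (auto simp: R_def)
      hence "s a / N < \<bar>a \<bullet> \<eta>\<bar>" using False N0 by (simp add: field_simps)
      also have "\<bar>a \<bullet> \<eta>\<bar> \<le> \<bar>of_int q * (a \<bullet> \<eta>)\<bar>"
        using q by (simp add: abs_mult mult_le_cancel_right1)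
      finally have "\<bar>of_int q * (a \<bullet> \<eta>) - a \<bullet> z\<bar> < \<bar>of_int q * (a \<bullet> \<eta>)\<bar>" using b by linarith
      hence "sgn (a \<bullet> z) = sgn (of_int q * (a \<bullet> \<eta>))"
        by (auto simp: sgn_if abs_if split: if_splits)
      thus ?thesis using q by (simp add: sgn_mult)
    qed
  qed
  thus ?thesis using that zint by blast
qed

lemma Ints_gap:
  fixes r :: real
  obtains \<delta> where "\<delta> > 0" "\<And>n. n \<in> \<int> \<Longrightarrow> n \<noteq> r \<Longrightarrow> \<delta> \<le> \<bar>n - r\<bar>"
proof -
  define \<delta> where "\<delta> = (if r \<in> \<int> then 1 else min (frac r) (1 - frac r))"
  have "\<delta> > 0" by (auto simp: \<delta>_def frac_lt_1 frac_gt_0_iff)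
  moreover have "\<delta> \<le> \<bar>n - r\<bar>" if n: "n \<in> \<int>" "n \<noteq> r" for n
  proof (cases "r \<in> \<int>")
    case True
    have "n - r \<in> \<int>" using True n by simp
    thus ?thesis using True n Ints_nonzero_abs_ge1[of "n - r"] by (simp add: \<delta>_def)
  next
    case False
    obtain k where k: "n = of_int k" using n by (auto simp: Ints_def)
    have "k \<le> \<lfloor>r\<rfloor> \<or> k \<ge> \<lfloor>r\<rfloor> + 1" by linarith
    thus ?thesis using False by (auto simp: \<delta>_def frac_def k min_def; linarith)
  qed
  ultimately show ?thesis using that by blast
qed

text \<open>The constraint values at lattice points lie in a translate of \<open>\<int>\<close>, hence \<open>\<epsilon>\<close> is uniform in \<open>x\<close>.\<close>

lemma local_membership:
  fixes A :: "((real ^ 'd) \<times> real) set"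
  assumes A: "finite A" "A \<subseteq> integer_points \<times> \<int>"
    and P: "P = {x. \<forall>(a, b)\<in>A. b \<le> a \<bullet> x}"
  obtains \<epsilon> where "\<epsilon> > 0"
    "\<And>x \<eta>. x \<in> integer_points \<Longrightarrow> norm \<eta> < \<epsilon> \<Longrightarrow>
       x - (w + \<eta>) \<in> P \<longleftrightarrow> x - w \<in> P \<and> (\<forall>(a, b)\<in>A. a \<bullet> (x - w) = b \<longrightarrow> sgn (a \<bullet> \<eta>) \<noteq> 1)"
proof -
  have "\<exists>\<delta>>0. \<forall>n\<in>\<int>. n \<noteq> a \<bullet> w \<longrightarrow> \<delta> \<le> \<bar>n - a \<bullet> w\<bar>" for a
    using Ints_gap[of "a \<bullet> w"] by metis
  then obtain \<delta> where d: "\<And>a. \<delta> a > 0" "\<And>a n. n \<in> \<int> \<Longrightarrow> n \<noteq> a \<bullet> w \<Longrightarrow> \<delta> a \<le> \<bar>n - a \<bullet> w\<bar>"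
    by metis
  \<comment> \<open>The summand 1 in the denominator admits \<open>a = 0\<close>, and the inserted 1
    keeps the set nonempty when there are no inequalities.\<close>
  define E where "E = insert 1 ((\<lambda>(a, b). \<delta> a / (1 + norm a)) ` A)"
  have E: "finite E" using A by (simp add: E_def)
  have Epos: "e > 0" if "e \<in> E" for e
    using that d(1) by (auto simp: E_def intro!: divide_pos_pos add_pos_nonneg)
  define \<epsilon> where "\<epsilon> = Min E"
  have "\<epsilon> > 0" unfolding \<epsilon>_def using E Epos by (subst Min_gr_iff) (auto simp: E_def)
  moreover have "x - (w + \<eta>) \<in> P \<longleftrightarrow> x - w \<in> P \<and> (\<forall>(a, b)\<in>A. a \<bullet> (x - w) = b \<longrightarrow> sgn (a \<bullet> \<eta>) \<noteq> 1)"
    if x: "x \<in> integer_points" and n: "norm \<eta> < \<epsilon>" for x \<eta>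
  proof -
    have "b \<le> a \<bullet> (x - (w + \<eta>)) \<longleftrightarrow> b \<le> a \<bullet> (x - w) \<and> (a \<bullet> (x - w) = b \<longrightarrow> sgn (a \<bullet> \<eta>) \<noteq> 1)"
      if ab: "(a, b) \<in> A" for a b
    proof -
      have "\<epsilon> \<le> \<delta> a / (1 + norm a)" unfolding \<epsilon>_def using E ab by (intro Min_le) (auto simp: E_def)
      hence "norm \<eta> * (1 + norm a) < \<delta> a"
        using n by (smt (verit) norm_ge_zero pos_less_divide_eq)
      moreover have "\<bar>a \<bullet> \<eta>\<bar> \<le> norm a * norm \<eta>" by (rule Cauchy_Schwarz_ineq2)
      ultimately have small: "\<bar>a \<bullet> \<eta>\<bar> < \<delta> a"
        using norm_ge_zero[of \<eta>] by (simp only: distrib_left mult.commute[of "norm a"])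
      have "a \<bullet> x - b \<in> \<int>" using A(2) ab x by (intro Ints_diff integer_points_inner) auto
      \<comment> \<open>Either the inequality is tight at \<open>x - w\<close>, and then the sign of
        \<open>a \<bullet> \<eta>\<close> decides, or its value is at least
        \<open>\<delta> a\<close> away from equality, which the perturbation cannot bridge.\<close>
      hence "a \<bullet> x - b = a \<bullet> w \<or> \<delta> a \<le> \<bar>a \<bullet> x - b - a \<bullet> w\<bar>" using d(2) by blast
      thus ?thesis using small d(1)[of a]
        by (auto simp: inner_diff_right inner_add_right sgn_if abs_if split: if_splits)
    qed
    thus ?thesis unfolding P by fast
  qed
  ultimately show ?thesis using that by blast
qed

text \<open>The purpose is a single multiplier, still a unit, that acts as \<open>k\<close> on
  vectors of denominator \<open>m\<close> and as the sign \<open>s\<close> on vectors of denominator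
  \<open>N\<close>.\<close>

lemma coprime_imp_cong_sign:
  fixes m N k :: nat and s :: int
  assumes "coprime m N" "coprime k m" "N > 1" "s = 1 \<or> s = - 1"
  obtains k' where "coprime k' (m * N)" "int m dvd int k' - int k" "int N dvd int k' - s"
proof -
  \<comment> \<open>The natural number that represents \<open>s\<close> modulo
    \<open>N\<close>.\<close>
  define u where "u = (if s = 1 then 1 else N - 1)"
  obtain k' where k': "[k' = k] (mod m)" "[k' = u] (mod N)"
    using binary_chinese_remainder_nat[OF assms(1)] by blast
  have "coprime u N" using assms(3) coprime_diff_one_left_nat[of N] by (auto simp: u_def)
  hence "coprime k' N" using k'(2) by (metis cong_imp_coprime cong_sym)
  moreover have "coprime k' m" using k'(1) assms(2) by (metis cong_imp_coprime cong_sym)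
  ultimately have 1: "coprime k' (m * N)" by simp
  have 2: "int m dvd int k' - int k" using k'(1) by (metis cong_iff_dvd_diff cong_int_iff)
  have "int N dvd int k' - int u" using k'(2) by (metis cong_iff_dvd_diff cong_int_iff)
  moreover have "int N dvd int u - s" using assms(3,4) by (auto simp: u_def of_nat_diff)
  ultimately have "int N dvd int k' - s" by (metis diff_add_cancel dvd_add add_diff_eq)
  thus ?thesis using that 1 2 by blast
qed

text \<open>A unit modulo \<open>m * N\<close> acts as \<open>k\<close> on \<open>w\<close> and as
  \<open>s\<close> on a rational replacement of \<eta> with the same signs; local constancy on both
  sides lets the replacement be undone. Later \<open>s = 1\<close> serves for passing to faces and
  \<open>s = - 1\<close> for comparing opposite ones.\<close>

lemma unit_invariant_local:
  fixes P :: "(real ^ 'd) set" and s :: int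
  assumes P: "unit_invariant P" "lattice_hull P"
    and w: "m > 0" "real m *\<^sub>R w \<in> integer_points" "coprime k m" and s: "s = 1 \<or> s = - 1"
  obtains \<epsilon> where "\<epsilon> > 0"
    "\<And>\<eta>. norm \<eta> < \<epsilon> \<Longrightarrow> count_shift P (w + \<eta>) = count_shift P (real k *\<^sub>R w + of_int s *\<^sub>R \<eta>)"
proof -
  obtain A where A: "finite A" "A \<subseteq> integer_points \<times> \<int>" "P = {x. \<forall>(a, b)\<in>A. b \<le> a \<bullet> x}"
    by (rule lattice_hull_halfspaces[OF P(2)]) blast
  have cong: "\<exists>\<epsilon>>0. \<forall>\<eta> \<eta>'. norm \<eta> < \<epsilon> \<longrightarrow> norm \<eta>' < \<epsilon> \<longrightarrow> (\<forall>a\<in>fst ` A. sgn (a \<bullet> \<eta>) = sgn (a \<bullet> \<eta>')) \<longrightarrow>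
      count_shift P (w' + \<eta>) = count_shift P (w' + \<eta>')" for w'
  proof -
    obtain \<epsilon> where e: "\<epsilon> > 0" "\<And>x \<eta>. x \<in> integer_points \<Longrightarrow> norm \<eta> < \<epsilon> \<Longrightarrow>
       x - (w' + \<eta>) \<in> P \<longleftrightarrow> x - w' \<in> P \<and> (\<forall>(a, b)\<in>A. a \<bullet> (x - w') = b \<longrightarrow> sgn (a \<bullet> \<eta>) \<noteq> 1)"
      by (rule local_membership[OF A]) blast
    have "count_shift P (w' + \<eta>) = count_shift P (w' + \<eta>')"
      if "norm \<eta> < \<epsilon>" "norm \<eta>' < \<epsilon>" and sg: "\<forall>a\<in>fst ` A. sgn (a \<bullet> \<eta>) = sgn (a \<bullet> \<eta>')" for \<eta> \<eta>'
    proof -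
      have sg': "sgn (a \<bullet> \<eta>) = sgn (a \<bullet> \<eta>')" if "(a, b) \<in> A" for a b
        using sg that by force
      have "x - (w' + \<eta>) \<in> P \<longleftrightarrow> x - (w' + \<eta>') \<in> P" if "x \<in> integer_points" for x
        unfolding e(2)[OF that \<open>norm \<eta> < \<epsilon>\<close>] e(2)[OF that \<open>norm \<eta>' < \<epsilon>\<close>] using sg' by fastforce
      thus ?thesis unfolding count_shift_def by (intro arg_cong[of _ _ card]) blast
    qed
    thus ?thesis using e(1) by blast
  qed
  obtain \<epsilon>1 where e1: "\<epsilon>1 > 0" "\<And>\<eta> \<eta>'. norm \<eta> < \<epsilon>1 \<Longrightarrow> norm \<eta>' < \<epsilon>1 \<Longrightarrow>
      (\<And>a. a\<in>fst ` A \<Longrightarrow> sgn (a \<bullet> \<eta>) = sgn (a \<bullet> \<eta>')) \<Longrightarrow> count_shift P (w + \<eta>) = count_shift P (w + \<eta>')"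
    using cong[of w] by blast
  obtain \<epsilon>2 where e2: "\<epsilon>2 > 0" "\<And>\<eta> \<eta>'. norm \<eta> < \<epsilon>2 \<Longrightarrow> norm \<eta>' < \<epsilon>2 \<Longrightarrow>
      (\<And>a. a\<in>fst ` A \<Longrightarrow> sgn (a \<bullet> \<eta>) = sgn (a \<bullet> \<eta>')) \<Longrightarrow>
      count_shift P (real k *\<^sub>R w + \<eta>) = count_shift P (real k *\<^sub>R w + \<eta>')"
    using cong[of "real k *\<^sub>R w"] by blast
  define \<epsilon> where "\<epsilon> = min \<epsilon>1 \<epsilon>2"
  have e: "\<epsilon> > 0" using e1 e2 by (simp add: \<epsilon>_def)
  have "count_shift P (w + \<eta>) = count_shift P (real k *\<^sub>R w + of_int s *\<^sub>R \<eta>)" if n: "norm \<eta> < \<epsilon>" for \<eta>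
  proof -
    have "finite (fst ` A)" "fst ` A \<subseteq> integer_points" using A(1,2) by auto
    then obtain z where z: "z \<in> integer_points" "\<And>a. a \<in> fst ` A \<Longrightarrow> sgn (a \<bullet> z) = sgn (a \<bullet> \<eta>)"
      by (rule integer_vector_same_signs[of "fst ` A" \<eta>]) blast
    obtain M :: nat where M: "norm z / \<epsilon> + 1 < M" using reals_Archimedean2 by blast
    \<comment> \<open>Congruent to 1 modulo \<open>m\<close>, hence coprime to it, and large enough
      for \<open>z\<close> divided by \<open>N\<close> to be a small perturbation.\<close>
    define N where "N = m * M + 1"
    have "M > 0" using M e by (smt (verit) divide_nonneg_pos norm_ge_zero of_nat_0_less_iff)
    hence "M \<le> N" "N > 1" using w(1) by (auto simp: N_def intro: le_SucI)
    hence "real M \<le> real N" by simp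
    have Npos: "real N > 0" using \<open>N > 1\<close> by simp
    have "norm z / \<epsilon> < real N" using M \<open>real M \<le> real N\<close> by linarith
    hence N: "norm z / real N < \<epsilon>" using e Npos by (simp add: field_simps)
    have "coprime m N"
    proof (rule coprimeI)
      fix c assume "c dvd m" "c dvd N"
      thus "is_unit c" unfolding N_def by (metis dvd_add_right_iff dvd_mult2)
    qed
    then obtain k' where k': "coprime k' (m * N)" "int m dvd int k' - int k" "int N dvd int k' - s"
      using coprime_imp_cong_sign[OF _ w(3) \<open>N > 1\<close> s] by blast
    obtain i where i: "int k' - int k = int m * i" using k'(2) by (auto elim: dvdE)
    obtain j where j: "int k' - s = int N * j" using k'(3) by (auto elim: dvdE)
    define \<eta>' where "\<eta>' = (1 / real N) *\<^sub>R z"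
    have n': "norm \<eta>' < \<epsilon>" using N by (simp add: \<eta>'_def)
    have sg: "sgn (a \<bullet> \<eta>') = sgn (a \<bullet> \<eta>)" if "a \<in> fst ` A" for a
      using z(2)[OF that] Npos by (simp add: \<eta>'_def sgn_divide)
    have s1: "\<bar>real_of_int s\<bar> = 1" using s by auto
    have "count_shift P (w + \<eta>) = count_shift P (w + \<eta>')"
      using n n' sg by (intro e1(2)) (auto simp: \<epsilon>_def)
    also have "\<dots> = count_shift P (real k' *\<^sub>R (w + \<eta>'))"
    proof -
      have "real (m * N) *\<^sub>R (w + \<eta>') = real N *\<^sub>R (real m *\<^sub>R w) + real m *\<^sub>R z"
        using Npos by (simp add: \<eta>'_def algebra_simps)
      moreover have "\<dots> \<in> integer_points"
        by (intro integer_points_add integer_points_scale w z Ints_of_nat)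
      ultimately show ?thesis
        using P(1) k'(1) w(1) \<open>N > 1\<close> unfolding unit_invariant_def by (metis mult_pos_pos gr_implies_not0 neq0_conv)
    qed
    \<comment> \<open>Modulo the lattice, \<open>k' - k\<close> kills \<open>w\<close> because it is
      a multiple of \<open>m\<close>, and \<open>k' - s\<close> kills \<open>\<eta>'\<close> because
      it is a multiple of \<open>N\<close>.\<close>
    also have "\<dots> = count_shift P (real k *\<^sub>R w + of_int s *\<^sub>R \<eta>')"
    proof (rule count_shift_cong_integer)
      have "real k' - real k = real m * of_int i" using i by (metis of_int_diff of_int_mult of_int_of_nat_eq)
      moreover have "real k' - of_int s = real N * of_int j" using j by (metis of_int_diff of_int_mult of_int_of_nat_eq)
      ultimately have "of_int i *\<^sub>R (real m *\<^sub>R w) + of_int j *\<^sub>R (real N *\<^sub>R \<eta>')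
          = (real k' - real k) *\<^sub>R w + (real k' - of_int s) *\<^sub>R \<eta>'"
        by (simp add: mult.commute)
      hence "real k' *\<^sub>R (w + \<eta>') - (real k *\<^sub>R w + of_int s *\<^sub>R \<eta>')
          = of_int i *\<^sub>R (real m *\<^sub>R w) + of_int j *\<^sub>R (real N *\<^sub>R \<eta>')"
        by (simp add: algebra_simps)
      moreover have "real N *\<^sub>R \<eta>' = z" using Npos by (simp add: \<eta>'_def)
      moreover have "of_int i *\<^sub>R (real m *\<^sub>R w) \<in> integer_points"
        using w(2) by (rule integer_points_scale) auto
      moreover have "of_int j *\<^sub>R z \<in> integer_points"
        using z(1) by (rule integer_points_scale) auto
      ultimately show "real k' *\<^sub>R (w + \<eta>') - (real k *\<^sub>R w + of_int s *\<^sub>R \<eta>') \<in> integer_points"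
        by (simp only: integer_points_add)
    qed
    also have "\<dots> = count_shift P (real k *\<^sub>R w + of_int s *\<^sub>R \<eta>)"
      using n n' sg s1 by (intro e2(2)) (auto simp: \<epsilon>_def sgn_mult)
    finally show ?thesis .
  qed
  thus ?thesis using that e by blast
qed

subsection \<open>Passing to faces\<close>

text \<open>A nonempty compact interval has exactly one right end point, the only place where its
  indicator exceeds its own limit from the right. Summing these drops over all end points counts
  each interval once, and the zero function has no drops.\<close>

lemma compact_interval_Euler_sum:
  fixes C :: "'i \<Rightarrow> real set" and c :: "'i \<Rightarrow> real"
  assumes I: "finite I" and C: "\<And>i. i \<in> I \<Longrightarrow> compact (C i)" "\<And>i. i \<in> I \<Longrightarrow> convex (C i)"
    and z: "\<And>s. (\<Sum>i\<in>I. if s \<in> C i then c i else 0) = 0"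
  shows "(\<Sum>i\<in>I. if C i \<noteq> {} then c i else 0) = 0"
proof -
  define J where "J = {i\<in>I. C i \<noteq> {}}"
  have J: "finite J" using I by (simp add: J_def)
  have "\<exists>l u. l \<le> u \<and> C i = {l..u}" if "i \<in> J" for i
  proof -
    have "C i \<noteq> {}" "compact (C i)" "connected (C i)"
      using that C by (auto simp: J_def convex_connected)
    then obtain l u where "C i = {l..u}" using connected_compact_interval_1[of "C i"] by auto
    thus ?thesis using \<open>C i \<noteq> {}\<close> by auto
  qed
  then obtain l u where lu: "\<And>i. i \<in> J \<Longrightarrow> l i \<le> u i" "\<And>i. i \<in> J \<Longrightarrow> C i = {l i..u i}" by metis
  have zJ: "(\<Sum>i\<in>J. if s \<in> C i then c i else 0) = 0" for s
  proof -
    have "(\<Sum>i\<in>J. if s \<in> C i then c i else 0) = (\<Sum>i\<in>I. if s \<in> C i then c i else 0)"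
      using I by (intro sum.mono_neutral_left) (auto simp: J_def)
    thus ?thesis using z by simp
  qed
  text \<open>Compare the sum at \<open>s\<close> with the sum slightly to the right of \<open>s\<close>.\<close>
  have right: "(\<Sum>i\<in>{i\<in>J. u i = s}. c i) = 0" for s
  proof -
    define T where "T = {x \<in> l ` J \<union> u ` J. x > s}"
    \<comment> \<open>A point strictly between \<open>s\<close> and the next end point, or any
      larger point if there is none.\<close>
    define s' where "s' = (if T = {} then s + 1 else (s + Min T) / 2)"
    have T: "finite T" using J by (simp add: T_def)
    have s': "s < s'" "\<And>x. x \<in> T \<Longrightarrow> s' < x"
    proof -
      have "Min T > s" if "T \<noteq> {}" using T that by (subst Min_gr_iff) (auto simp: T_def)
      thus "s < s'" by (auto simp: s'_def)
      fix x assume "x \<in> T"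
      hence "Min T \<le> x" "T \<noteq> {}" using T by auto
      thus "s' < x" using \<open>T \<noteq> {} \<Longrightarrow> Min T > s\<close> by (auto simp: s'_def)
    qed
    have mem: "(if s \<in> C i then c i else 0) - (if s' \<in> C i then c i else 0) = (if u i = s then c i else 0)"
      if i: "i \<in> J" for i
    proof -
      have "l i > s \<Longrightarrow> l i > s'" "u i > s \<Longrightarrow> u i > s'" using s'(2) i by (auto simp: T_def)
      thus ?thesis using s'(1) lu[OF i] by auto
    qed
    have "0 = (\<Sum>i\<in>J. if s \<in> C i then c i else 0) - (\<Sum>i\<in>J. if s' \<in> C i then c i else 0)"
      by (simp add: zJ)
    also have "\<dots> = (\<Sum>i\<in>J. if u i = s then c i else 0)"
      unfolding sum_subtractf[symmetric] by (intro sum.cong mem refl)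
    also have "\<dots> = (\<Sum>i\<in>{i\<in>J. u i = s}. c i)"
      using J by (simp add: sum.inter_filter)
    finally show ?thesis by simp
  qed
  have "(\<Sum>i\<in>J. c i) = (\<Sum>s\<in>u ` J. \<Sum>i\<in>{i\<in>J. u i = s}. c i)"
    by (rule sum.image_gen[OF J])
  also have "\<dots> = 0" using right by simp
  finally have "(\<Sum>i\<in>J. c i) = 0" .
  thus ?thesis unfolding J_def using I by (simp add: sum.inter_filter)
qed

text \<open>Groemer's theorem that the Euler characteristic is well defined on indicator functions of
  compact convex sets; the induction fibres over one coordinate after the other.\<close>

lemma compact_convex_Euler_sum:
  fixes C :: "'i \<Rightarrow> 'a::euclidean_space set" and c :: "'i \<Rightarrow> real"
  assumes I: "finite I" and C: "\<And>i. i \<in> I \<Longrightarrow> compact (C i)" "\<And>i. i \<in> I \<Longrightarrow> convex (C i)"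
    and z: "\<And>x. (\<Sum>i\<in>I. if x \<in> C i then c i else 0) = 0"
  shows "(\<Sum>i\<in>I. if C i \<noteq> {} then c i else 0) = 0"
proof -
  \<comment> \<open>\<open>B\<close> collects the coordinates along which the sets have already been
    projected: for \<open>B\<close> empty the condition reads \<open>p \<in> C i\<close>, for
    \<open>B = Basis\<close> it is nonemptiness.\<close>
  have "\<forall>p. (\<Sum>i\<in>I. if \<exists>x\<in>C i. \<forall>b\<in>Basis - B. x \<bullet> b = p \<bullet> b then c i else 0) = 0"
    if "finite B" "B \<subseteq> Basis" for B :: "'a set"
    using that
  proof (induction B rule: finite_induct)
    case empty
    have "(\<exists>x\<in>C i. \<forall>b\<in>Basis - {}. x \<bullet> b = p \<bullet> b) \<longleftrightarrow> p \<in> C i" for p i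
      by (metis Diff_empty euclidean_eqI)
    thus ?case using z by simp
  next
    case (insert b B)
    hence b: "b \<in> Basis" "b \<notin> B" by auto
    show ?case
    proof
      fix p
      define H where "H = {x. \<forall>b'\<in>Basis - insert b B. x \<bullet> b' = p \<bullet> b'}"
      have H: "closed H" "convex H"
      proof -
        have "H = (\<Inter>b'\<in>Basis - insert b B. {x. b' \<bullet> x = p \<bullet> b'})"
          by (auto simp: H_def inner_commute)
        thus "closed H" "convex H" by (auto intro!: closed_INT closed_hyperplane convex_INT convex_hyperplane)
      qed
      \<comment> \<open>The shadow of a slice on the axis \<open>b\<close>. It is a compact
        interval, so the one-dimensional case adds \<open>b\<close> to the projected
        coordinates.\<close>
      define D where "D i = (\<lambda>x. x \<bullet> b) ` (C i \<inter> H)" for i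
      have D: "compact (D i)" "convex (D i)" if "i \<in> I" for i
      proof -
        show "compact (D i)" unfolding D_def using that C(1) H(1)
          by (intro compact_continuous_image compact_Int_closed continuous_intros) auto
        show "convex (D i)" unfolding D_def using that C(2) H(2)
          by (intro convex_linear_image convex_Int bounded_linear.linear[OF bounded_linear_inner_left]) auto
      qed
      have mem: "s \<in> D i \<longleftrightarrow> (\<exists>x\<in>C i. \<forall>b'\<in>Basis - B. x \<bullet> b' = (p + (s - p \<bullet> b) *\<^sub>R b) \<bullet> b')" for s i
      proof -
        have "(p + (s - p \<bullet> b) *\<^sub>R b) \<bullet> b' = (if b' = b then s else p \<bullet> b')" if "b' \<in> Basis" for b'
          using b that by (simp add: inner_add_left inner_Basis)
        thus ?thesis using b by (auto simp: D_def H_def)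
      qed
      have "(\<Sum>i\<in>I. if D i \<noteq> {} then c i else 0) = 0"
        using insert.IH insert.prems
        by (intro compact_interval_Euler_sum[OF I D]) (auto simp: mem)
      moreover have "D i \<noteq> {} \<longleftrightarrow> (\<exists>x\<in>C i. \<forall>b'\<in>Basis - insert b B. x \<bullet> b' = p \<bullet> b')" for i
        by (auto simp: D_def H_def)
      ultimately show "(\<Sum>i\<in>I. if \<exists>x\<in>C i. \<forall>b'\<in>Basis - insert b B. x \<bullet> b' = p \<bullet> b' then c i else 0) = 0"
        by simp
    qed
  qed
  from this[OF finite_Basis subset_refl] show ?thesis by (simp add: Bex_def ex_in_conv)
qed

text \<open>Equal multiplicities mean that the indicators cancel when the first family has weight 1
  and the second weight - 1.\<close>

lemma compact_convex_families_count:
  fixes C :: "'i \<Rightarrow> 'a::euclidean_space set" and D :: "'j \<Rightarrow> 'a set"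
  assumes I: "finite I" "\<And>i. i \<in> I \<Longrightarrow> compact (C i)" "\<And>i. i \<in> I \<Longrightarrow> convex (C i)"
    and J: "finite J" "\<And>j. j \<in> J \<Longrightarrow> compact (D j)" "\<And>j. j \<in> J \<Longrightarrow> convex (D j)"
    and eq: "\<And>x. card {i\<in>I. x \<in> C i} = card {j\<in>J. x \<in> D j}"
  shows "card {i\<in>I. C i \<noteq> {}} = card {j\<in>J. D j \<noteq> {}}"
proof -
  define E where "E = case_sum C D"
  define c where "c = case_sum (\<lambda>_::'i. 1::real) (\<lambda>_::'j. - 1)"
  have split: "(\<Sum>k\<in>I <+> J. if Q (E k) then c k else 0) = real (card {i\<in>I. Q (C i)}) - real (card {j\<in>J. Q (D j)})" for Q
  proof -
    have "(\<Sum>k\<in>I <+> J. if Q (E k) then c k else 0)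
        = (\<Sum>i\<in>I. if Q (C i) then 1 else 0) + (\<Sum>j\<in>J. if Q (D j) then - 1 else 0)"
      using I(1) J(1) by (simp add: sum.Plus E_def c_def cong: if_cong)
    also have "(\<Sum>i\<in>I. if Q (C i) then 1 else 0) = real (card {i\<in>I. Q (C i)})"
      using I(1) by (simp flip: sum.inter_filter)
    also have "(\<Sum>j\<in>J. if Q (D j) then - 1 else 0) = - real (card {j\<in>J. Q (D j)})"
      using J(1) by (simp flip: sum.inter_filter)
    finally show ?thesis by simp
  qed
  have "(\<Sum>k\<in>I <+> J. if E k \<noteq> {} then c k else 0) = 0"
  proof (rule compact_convex_Euler_sum)
    show "compact (E k)" "convex (E k)" if "k \<in> I <+> J" for k
      using that I J by (auto simp: E_def)
    show "(\<Sum>k\<in>I <+> J. if x \<in> E k then c k else 0) = 0" for x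
      using split[of "\<lambda>X. x \<in> X"] eq[of x] by simp
  qed (use I J in auto)
  thus ?thesis using split[of "\<lambda>X. X \<noteq> {}"] by simp
qed

section \<open>Faces cut out by linear functionals\<close>

text \<open>Applied both to polytopes and to the finite sets spanning them. The zero functional
  returns the whole set.\<close>

definition min_face :: "'a::euclidean_space set \<Rightarrow> 'a \<Rightarrow> 'a set" where
  "min_face P y = {x \<in> P. \<forall>z\<in>P. y \<bullet> x \<le> y \<bullet> z}"

text \<open>A point off the face can move towards some \<open>z\<close> of smaller value; the step
  is scaled so that the functional drops by exactly \<delta>, and it is short when \<delta> is
  small.\<close>

lemma convex_step_off_min_face:
  assumes "convex P" "p \<in> P" "p \<notin> min_face P y" "e > 0"
  shows "\<forall>\<^sub>F \<delta> in at_right 0. \<exists>\<eta>. norm \<eta> \<le> e \<and> y \<bullet> \<eta> = \<delta> \<and> p - \<eta> \<in> P"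
proof -
  obtain z where z: "z \<in> P" "y \<bullet> z < y \<bullet> p"
    using assms by (auto simp: min_face_def not_le)
  define g where "g = y \<bullet> (p - z)"
  have g: "g > 0" using z by (simp add: g_def inner_diff_right)
  define d where "d = min g (e * g / (1 + norm (p - z)))"
  have "d > 0" using g assms by (auto simp: d_def intro!: divide_pos_pos add_pos_nonneg)
  moreover have "\<exists>\<eta>. norm \<eta> \<le> e \<and> y \<bullet> \<eta> = \<delta> \<and> p - \<eta> \<in> P" if "0 < \<delta>" "\<delta> < d" for \<delta>
  proof -
    define t where "t = \<delta> / g"
    have t: "0 < t" "t < 1" using that g by (auto simp: t_def d_def)
    have "\<delta> * (1 + norm (p - z)) < e * g"
      using that unfolding d_def by (simp add: pos_less_divide_eq add_pos_nonneg)
    hence "\<delta> * norm (p - z) \<le> e * g" using that by (simp add: algebra_simps)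
    hence "norm (t *\<^sub>R (p - z)) \<le> e" using t(1) g by (simp only: norm_scaleR abs_of_pos) (simp add: t_def divide_le_eq)
    moreover have "y \<bullet> (t *\<^sub>R (p - z)) = \<delta>"
      using g by (simp add: t_def g_def)
    moreover have "p - t *\<^sub>R (p - z) = (1 - t) *\<^sub>R p + t *\<^sub>R z" by (simp add: algebra_simps)
    hence "p - t *\<^sub>R (p - z) \<in> P" using t assms z by (simp add: convexD)
    ultimately show ?thesis by blast
  qed
  ultimately show ?thesis unfolding eventually_at_right_field by blast
qed

lemma lattice_hull_props:
  assumes "lattice_hull P"
  shows "compact P" "convex P" "bounded P" "P \<noteq> {}"
  using assms by (auto simp: lattice_hull_def finite_imp_compact_convex_hull convex_convex_hull
      compact_imp_bounded)

text \<open>Near \<open>0\<close> the counts agree as functions of \<open>\<eta>\<close>, so the Euler characteristics of their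
  restrictions to a small section \<open>y \<bullet> \<eta> = \<delta>\<close> agree. The set of shifts \<open>\<eta>\<close> belonging to a lattice
  point \<open>x\<close> meets this section unless \<open>x - w\<close> lies on the face.\<close>

lemma count_shift_min_face:
  fixes P :: "(real ^ 'd) set" and s :: int
  assumes P: "unit_invariant P" "lattice_hull P"
    and w: "m > 0" "real m *\<^sub>R w \<in> integer_points" "coprime k m" and s: "s = 1 \<or> s = - 1"
  shows "count_shift (min_face P y) w = count_shift (min_face P (of_int s *\<^sub>R y)) (real k *\<^sub>R w)"
proof -
  note Pp = lattice_hull_props[OF P(2)]
  define w' where "w' = real k *\<^sub>R w"
  define \<sigma> :: real where "\<sigma> = of_int s"
  have s2: "\<sigma> * \<sigma> = 1" "\<bar>\<sigma>\<bar> = 1" using s by (auto simp: \<sigma>_def)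
  define X where "X = {x \<in> integer_points. x - w \<in> P}"
  define X' where "X' = {x \<in> integer_points. x - w' \<in> P}"
  define U where "U = {x \<in> X. x - w \<notin> min_face P y}"
  define U' where "U' = {x \<in> X'. x - w' \<notin> min_face P (\<sigma> *\<^sub>R y)}"
  have fin: "finite X" "finite X'" unfolding X_def X'_def using Pp(3) by (auto intro: finite_count_shift)
  hence finU: "finite U" "finite U'" by (simp_all add: U_def U'_def)
  obtain A where A: "finite A" "A \<subseteq> integer_points \<times> \<int>" "P = {x. \<forall>(a, b)\<in>A. b \<le> a \<bullet> x}"
    by (rule lattice_hull_halfspaces[OF P(2)]) blast
  obtain e0 where e0: "e0 > 0" "\<And>\<eta>. norm \<eta> < e0 \<Longrightarrow> count_shift P (w + \<eta>) = count_shift P (w' + \<sigma> *\<^sub>R \<eta>)"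
    unfolding w'_def \<sigma>_def using unit_invariant_local[OF P w s] by metis
  obtain e1 where e1: "e1 > 0" "\<And>x \<eta>. x \<in> integer_points \<Longrightarrow> norm \<eta> < e1 \<Longrightarrow> x - (w + \<eta>) \<in> P \<Longrightarrow> x - w \<in> P"
    by (rule local_membership[OF A, of w]) blast
  obtain e2 where e2: "e2 > 0" "\<And>x \<eta>. x \<in> integer_points \<Longrightarrow> norm \<eta> < e2 \<Longrightarrow> x - (w' + \<eta>) \<in> P \<Longrightarrow> x - w' \<in> P"
    by (rule local_membership[OF A, of w']) blast
  \<comment> \<open>After halving, the closed ball of radius \<open>e\<close> fits into the three
    open balls of validity, which allows a compact section.\<close>
  define e where "e = min e0 (min e1 e2) / 2"
  have e: "e > 0" "e < e0" "e < e1" "e < e2" using e0 e1 e2 by (auto simp: e_def)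
  have "\<forall>\<^sub>F \<delta> in at_right 0. \<delta> > (0::real)" by (simp add: eventually_at_right_less)
  moreover have "\<forall>\<^sub>F \<delta> in at_right 0. \<forall>x\<in>U. \<exists>\<eta>. norm \<eta> \<le> e \<and> y \<bullet> \<eta> = \<delta> \<and> x - w - \<eta> \<in> P"
    using e(1) Pp(2) by (intro eventually_ball_finite finU ballI convex_step_off_min_face) (auto simp: U_def X_def)
  moreover have "\<forall>\<^sub>F \<delta> in at_right 0. \<forall>x\<in>U'. \<exists>\<eta>. norm \<eta> \<le> e \<and> (\<sigma> *\<^sub>R y) \<bullet> \<eta> = \<delta> \<and> x - w' - \<eta> \<in> P"
    using e(1) Pp(2) by (intro eventually_ball_finite finU ballI convex_step_off_min_face) (auto simp: U'_def X'_def)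
  ultimately have "\<forall>\<^sub>F \<delta> in at_right 0. \<delta> > 0 \<and>
      (\<forall>x\<in>U. \<exists>\<eta>. norm \<eta> \<le> e \<and> y \<bullet> \<eta> = \<delta> \<and> x - w - \<eta> \<in> P) \<and>
      (\<forall>x\<in>U'. \<exists>\<eta>. norm \<eta> \<le> e \<and> (\<sigma> *\<^sub>R y) \<bullet> \<eta> = \<delta> \<and> x - w' - \<eta> \<in> P)"
    by eventually_elim auto
  \<comment> \<open>Only finitely many lattice points are concerned, so one height \<delta> serves
    them all.\<close>
  from eventually_happens'[OF trivial_limit_at_right_real this] obtain \<delta> where \<delta>: "\<delta> > 0"
      "\<And>x. x\<in>U \<Longrightarrow> \<exists>\<eta>. norm \<eta> \<le> e \<and> y \<bullet> \<eta> = \<delta> \<and> x - w - \<eta> \<in> P"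
      "\<And>x. x\<in>U' \<Longrightarrow> \<exists>\<eta>. norm \<eta> \<le> e \<and> (\<sigma> *\<^sub>R y) \<bullet> \<eta> = \<delta> \<and> x - w' - \<eta> \<in> P"
    by blast
  define B where "B = cball 0 e \<inter> {\<eta>. y \<bullet> \<eta> = \<delta>}"
  have B: "compact B" "convex B"
    by (auto simp: B_def intro!: compact_Int_closed closed_hyperplane convex_Int convex_hyperplane)
  define C where "C x = B \<inter> {\<eta>. x - (w + \<eta>) \<in> P}" for x
  \<comment> \<open>The sign is applied to the shift and to the functional alike: \<open>(\<sigma>
    *\<^sub>R y) \<bullet> (\<sigma> *\<^sub>R \<eta>) = y \<bullet> \<eta>\<close>, so both
    families live in the same section.\<close>
  define C' where "C' x = B \<inter> {\<eta>. x - (w' + \<sigma> *\<^sub>R \<eta>) \<in> P}" for x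
  have pre: "closed {\<eta>. x - (u + r *\<^sub>R \<eta>) \<in> P}" "convex {\<eta>. x - (u + r *\<^sub>R \<eta>) \<in> P}" for x u r
  proof -
    have "{\<eta>. x - (u + r *\<^sub>R \<eta>) \<in> P} = (\<lambda>\<eta>. x - (u + r *\<^sub>R \<eta>)) -` P" by auto
    moreover have "continuous_on UNIV (\<lambda>\<eta>. x - (u + r *\<^sub>R \<eta>))" by (intro continuous_intros)
    ultimately show "closed {\<eta>. x - (u + r *\<^sub>R \<eta>) \<in> P}"
      using Pp(1) by (metis closed_vimage compact_imp_closed)
    show "convex {\<eta>. x - (u + r *\<^sub>R \<eta>) \<in> P}"
    proof (rule convexI)
      fix a b and \<alpha> \<beta> :: real
      assume h: "a \<in> {\<eta>. x - (u + r *\<^sub>R \<eta>) \<in> P}" "b \<in> {\<eta>. x - (u + r *\<^sub>R \<eta>) \<in> P}" "0 \<le> \<alpha>" "0 \<le> \<beta>" "\<alpha> + \<beta> = 1"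
      have "\<alpha> *\<^sub>R (x - (u + r *\<^sub>R a)) + \<beta> *\<^sub>R (x - (u + r *\<^sub>R b)) \<in> P"
        using h Pp(2) by (intro convexD) auto
      also have "\<alpha> *\<^sub>R (x - (u + r *\<^sub>R a)) + \<beta> *\<^sub>R (x - (u + r *\<^sub>R b))
          = (\<alpha> + \<beta>) *\<^sub>R (x - u) - r *\<^sub>R (\<alpha> *\<^sub>R a + \<beta> *\<^sub>R b)"
        by (simp add: algebra_simps)
      finally show "\<alpha> *\<^sub>R a + \<beta> *\<^sub>R b \<in> {\<eta>. x - (u + r *\<^sub>R \<eta>) \<in> P}"
        using h(5) by (simp add: diff_diff_eq)
    qed
  qed
  have CC: "compact (C x)" "convex (C x)" "compact (C' x)" "convex (C' x)" for x
    using pre[of x w 1] pre[of x w' \<sigma>] B by (auto simp: C_def C'_def intro!: compact_Int_closed convex_Int)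
  have count: "card {x\<in>X. \<eta> \<in> C x} = card {x\<in>X'. \<eta> \<in> C' x}" for \<eta>
  proof (cases "\<eta> \<in> B")
    case True
    hence n: "norm \<eta> < e0" "norm \<eta> < e1" "norm (\<sigma> *\<^sub>R \<eta>) < e2" using e s2 by (auto simp: B_def)
    have "{x\<in>X. \<eta> \<in> C x} = {x \<in> integer_points. x - (w + \<eta>) \<in> P}"
      using True e1(2) n by (auto simp: X_def C_def)
    moreover have "{x\<in>X'. \<eta> \<in> C' x} = {x \<in> integer_points. x - (w' + \<sigma> *\<^sub>R \<eta>) \<in> P}"
      using True e2(2)[OF _ n(3)] by (auto simp: X'_def C'_def)
    ultimately show ?thesis using e0(2)[OF n(1)] by (simp add: count_shift_def)
  qed (auto simp: C_def C'_def)
  \<comment> \<open>The multiplicities agree at every \<eta> of the section, hence so do the numbers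
    of nonempty pieces. A point on the face has an empty piece, since the functional cannot drop
    below its minimum.\<close>
  have "card {x\<in>X. C x \<noteq> {}} = card {x\<in>X'. C' x \<noteq> {}}"
    by (rule compact_convex_families_count) (use fin CC count in auto)
  moreover have "{x\<in>X. C x \<noteq> {}} = U"
  proof (intro set_eqI iffI)
    fix x assume "x \<in> {x\<in>X. C x \<noteq> {}}"
    then obtain \<eta> where x: "x \<in> X" "y \<bullet> \<eta> = \<delta>" "x - (w + \<eta>) \<in> P" by (auto simp: C_def B_def)
    hence "\<not> y \<bullet> (x - w) \<le> y \<bullet> (x - (w + \<eta>))" using \<delta>(1) by (simp add: inner_diff_right inner_add_right)
    thus "x \<in> U" using x by (auto simp: U_def min_face_def)
  next
    fix x assume x: "x \<in> U"
    then obtain \<eta> where "norm \<eta> \<le> e" "y \<bullet> \<eta> = \<delta>" "x - w - \<eta> \<in> P" using \<delta>(2) by blast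
    hence "\<eta> \<in> C x" by (simp add: C_def B_def diff_diff_eq)
    thus "x \<in> {x\<in>X. C x \<noteq> {}}" using x by (auto simp: U_def)
  qed
  moreover have "{x\<in>X'. C' x \<noteq> {}} = U'"
  proof (intro set_eqI iffI)
    fix x assume "x \<in> {x\<in>X'. C' x \<noteq> {}}"
    then obtain \<eta> where x: "x \<in> X'" "y \<bullet> \<eta> = \<delta>" "x - (w' + \<sigma> *\<^sub>R \<eta>) \<in> P" by (auto simp: C'_def B_def)
    have "(\<sigma> *\<^sub>R y) \<bullet> (\<sigma> *\<^sub>R \<eta>) = \<delta>" using x(2) s2 by (simp flip: mult.assoc)
    hence "\<not> (\<sigma> *\<^sub>R y) \<bullet> (x - w') \<le> (\<sigma> *\<^sub>R y) \<bullet> (x - (w' + \<sigma> *\<^sub>R \<eta>))"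
      using \<delta>(1) by (simp only: inner_diff_right inner_add_right)
    thus "x \<in> U'" using x unfolding U'_def min_face_def by blast
  next
    fix x assume x: "x \<in> U'"
    then obtain \<eta> where h: "norm \<eta> \<le> e" "(\<sigma> *\<^sub>R y) \<bullet> \<eta> = \<delta>" "x - w' - \<eta> \<in> P" using \<delta>(3) by blast
    have "\<sigma> *\<^sub>R \<eta> \<in> C' x" using h s2 by (simp add: C'_def B_def diff_diff_eq)
    thus "x \<in> {x\<in>X'. C' x \<noteq> {}}" using x by (auto simp: U'_def)
  qed
  ultimately have cU: "card U = card U'" by simp
  \<comment> \<open>At \<open>\<eta> = 0\<close> the totals agree; removing the points off the faces
    leaves those on them.\<close>
  have "card X = card X'" using e0(2)[of 0] e0(1) by (simp add: count_shift_def X_def X'_def)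
  moreover have "count_shift (min_face P y) w = card X - card U"
  proof -
    have "{x \<in> integer_points. x - w \<in> min_face P y} = X - U" by (auto simp: X_def U_def min_face_def)
    thus ?thesis using fin by (simp add: count_shift_def card_Diff_subset U_def)
  qed
  moreover have "count_shift (min_face P (\<sigma> *\<^sub>R y)) w' = card X' - card U'"
  proof -
    have "{x \<in> integer_points. x - w' \<in> min_face P (\<sigma> *\<^sub>R y)} = X' - U'" by (auto simp: X'_def U'_def min_face_def)
    thus ?thesis using fin by (simp add: count_shift_def card_Diff_subset U'_def)
  qed
  ultimately show ?thesis using cU by (simp add: w'_def \<sigma>_def)
qed

lemma min_face_finite_nonempty:
  assumes "finite V" "V \<noteq> {}"
  shows "min_face V y \<noteq> {}"
proof -
  have "finite ((\<lambda>v. y \<bullet> v) ` V)" "(\<lambda>v. y \<bullet> v) ` V \<noteq> {}" using assms by auto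
  from Min_in[OF this] obtain v where v: "v \<in> V" "y \<bullet> v = Min ((\<lambda>v. y \<bullet> v) ` V)" by auto
  have "y \<bullet> v \<le> y \<bullet> z" if "z \<in> V" for z
    unfolding v(2) using that assms(1) by (intro Min_le) auto
  thus ?thesis using v(1) by (auto simp: min_face_def)
qed

text \<open>A convex combination attains the minimal value only if its weights vanish off the
  minimisers.\<close>

lemma min_face_convex_hull:
  assumes V: "finite V" "V \<noteq> {}"
  shows "min_face (convex hull V) y = convex hull (min_face V y)"
proof -
  obtain v0 where v0: "v0 \<in> V" "\<And>z. z \<in> V \<Longrightarrow> y \<bullet> v0 \<le> y \<bullet> z"
    using min_face_finite_nonempty[OF V, of y] by (auto simp: min_face_def)
  define m where "m = y \<bullet> v0"
  have low: "m \<le> y \<bullet> x" if "x \<in> convex hull V" for x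
  proof -
    have "convex hull V \<subseteq> {x. y \<bullet> x \<ge> m}"
      using v0 by (intro hull_minimal convex_halfspace_ge) (auto simp: m_def)
    thus ?thesis using that by auto
  qed
  have W: "min_face V y = {v\<in>V. y \<bullet> v = m}"
    using v0 by (auto simp: min_face_def m_def intro: antisym)
  have F: "min_face (convex hull V) y = {x \<in> convex hull V. y \<bullet> x = m}"
  proof -
    have "v0 \<in> convex hull V" using v0(1) by (rule hull_inc)
    hence "y \<bullet> x = m" if "x \<in> min_face (convex hull V) y" for x
      using that low by (auto simp: min_face_def m_def intro!: antisym)
    thus ?thesis using low unfolding min_face_def by auto
  qed
  show ?thesis
  proof
    show "convex hull (min_face V y) \<subseteq> min_face (convex hull V) y"
    proof -
      have "convex hull (min_face V y) \<subseteq> convex hull V" by (intro hull_mono) (auto simp: min_face_def)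
      moreover have "convex hull (min_face V y) \<subseteq> {x. y \<bullet> x = m}"
        by (intro hull_minimal convex_hyperplane) (auto simp: W)
      ultimately show ?thesis unfolding F by blast
    qed
    show "min_face (convex hull V) y \<subseteq> convex hull (min_face V y)"
    proof
      fix x assume "x \<in> min_face (convex hull V) y"
      hence x: "x \<in> convex hull V" "y \<bullet> x = m" by (auto simp: F)
      obtain c where c: "\<forall>v\<in>V. 0 \<le> c v" "sum c V = 1" "(\<Sum>v\<in>V. c v *\<^sub>R v) = x"
        using x(1) unfolding convex_hull_finite[OF V(1)] by blast
      have "(\<Sum>v\<in>V. c v * (y \<bullet> v - m)) = y \<bullet> x - m"
        using c by (simp add: inner_sum_right sum_subtractf right_diff_distrib flip: c(3) sum_distrib_right)
      hence "(\<Sum>v\<in>V. c v * (y \<bullet> v - m)) = 0" using x(2) by simp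
      moreover have "0 \<le> c v * (y \<bullet> v - m)" if "v \<in> V" for v
        using c(1) v0 that by (auto simp: m_def)
      ultimately have z: "c v * (y \<bullet> v - m) = 0" if "v \<in> V" for v
        using sum_nonneg_eq_0_iff[OF V(1), of "\<lambda>v. c v * (y \<bullet> v - m)"] that by simp
      hence out: "c v = 0" if "v \<in> V - min_face V y" for v using that by (auto simp: W)
      have sub: "min_face V y \<subseteq> V" by (auto simp: min_face_def)
      have "sum c (min_face V y) = sum c V"
        by (rule sum.mono_neutral_left[OF V(1) sub]) (use out in auto)
      hence "sum c (min_face V y) = 1" using c(2) by simp
      moreover have "(\<Sum>v\<in>min_face V y. c v *\<^sub>R v) = x"
        using c(3) sum.mono_neutral_left[OF V(1) sub, of "\<lambda>v. c v *\<^sub>R v"] out by simp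
      moreover have "finite (min_face V y)" using sub V(1) by (rule finite_subset)
      ultimately show "x \<in> convex hull (min_face V y)"
        using c(1) sub by (auto simp: convex_hull_finite)
    qed
  qed
qed

lemma lattice_hull_min_face:
  assumes "lattice_hull P"
  shows "lattice_hull (min_face P y)"
proof -
  obtain V where V: "finite V" "V \<noteq> {}" "V \<subseteq> integer_points" "P = convex hull V"
    using assms by (auto simp: lattice_hull_def)
  have "min_face V y \<subseteq> V" by (auto simp: min_face_def)
  thus ?thesis unfolding lattice_hull_def V(4) min_face_convex_hull[OF V(1,2)]
    using V min_face_finite_nonempty[OF V(1,2)] finite_subset by (intro exI[of _ "min_face V y"]) blast
qed

text \<open>For \<open>s = 1\<close> the same face stands on both sides, so the invariance can be
  used again inside faces.\<close>

lemma unit_invariant_min_face: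
  assumes "unit_invariant P" "lattice_hull P"
  shows "unit_invariant (min_face P y)"
  unfolding unit_invariant_def
  using count_shift_min_face[OF assms, where s = 1 and y = y] by simp

text \<open>The sign - 1 at \<open>w = 0\<close>, where the denominator is 1 and
  \<open>k = 1\<close> is admissible.\<close>

lemma count_shift_opposite_faces:
  assumes "unit_invariant P" "lattice_hull P"
  shows "count_shift (min_face P (- y)) 0 = count_shift (min_face P y) 0"
  using count_shift_min_face[OF assms, of 1 0 1 "-1" y] by (simp add: integer_points_0)

section \<open>Varying the functional\<close>

lemma eventually_inner_less:
  fixes v :: "'a::real_inner"
  assumes "y \<bullet> a < y \<bullet> b"
  shows "\<forall>\<^sub>F \<tau> in at_right 0. (y + \<tau> *\<^sub>R v) \<bullet> a < (y + \<tau> *\<^sub>R v) \<bullet> b"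
proof -
  have "((\<lambda>\<tau>. (y + \<tau> *\<^sub>R v) \<bullet> b - (y + \<tau> *\<^sub>R v) \<bullet> a) \<longlongrightarrow> (y + 0 *\<^sub>R v) \<bullet> b - (y + 0 *\<^sub>R v) \<bullet> a) (at_right 0)"
    by (intro tendsto_intros)
  hence "\<forall>\<^sub>F \<tau> in at_right 0. 0 < (y + \<tau> *\<^sub>R v) \<bullet> b - (y + \<tau> *\<^sub>R v) \<bullet> a"
    using assms by (intro order_tendstoD) auto
  thus ?thesis by eventually_elim simp
qed

lemma eventually_inner_nonzero:
  fixes v :: "'a::real_inner"
  assumes "y \<bullet> a \<noteq> 0 \<or> v \<bullet> a \<noteq> 0"
  shows "\<forall>\<^sub>F \<tau> in at_right 0. (y + \<tau> *\<^sub>R v) \<bullet> a \<noteq> 0"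
proof (cases "y \<bullet> a = 0")
  case True
  have "\<forall>\<^sub>F \<tau> in at_right (0::real). \<tau> > 0" by (rule eventually_at_right_less)
  thus ?thesis by eventually_elim (use True assms in \<open>simp add: inner_add_left\<close>)
next
  case False
  hence "y \<bullet> a < y \<bullet> 0 \<or> y \<bullet> 0 < y \<bullet> a" by auto
  thus ?thesis
  proof
    assume "y \<bullet> a < y \<bullet> 0"
    from eventually_inner_less[OF this, of v] show ?thesis by eventually_elim simp
  next
    assume "y \<bullet> 0 < y \<bullet> a"
    from eventually_inner_less[OF this, of v] show ?thesis by eventually_elim simp
  qed
qed

text \<open>Strict inequalities between the finitely many values of \<open>y\<close> on the spanning
  points survive a small perturbation, and ties are broken by \<open>v\<close>. A slight turn of the
  functional therefore selects a face of the face.\<close>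

lemma eventually_min_face_hull:
  assumes "lattice_hull P"
  shows "\<forall>\<^sub>F \<tau> in at_right 0. min_face P (y + \<tau> *\<^sub>R v) = min_face (min_face P y) v"
proof -
  obtain V where V: "finite V" "V \<noteq> {}" "P = convex hull V"
    using assms by (auto simp: lattice_hull_def)
  have sub: "min_face V y \<subseteq> V" by (auto simp: min_face_def)
  have W: "finite (min_face V y)" "min_face V y \<noteq> {}"
    using sub V(1) finite_subset min_face_finite_nonempty[OF V(1,2)] by auto
  have "\<forall>\<^sub>F \<tau> in at_right 0. \<forall>a\<in>V. \<forall>b\<in>V. y \<bullet> a < y \<bullet> b \<longrightarrow> (y + \<tau> *\<^sub>R v) \<bullet> a < (y + \<tau> *\<^sub>R v) \<bullet> b"
  proof (intro eventually_ball_finite V(1) ballI)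
    fix a b
    show "\<forall>\<^sub>F \<tau> in at_right 0. y \<bullet> a < y \<bullet> b \<longrightarrow> (y + \<tau> *\<^sub>R v) \<bullet> a < (y + \<tau> *\<^sub>R v) \<bullet> b"
      using eventually_inner_less[of y a b v] by (cases "y \<bullet> a < y \<bullet> b") auto
  qed
  moreover have "\<forall>\<^sub>F \<tau> in at_right (0::real). \<tau> > 0" by (rule eventually_at_right_less)
  ultimately show ?thesis
  proof eventually_elim
    case (elim \<tau>)
    have eq: "(y + \<tau> *\<^sub>R v) \<bullet> a = y \<bullet> a + \<tau> * (v \<bullet> a)" for a by (simp add: inner_add_left)
    have "min_face V (y + \<tau> *\<^sub>R v) = min_face (min_face V y) v"
    proof (intro set_eqI iffI)
      fix x assume x: "x \<in> min_face V (y + \<tau> *\<^sub>R v)"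
      have "y \<bullet> x \<le> y \<bullet> z" if "z \<in> V" for z
        using x that elim(1) by (force simp: min_face_def)
      hence xy: "x \<in> min_face V y" using x by (simp add: min_face_def)
      moreover have "v \<bullet> x \<le> v \<bullet> z" if z: "z \<in> min_face V y" for z
      proof -
        have "y \<bullet> x = y \<bullet> z" using xy z by (auto simp: min_face_def intro: antisym)
        moreover have "(y + \<tau> *\<^sub>R v) \<bullet> x \<le> (y + \<tau> *\<^sub>R v) \<bullet> z" using x z by (auto simp: min_face_def)
        ultimately show ?thesis using elim(2) by (simp add: eq)
      qed
      ultimately show "x \<in> min_face (min_face V y) v" by (simp add: min_face_def[of "min_face V y"])
    next
      fix x assume x: "x \<in> min_face (min_face V y) v"
      hence xy: "x \<in> min_face V y" by (simp add: min_face_def)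
      have "(y + \<tau> *\<^sub>R v) \<bullet> x \<le> (y + \<tau> *\<^sub>R v) \<bullet> z" if z: "z \<in> V" for z
      proof (cases "y \<bullet> x < y \<bullet> z")
        case True
        thus ?thesis using elim(1) xy z by (auto simp: min_face_def intro: less_imp_le)
      next
        case False
        hence e: "y \<bullet> x = y \<bullet> z" using xy z by (auto simp: min_face_def intro: antisym)
        hence "z \<in> min_face V y" using xy z by (auto simp: min_face_def)
        hence "v \<bullet> x \<le> v \<bullet> z" using x by (auto simp: min_face_def)
        thus ?thesis using elim(2) by (simp add: eq e)
      qed
      thus "x \<in> min_face V (y + \<tau> *\<^sub>R v)" using xy by (auto simp: min_face_def)
    qed
    thus ?case unfolding V(3) min_face_convex_hull[OF V(1,2)] min_face_convex_hull[OF W] by simp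
  qed
qed

lemma eventually_at_right_shift:
  assumes "\<forall>\<^sub>F \<tau> in at_right 0. Q (\<tau>::real)"
  obtains d where "d > 0" "\<And>\<tau>. 0 < \<tau> \<Longrightarrow> \<tau> < d \<Longrightarrow> Q \<tau>"
  using assms unfolding eventually_at_right_field by auto

text \<open>The value at a point itself is left free; only the values close to it on both sides have
  to agree. Equality of right-hand germs is transitive and holds for nearby points around any given
  one, so bisection of the interval applies.\<close>

lemma one_sided_constant_on_line:
  fixes f :: "real \<Rightarrow> 'a"
  assumes f: "\<And>s. \<exists>c. (\<forall>\<^sub>F \<tau> in at_right 0. f (s + \<tau>) = c) \<and> (\<forall>\<^sub>F \<tau> in at_right 0. f (s - \<tau>) = c)"
    and "a \<le> b"
  shows "\<forall>\<^sub>F \<tau> in at_right 0. f (a + \<tau>) = f (b + \<tau>)"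
  using \<open>a \<le> b\<close>
proof (induction rule: Bolzano)
  case (trans a b c)
  from trans(1,2) show ?case by eventually_elim simp
next
  case (local x)
  obtain c where c: "\<forall>\<^sub>F \<tau> in at_right 0. f (x + \<tau>) = c" "\<forall>\<^sub>F \<tau> in at_right 0. f (x - \<tau>) = c"
    using f by blast
  obtain d1 where d1: "d1 > 0" "\<And>\<tau>. 0 < \<tau> \<Longrightarrow> \<tau> < d1 \<Longrightarrow> f (x + \<tau>) = c"
    using eventually_at_right_shift[OF c(1)] by blast
  obtain d2 where d2: "d2 > 0" "\<And>\<tau>. 0 < \<tau> \<Longrightarrow> \<tau> < d2 \<Longrightarrow> f (x - \<tau>) = c"
    using eventually_at_right_shift[OF c(2)] by blast
  have near: "\<forall>\<^sub>F \<tau> in at_right 0. f (r + \<tau>) = c" if r: "x - d2 < r" "r < x + d1" for r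
  proof (cases "r < x")
    case True
    have "f (r + \<tau>) = c" if "0 < \<tau>" "\<tau> < x - r" for \<tau>
      using d2(2)[of "x - r - \<tau>"] that r by simp
    thus ?thesis unfolding eventually_at_right_field using True by (intro exI[of _ "x - r"]) auto
  next
    case False
    have "f (r + \<tau>) = c" if "0 < \<tau>" "\<tau> < x + d1 - r" for \<tau>
      using d1(2)[of "r - x + \<tau>"] that r False by simp
    thus ?thesis unfolding eventually_at_right_field using r by (intro exI[of _ "x + d1 - r"]) auto
  qed
  have "\<forall>\<^sub>F \<tau> in at_right 0. f (a + \<tau>) = f (b + \<tau>)" if "a \<le> x" "x \<le> b" "b - a < min d1 d2" for a b
  proof -
    have "\<forall>\<^sub>F \<tau> in at_right 0. f (a + \<tau>) = c" "\<forall>\<^sub>F \<tau> in at_right 0. f (b + \<tau>) = c"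
      using that by (auto intro!: near)
    thus ?thesis by eventually_elim simp
  qed
  thus ?case using d1(1) d2(1) by (intro exI[of _ "min d1 d2"]) auto
qed

text \<open>Just after and just before the parameter \<open>s\<close> the functional selects the
  faces of \<open>min_face P (y + s *\<^sub>R v)\<close> in the directions \<open>v\<close> and
  \<open>- v\<close>. These are opposite faces of a polytope that is again unit invariant, so the
  count does not jump along the line.\<close>

lemma count_shift_faces_along_line:
  assumes P: "unit_invariant P" "lattice_hull P"
  shows "count_shift (min_face (min_face P y) (y' - y)) 0 = count_shift (min_face (min_face P y') (y' - y)) 0"
proof -
  define v where "v = y' - y"
  define f where "f s = count_shift (min_face P (y + s *\<^sub>R v)) 0" for s
  have right: "\<forall>\<^sub>F \<tau> in at_right 0. f (s + \<tau>) = count_shift (min_face (min_face P (y + s *\<^sub>R v)) v) 0" for s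
    using eventually_min_face_hull[OF P(2), of "y + s *\<^sub>R v" v]
    by eventually_elim (simp add: f_def scaleR_add_left add.assoc)
  have left: "\<forall>\<^sub>F \<tau> in at_right 0. f (s - \<tau>) = count_shift (min_face (min_face P (y + s *\<^sub>R v)) v) 0" for s
    using eventually_min_face_hull[OF P(2), of "y + s *\<^sub>R v" "- v"]
  proof eventually_elim
    case (elim \<tau>)
    have "f (s - \<tau>) = count_shift (min_face (min_face P (y + s *\<^sub>R v)) (- v)) 0"
      unfolding f_def elim[symmetric] by (simp add: scaleR_diff_left algebra_simps)
    also have "\<dots> = count_shift (min_face (min_face P (y + s *\<^sub>R v)) v) 0"
      by (intro count_shift_opposite_faces unit_invariant_min_face lattice_hull_min_face P)
    finally show ?case .
  qed
  have "\<forall>\<^sub>F \<tau> in at_right 0. f (0 + \<tau>) = f (1 + \<tau>)"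
    by (rule one_sided_constant_on_line) (use left right in \<open>blast, simp\<close>)
  with right[of 0] right[of 1]
  have "\<forall>\<^sub>F \<tau> in at_right (0::real). count_shift (min_face (min_face P (y + 0 *\<^sub>R v)) v) 0
    = count_shift (min_face (min_face P (y + 1 *\<^sub>R v)) v) 0"
    by eventually_elim simp
  hence "count_shift (min_face (min_face P (y + 0 *\<^sub>R v)) v) 0 = count_shift (min_face (min_face P (y + 1 *\<^sub>R v)) v) 0"
    by (simp add: eventually_const)
  thus ?thesis by (simp add: v_def)
qed

text \<open>The lattice vector \<open>a' - a\<close> carries the lattice points of the shorter
  segment into the longer one and misses its far end.\<close>

lemma count_shift_segment_mono:
  fixes a a' u :: "real ^ 'd"
  assumes "a \<in> integer_points" "a' \<in> integer_points" "a' + l' *\<^sub>R u \<in> integer_points"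
    and "u \<noteq> 0" "0 \<le> l" "l < l'"
  shows "count_shift (closed_segment a (a + l *\<^sub>R u)) 0 < count_shift (closed_segment a' (a' + l' *\<^sub>R u)) 0"
proof -
  define S where "S = {x \<in> integer_points. x \<in> closed_segment a (a + l *\<^sub>R u)}"
  define S' where "S' = {x \<in> integer_points. x \<in> closed_segment a' (a' + l' *\<^sub>R u)}"
  have seg: "x \<in> closed_segment b (b + r *\<^sub>R u) \<longleftrightarrow> (\<exists>t. 0 \<le> t \<and> t \<le> r \<and> x = b + t *\<^sub>R u)"
    if "0 \<le> r" for x b and r :: real
  proof
    assume "x \<in> closed_segment b (b + r *\<^sub>R u)"
    then obtain k where k: "0 \<le> k" "k \<le> 1" "x = (1 - k) *\<^sub>R b + k *\<^sub>R (b + r *\<^sub>R u)"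
      by (auto simp: in_segment)
    hence "x = b + (k * r) *\<^sub>R u" by (simp add: algebra_simps)
    thus "\<exists>t. 0 \<le> t \<and> t \<le> r \<and> x = b + t *\<^sub>R u"
      using k that by (intro exI[of _ "k * r"]) (auto simp: mult_left_le_one_le)
  next
    assume "\<exists>t. 0 \<le> t \<and> t \<le> r \<and> x = b + t *\<^sub>R u"
    then obtain t where t: "0 \<le> t" "t \<le> r" "x = b + t *\<^sub>R u" by blast
    show "x \<in> closed_segment b (b + r *\<^sub>R u)"
    proof (cases "r = 0")
      case False
      thus ?thesis unfolding in_segment using t that
        by (intro exI[of _ "t / r"]) (auto simp: algebra_simps)
    qed (use t in auto)
  qed
  have fin: "finite S'"
    using finite_count_shift[OF bounded_closed_segment, where w = 0] by (simp add: S'_def)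
  have "(\<lambda>x. x + (a' - a)) ` S \<subseteq> S' - {a' + l' *\<^sub>R u}"
  proof
    fix z assume "z \<in> (\<lambda>x. x + (a' - a)) ` S"
    then obtain x where x: "x \<in> integer_points" "x \<in> closed_segment a (a + l *\<^sub>R u)" "z = x + (a' - a)"
      by (auto simp: S_def)
    then obtain t where t: "0 \<le> t" "t \<le> l" "x = a + t *\<^sub>R u" using seg[OF assms(5)] by blast
    have z: "z = a' + t *\<^sub>R u" using x t by simp
    have "z \<in> integer_points" using x assms by (auto intro: integer_points_add integer_points_diff)
    moreover have "z \<noteq> a' + l' *\<^sub>R u" using z t assms by auto
    moreover have "z \<in> closed_segment a' (a' + l' *\<^sub>R u)"
      using seg[of l' z a'] assms t z by auto
    ultimately show "z \<in> S' - {a' + l' *\<^sub>R u}" by (simp add: S'_def)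
  qed
  moreover have "a' + l' *\<^sub>R u \<in> S'" using assms by (auto simp: S'_def)
  ultimately have "(\<lambda>x. x + (a' - a)) ` S \<subset> S'" by blast
  hence "card ((\<lambda>x. x + (a' - a)) ` S) < card S'" using fin by (intro psubset_card_mono)
  hence "card S < card S'" by (simp add: card_image inj_on_def)
  thus ?thesis by (simp add: count_shift_def S_def S'_def)
qed

lemma inner_closed_segment_const:
  assumes "x \<in> closed_segment a (a + l *\<^sub>R u)" "v \<bullet> u = 0"
  shows "v \<bullet> x = v \<bullet> a"
  using assms by (auto simp: in_segment algebra_simps inner_add_right)

lemma min_face_segment_const:
  assumes "v \<bullet> u = 0"
  shows "min_face (closed_segment a (a + l *\<^sub>R u)) v = closed_segment a (a + l *\<^sub>R u)"
proof -
  have "v \<bullet> x \<le> v \<bullet> z" if "x \<in> closed_segment a (a + l *\<^sub>R u)" "z \<in> closed_segment a (a + l *\<^sub>R u)" for x z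
    using inner_closed_segment_const[OF that(1) assms] inner_closed_segment_const[OF that(2) assms] by simp
  thus ?thesis unfolding min_face_def by blast
qed

text \<open>\<open>y' - y\<close> is constant on both edges, so the comparison along the line from
  \<open>y\<close> to \<open>y'\<close> concerns the edges themselves, and counting determines the
  length. Length 0 is allowed: of two such functionals, one cannot select a proper edge and the
  other only a vertex.\<close>

lemma edge_length_unique:
  fixes P :: "(real ^ 'd) set"
  assumes P: "unit_invariant P" "lattice_hull P"
    and y: "min_face P y = closed_segment a (a + l *\<^sub>R u)" "y \<bullet> u = 0" "0 \<le> l"
      "a \<in> integer_points" "a + l *\<^sub>R u \<in> integer_points"
    and y': "min_face P y' = closed_segment a' (a' + l' *\<^sub>R u)" "y' \<bullet> u = 0" "0 \<le> l'"
      "a' \<in> integer_points" "a' + l' *\<^sub>R u \<in> integer_points"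
    and u: "u \<noteq> 0"
  shows "l = l'"
proof -
  have "(y' - y) \<bullet> u = 0" using y y' by (simp add: inner_diff_left)
  hence "count_shift (closed_segment a (a + l *\<^sub>R u)) 0 = count_shift (closed_segment a' (a' + l' *\<^sub>R u)) 0"
    using count_shift_faces_along_line[OF P, of y y'] y(1) y'(1) by (simp add: min_face_segment_const)
  thus ?thesis
    using count_shift_segment_mono[OF y(4) y'(4,5) u y(3)] count_shift_segment_mono[OF y'(4) y(4,5) u y'(3)]
    by (metis less_irrefl linorder_less_linear)
qed

lemma collinear_hull_eq_segment:
  fixes W :: "'a::euclidean_space set"
  assumes W: "finite W" "W \<noteq> {}" and u: "norm u = 1"
    and par: "\<forall>a\<in>W. \<forall>b\<in>W. b - a \<in> span {u}"
  shows "\<exists>a l. 0 \<le> l \<and> a \<in> W \<and> a + l *\<^sub>R u \<in> W \<and> convex hull W = closed_segment a (a + l *\<^sub>R u)"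
proof -
  obtain a where a: "a \<in> W" "\<And>z. z \<in> W \<Longrightarrow> u \<bullet> a \<le> u \<bullet> z"
    using min_face_finite_nonempty[OF W, of u] by (auto simp: min_face_def)
  obtain b where b: "b \<in> W" "\<And>z. z \<in> W \<Longrightarrow> (- u) \<bullet> b \<le> (- u) \<bullet> z"
    using min_face_finite_nonempty[OF W, of "- u"] by (auto simp: min_face_def)
  define l where "l = u \<bullet> (b - a)"
  have uu: "u \<bullet> u = 1" using u by (simp add: norm_eq_1)
  have pt: "w = a + (u \<bullet> (w - a)) *\<^sub>R u" if w: "w \<in> W" for w
  proof -
    obtain c where "w - a = c *\<^sub>R u" using par a(1) w by (force simp: span_singleton)
    thus ?thesis using uu by (simp add: algebra_simps)
  qed
  have l: "0 \<le> l" using a b by (simp add: l_def inner_diff_right)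
  have bl: "a + l *\<^sub>R u = b" using pt[OF b(1)] by (simp add: l_def)
  have "W \<subseteq> closed_segment a b"
  proof
    fix w assume w: "w \<in> W"
    define t where "t = u \<bullet> (w - a)"
    have t: "0 \<le> t" "t \<le> l" using a(2)[OF w] b(2)[OF w] by (auto simp: t_def l_def inner_diff_right)
    have wt: "w = a + t *\<^sub>R u" using pt[OF w] by (simp add: t_def)
    show "w \<in> closed_segment a b"
    proof (cases "l = 0")
      case False
      thus ?thesis unfolding in_segment bl[symmetric] using t l wt
        by (intro exI[of _ "t / l"]) (auto simp: algebra_simps)
    qed (use t wt in auto)
  qed
  hence "convex hull W \<subseteq> closed_segment a b" by (intro hull_minimal) auto
  moreover have "closed_segment a b \<subseteq> convex hull W"
    using a(1) b(1) by (simp add: segment_convex_hull hull_mono)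
  ultimately show ?thesis using l a(1) b(1) bl by blast
qed

section \<open>Generic functionals\<close>

text \<open>A subspace is not a union of finitely many proper subspaces: a small multiple of
  \<open>s\<close> repairs the new vector without spoiling the earlier ones.\<close>

lemma exists_nonorthogonal_in_subspace:
  fixes S :: "'a::real_inner set"
  assumes S: "subspace S" and E: "finite E" "\<And>e. e \<in> E \<Longrightarrow> \<exists>s\<in>S. s \<bullet> e \<noteq> 0"
  shows "\<exists>v\<in>S. \<forall>e\<in>E. v \<bullet> e \<noteq> 0"
  using E
proof (induction E rule: finite_induct)
  case empty
  thus ?case using subspace_0[OF S] by blast
next
  case (insert e E)
  then obtain v where v: "v \<in> S" "\<And>e. e \<in> E \<Longrightarrow> v \<bullet> e \<noteq> 0" by (metis insertCI)
  obtain s where s: "s \<in> S" "s \<bullet> e \<noteq> 0" using insert.prems by blast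
  have "\<forall>\<^sub>F \<tau> in at_right 0. \<forall>e'\<in>insert e E. (v + \<tau> *\<^sub>R s) \<bullet> e' \<noteq> 0"
    using insert.hyps v s by (intro eventually_ball_finite ballI eventually_inner_nonzero) auto
  from eventually_happens'[OF trivial_limit_at_right_real this]
  obtain \<tau> where "\<forall>e'\<in>insert e E. (v + \<tau> *\<^sub>R s) \<bullet> e' \<noteq> 0" by blast
  moreover have "v + \<tau> *\<^sub>R s \<in> S" using v s S by (intro subspace_add subspace_scale)
  ultimately show ?case by blast
qed

lemma exists_nonorthogonal:
  fixes E :: "'a::real_inner set"
  assumes "finite E" "0 \<notin> E"
  obtains v where "\<And>e. e \<in> E \<Longrightarrow> v \<bullet> e \<noteq> 0"
proof -
  have "\<exists>v\<in>UNIV. \<forall>e\<in>E. v \<bullet> e \<noteq> 0"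
  proof (rule exists_nonorthogonal_in_subspace)
    show "\<exists>s\<in>UNIV. s \<bullet> e \<noteq> 0" if "e \<in> E" for e
      using that assms by (intro bexI[of _ e]) auto
  qed (use assms in auto)
  thus ?thesis using that by blast
qed

text \<open>A point outside \<open>B\<close> is strictly separated from it, and since
  \<open>B\<close> is bounded, the separating functional can be perturbed to a generic one that
  still separates.\<close>

lemma subset_if_generic_minimizers:
  fixes A B E :: "'a::euclidean_space set"
  assumes B: "compact B" "convex B" and E: "finite E" "0 \<notin> E"
    and min: "\<And>y. (\<And>e. e \<in> E \<Longrightarrow> y \<bullet> e \<noteq> 0) \<Longrightarrow> \<exists>p\<in>B. \<forall>x\<in>A. y \<bullet> p \<le> y \<bullet> x"
  shows "A \<subseteq> B"
proof
  fix x assume x: "x \<in> A"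
  show "x \<in> B"
  proof (rule ccontr)
    assume "x \<notin> B"
    then obtain y b where y: "y \<bullet> x < b" "\<And>z. z \<in> B \<Longrightarrow> b < y \<bullet> z"
      using separating_hyperplane_closed_point[OF B(2) compact_imp_closed[OF B(1)]] by metis
    obtain M where M: "M > 0" "\<And>z. z \<in> B \<Longrightarrow> norm z \<le> M"
      using compact_imp_bounded[OF B(1)] bounded_pos by metis
    obtain v where v: "\<And>e. e \<in> E \<Longrightarrow> v \<bullet> e \<noteq> 0" using exists_nonorthogonal[OF E] by blast
    have "((\<lambda>\<tau>. \<tau> * (norm v * (norm x + M))) \<longlongrightarrow> 0 * (norm v * (norm x + M))) (at_right 0)"
      by (intro tendsto_intros)
    hence "\<forall>\<^sub>F \<tau> in at_right 0. \<tau> * (norm v * (norm x + M)) < b - y \<bullet> x"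
      using y(1) by (intro order_tendstoD) auto
    moreover have "\<forall>\<^sub>F \<tau> in at_right 0. \<forall>e\<in>E. (y + \<tau> *\<^sub>R v) \<bullet> e \<noteq> 0"
      using E v by (intro eventually_ball_finite ballI eventually_inner_nonzero) auto
    moreover have "\<forall>\<^sub>F \<tau> in at_right (0::real). \<tau> > 0" by (rule eventually_at_right_less)
    ultimately have "\<forall>\<^sub>F \<tau> in at_right 0. \<tau> * (norm v * (norm x + M)) < b - y \<bullet> x \<and>
        (\<forall>e\<in>E. (y + \<tau> *\<^sub>R v) \<bullet> e \<noteq> 0) \<and> \<tau> > 0"
      by eventually_elim simp
    from eventually_happens'[OF trivial_limit_at_right_real this]
    obtain \<tau> where elim: "\<tau> * (norm v * (norm x + M)) < b - y \<bullet> x"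
        "\<forall>e\<in>E. (y + \<tau> *\<^sub>R v) \<bullet> e \<noteq> 0" "\<tau> > 0" by blast
    show False
    proof -
      obtain p where p: "p \<in> B" "(y + \<tau> *\<^sub>R v) \<bullet> p \<le> (y + \<tau> *\<^sub>R v) \<bullet> x" using min elim(2) x by blast
      have "v \<bullet> (x - p) \<le> norm v * norm (x - p)" by (rule norm_cauchy_schwarz)
      also have "\<dots> \<le> norm v * (norm x + M)"
        using M(2)[OF p(1)] norm_triangle_ineq4[of x p] by (intro mult_left_mono) auto
      finally have "\<tau> * (v \<bullet> (x - p)) \<le> \<tau> * (norm v * (norm x + M))" using elim(3) by simp
      hence "\<tau> * (v \<bullet> x) - \<tau> * (v \<bullet> p) < b - y \<bullet> x" using elim(1) by (simp add: inner_diff_right algebra_simps)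
      thus ?thesis using y(2)[OF p(1)] p(2) by (simp add: inner_add_left)
    qed
  qed
qed

section \<open>Zonotopes over finite index sets\<close>

text \<open>General index sets allow generators to be removed, merged, or indexed by their own
  directions.\<close>

definition zonotope_on :: "'i set \<Rightarrow> ('i \<Rightarrow> 'a::real_vector) \<Rightarrow> 'a set" where
  "zonotope_on I u = {\<Sum>i\<in>I. a i *\<^sub>R u i | a :: 'i \<Rightarrow> real. \<forall>i\<in>I. 0 \<le> a i \<and> a i \<le> 1}"

lemma zonotope_gen_eq: "zonotope_gen n u = zonotope_on {..<n} u"
  by (auto simp: zonotope_gen_def zonotope_on_def)

lemma zonotope_on_memI:
  "(\<And>i. i \<in> I \<Longrightarrow> 0 \<le> a i \<and> a i \<le> 1) \<Longrightarrow> (\<Sum>i\<in>I. a i *\<^sub>R u i) \<in> zonotope_on I u"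
  by (auto simp: zonotope_on_def)

lemma zonotope_on_reindex:
  assumes "bij_betw f J I"
  shows "zonotope_on I u = zonotope_on J (u \<circ> f)"
proof (intro set_eqI iffI)
  fix x assume "x \<in> zonotope_on I u"
  then obtain a where a: "\<forall>i\<in>I. 0 \<le> a i \<and> a i \<le> 1" "x = (\<Sum>i\<in>I. a i *\<^sub>R u i)"
    by (auto simp: zonotope_on_def)
  have "x = (\<Sum>j\<in>J. a (f j) *\<^sub>R (u \<circ> f) j)"
    unfolding a(2) by (simp add: sum.reindex_bij_betw[OF assms, symmetric])
  thus "x \<in> zonotope_on J (u \<circ> f)"
    using a(1) bij_betwE[OF assms] zonotope_on_memI[of J "a \<circ> f" "u \<circ> f"] by simp
next
  fix x assume "x \<in> zonotope_on J (u \<circ> f)"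
  then obtain a where a: "\<forall>j\<in>J. 0 \<le> a j \<and> a j \<le> 1" "x = (\<Sum>j\<in>J. a j *\<^sub>R (u \<circ> f) j)"
    by (auto simp: zonotope_on_def)
  define g where "g = inv_into J f"
  have gf: "g (f j) = j" if "j \<in> J" for j
    using that assms by (simp add: g_def bij_betw_inv_into_left)
  have "(\<Sum>i\<in>I. a (g i) *\<^sub>R u i) = (\<Sum>j\<in>J. a (g (f j)) *\<^sub>R u (f j))"
    by (rule sum.reindex_bij_betw[OF assms, symmetric])
  also have "\<dots> = x" unfolding a(2) by (intro sum.cong) (auto simp: gf)
  finally have "x = (\<Sum>i\<in>I. a (g i) *\<^sub>R u i)" ..
  moreover have "g i \<in> J" if "i \<in> I" for i
    using that bij_betw_apply[OF bij_betw_inv_into[OF assms]] by (simp add: g_def)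
  ultimately show "x \<in> zonotope_on I u" using a(1) by (auto intro!: zonotope_on_memI)
qed

lemma zonotope_up_to_translationI:
  fixes u :: "'i \<Rightarrow> real ^ 'd"
  assumes "finite I" "P = (+) v ` zonotope_on I u"
  shows "zonotope_up_to_translation P"
proof -
  obtain f where f: "bij_betw f {..<card I} I"
    using ex_bij_betw_nat_finite[OF assms(1)] by (auto simp: lessThan_atLeast0)
  show ?thesis
    unfolding zonotope_up_to_translation_def zonotope_gen_eq
    using assms(2) zonotope_on_reindex[OF f, of u] by metis
qed

lemma zonotope_on_insert:
  assumes "finite I" "i \<notin> I"
  shows "zonotope_on (insert i I) u = {x + y | x y. x \<in> closed_segment 0 (u i) \<and> y \<in> zonotope_on I u}"
proof (intro set_eqI iffI)
  fix x assume "x \<in> zonotope_on (insert i I) u"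
  then obtain a where a: "\<forall>i\<in>insert i I. 0 \<le> a i \<and> a i \<le> 1" "x = (\<Sum>i\<in>insert i I. a i *\<^sub>R u i)"
    by (auto simp: zonotope_on_def)
  have "x = a i *\<^sub>R u i + (\<Sum>i\<in>I. a i *\<^sub>R u i)" using a assms by simp
  moreover have "a i *\<^sub>R u i \<in> closed_segment 0 (u i)" using a(1) by (auto simp: in_segment)
  moreover have "(\<Sum>i\<in>I. a i *\<^sub>R u i) \<in> zonotope_on I u" using a(1) by (intro zonotope_on_memI) auto
  ultimately show "x \<in> {x + y | x y. x \<in> closed_segment 0 (u i) \<and> y \<in> zonotope_on I u}" by blast
next
  fix x assume "x \<in> {x + y | x y. x \<in> closed_segment 0 (u i) \<and> y \<in> zonotope_on I u}"
  then obtain t a where a: "0 \<le> t" "t \<le> 1" "\<forall>i\<in>I. 0 \<le> a i \<and> a i \<le> 1" "x = t *\<^sub>R u i + (\<Sum>i\<in>I. a i *\<^sub>R u i)"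
    by (auto simp: zonotope_on_def in_segment)
  have "(\<Sum>j\<in>I. (a(i := t)) j *\<^sub>R u j) = (\<Sum>i\<in>I. a i *\<^sub>R u i)"
    using assms by (intro sum.cong) auto
  hence "x = (\<Sum>j\<in>insert i I. (a(i := t)) j *\<^sub>R u j)" using assms a(4) by simp
  also have "\<dots> \<in> zonotope_on (insert i I) u" using a by (intro zonotope_on_memI) auto
  finally show "x \<in> zonotope_on (insert i I) u" .
qed

lemma zonotope_on_compact_convex:
  fixes u :: "'i \<Rightarrow> 'a::euclidean_space"
  assumes "finite I"
  shows "compact (zonotope_on I u) \<and> convex (zonotope_on I u)"
  using assms
proof (induction I rule: finite_induct)
  case empty
  have "zonotope_on {} u = {0}" by (auto simp: zonotope_on_def)
  thus ?case by simp
next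
  case (insert i I)
  have "zonotope_on (insert i I) u = (\<Union>x\<in>closed_segment 0 (u i). \<Union>y\<in>zonotope_on I u. {x + y})"
    unfolding zonotope_on_insert[OF insert.hyps] by auto
  hence "convex (zonotope_on (insert i I) u)" using insert.IH by (simp add: convex_sums)
  moreover have "compact (zonotope_on (insert i I) u)"
    unfolding zonotope_on_insert[OF insert.hyps] using insert.IH by (intro compact_sums) auto
  ultimately show ?case by simp
qed

lemma zonotope_on_minimizer:
  fixes u :: "'i \<Rightarrow> 'a::euclidean_space"
  assumes "finite I" "x \<in> zonotope_on I u"
  shows "y \<bullet> (\<Sum>i\<in>{i\<in>I. y \<bullet> u i < 0}. u i) \<le> y \<bullet> x"
    and "(\<Sum>i\<in>{i\<in>I. y \<bullet> u i < 0}. u i) \<in> zonotope_on I u"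
proof -
  define b where "b i = (if y \<bullet> u i < 0 then 1 else 0::real)" for i
  have b: "(\<Sum>i\<in>{i\<in>I. y \<bullet> u i < 0}. u i) = (\<Sum>i\<in>I. b i *\<^sub>R u i)"
    unfolding sum.inter_filter[OF assms(1)] b_def by (intro sum.cong) auto
  show "(\<Sum>i\<in>{i\<in>I. y \<bullet> u i < 0}. u i) \<in> zonotope_on I u"
    unfolding b by (intro zonotope_on_memI) (auto simp: b_def)
  obtain a where a: "\<forall>i\<in>I. 0 \<le> a i \<and> a i \<le> 1" "x = (\<Sum>i\<in>I. a i *\<^sub>R u i)"
    using assms(2) by (auto simp: zonotope_on_def)
  show "y \<bullet> (\<Sum>i\<in>{i\<in>I. y \<bullet> u i < 0}. u i) \<le> y \<bullet> x"
    unfolding b a(2) inner_sum_right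
  proof (intro sum_mono)
    fix i assume "i \<in> I"
    thus "y \<bullet> (b i *\<^sub>R u i) \<le> y \<bullet> (a i *\<^sub>R u i)"
      using a(1) by (auto simp: b_def mult_le_cancel_right1 mult_nonneg_nonneg)
  qed
qed

subsection \<open>Recovering the zonotope\<close>

text \<open>Meaningful where the face is a single point, as it is for generic
  \<open>y\<close>.\<close>

definition min_point :: "'a::euclidean_space set \<Rightarrow> 'a \<Rightarrow> 'a" where
  "min_point P y = (THE x. min_face P y = {x})"

lemma min_point_eq: "min_face P y = {x} \<Longrightarrow> min_point P y = x"
  by (simp add: min_point_def)

text \<open>For \<open>l \<ge> 0\<close> this is a minimiser of \<open>y\<close> on the zonotope
  with generators \<open>l u *\<^sub>R u\<close>: those on which \<open>y\<close> is negative enter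
  in full.\<close>

definition zonotope_vertex :: "('a::real_inner \<Rightarrow> real) \<Rightarrow> 'a set \<Rightarrow> 'a \<Rightarrow> 'a" where
  "zonotope_vertex l U y = (\<Sum>u\<in>{u\<in>U. y \<bullet> u < 0}. l u *\<^sub>R u)"

lemma eventually_same_side:
  fixes v :: "'a::real_inner"
  assumes "y \<bullet> a \<noteq> 0"
  shows "\<forall>\<^sub>F \<tau> in at_right 0. (y + \<tau> *\<^sub>R v) \<bullet> a < 0 \<longleftrightarrow> y \<bullet> a < 0"
proof (cases "y \<bullet> a < 0")
  case True
  hence "y \<bullet> a < y \<bullet> 0" by simp
  from eventually_inner_less[OF this, of v] show ?thesis by eventually_elim (use True in simp)
next
  case False
  hence "y \<bullet> 0 < y \<bullet> a" using assms by simp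
  from eventually_inner_less[OF this, of v] show ?thesis by eventually_elim (use False in simp)
qed

text \<open>When \<open>y\<close> crosses the hyperplane orthogonal to an edge direction \<open>u\<close>, the vertex of \<open>P\<close>
  and the vertex of the zonotope jump by the same vector \<open>l u *\<^sub>R u\<close>.\<close>

lemma vertex_difference_locally_constant:
  fixes P :: "'a::euclidean_space set"
  assumes ev: "\<And>v. \<forall>\<^sub>F \<tau> in at_right 0. min_face P (y + \<tau> *\<^sub>R v) = min_face (min_face P y) v"
    and U: "finite U" "u \<in> U" "\<forall>u'\<in>U. u' \<noteq> u \<longrightarrow> y \<bullet> u' \<noteq> 0"
    and l: "0 \<le> l u" and F: "min_face P y = closed_segment a (a + l u *\<^sub>R u)"
  shows "\<exists>c. \<forall>v. v \<bullet> u \<noteq> 0 \<longrightarrow>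
    (\<forall>\<^sub>F \<tau> in at_right 0. y \<bullet> u = 0 \<longrightarrow> min_point P (y + \<tau> *\<^sub>R v) - zonotope_vertex l U (y + \<tau> *\<^sub>R v) = c)"
proof (intro exI allI impI)
  fix v :: 'a
  assume v: "v \<bullet> u \<noteq> 0"
  \<comment> \<open>The contribution of the directions whose sign is stable near \<open>y\<close>.
    The constant will be \<open>a - q0\<close> on both sides: if \<open>v \<bullet> u < 0\<close>,
    the vertex of \<open>P\<close> and that of the zonotope both gain
    \<open>l u *\<^sub>R u\<close>.\<close>
  define q0 where "q0 = (\<Sum>u'\<in>{u'\<in>U - {u}. y \<bullet> u' < 0}. l u' *\<^sub>R u')"
  define p where "p = (if v \<bullet> u < 0 then a + l u *\<^sub>R u else a)"
  have face: "min_face (closed_segment a (a + l u *\<^sub>R u)) v = {p}"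
  proof -
    have val: "v \<bullet> x = v \<bullet> a + t * (l u * (v \<bullet> u))" if "x = (1 - t) *\<^sub>R a + t *\<^sub>R (a + l u *\<^sub>R u)" for x t
      unfolding that by (simp add: inner_add_right algebra_simps)
    have pin: "p \<in> closed_segment a (a + l u *\<^sub>R u)" by (auto simp: p_def)
    have less: "x = p \<or> v \<bullet> p < v \<bullet> x" if x: "x \<in> closed_segment a (a + l u *\<^sub>R u)" for x
    proof -
      obtain t where t: "0 \<le> t" "t \<le> 1" "x = (1 - t) *\<^sub>R a + t *\<^sub>R (a + l u *\<^sub>R u)"
        using x by (auto simp: in_segment)
      have x': "x = a + (t * l u) *\<^sub>R u" using t(3) by (simp add: algebra_simps)
      consider "l u = 0" | "l u > 0" "v \<bullet> u < 0" | "l u > 0" "v \<bullet> u > 0" using l v by linarith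
      thus ?thesis
      proof cases
        case 2
        hence neg: "l u * (v \<bullet> u) < 0" by (simp add: mult_pos_neg)
        have "t = 1 \<or> l u * (v \<bullet> u) < t * (l u * (v \<bullet> u))"
          using mult_strict_right_mono_neg[of t 1, OF _ neg] t(2) by fastforce
        thus ?thesis using val[OF t(3)] 2 x' by (auto simp: p_def inner_add_right)
      next
        case 3
        hence "0 < l u * (v \<bullet> u)" by simp
        hence "t = 0 \<or> 0 < t * (l u * (v \<bullet> u))" using t(1) by (auto simp: zero_less_mult_iff)
        thus ?thesis using val[OF t(3)] 3 x' by (auto simp: p_def)
      qed (auto simp: p_def x')
    qed
    show ?thesis
    proof (intro set_eqI iffI)
      fix x assume "x \<in> min_face (closed_segment a (a + l u *\<^sub>R u)) v"
      thus "x \<in> {p}" using less pin by (force simp: min_face_def)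
    next
      fix x assume "x \<in> {p}"
      thus "x \<in> min_face (closed_segment a (a + l u *\<^sub>R u)) v"
        using less pin by (auto simp: min_face_def intro: less_imp_le)
    qed
  qed
  have "\<forall>\<^sub>F \<tau> in at_right 0. \<forall>u'\<in>U - {u}. (y + \<tau> *\<^sub>R v) \<bullet> u' < 0 \<longleftrightarrow> y \<bullet> u' < 0"
    using U by (intro eventually_ball_finite ballI eventually_same_side) auto
  moreover have "\<forall>\<^sub>F \<tau> in at_right (0::real). \<tau> > 0" by (rule eventually_at_right_less)
  moreover note ev[of v]
  ultimately show "\<forall>\<^sub>F \<tau> in at_right 0. y \<bullet> u = 0 \<longrightarrow>
      min_point P (y + \<tau> *\<^sub>R v) - zonotope_vertex l U (y + \<tau> *\<^sub>R v) = a - q0"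
  proof eventually_elim
    case (elim \<tau>)
    show ?case
    proof
      assume yu: "y \<bullet> u = 0"
      have "(y + \<tau> *\<^sub>R v) \<bullet> u < 0 \<longleftrightarrow> v \<bullet> u < 0"
        using yu elim(2) by (simp add: inner_add_left mult_less_0_iff)
      hence "{u'\<in>U. (y + \<tau> *\<^sub>R v) \<bullet> u' < 0} =
          (if v \<bullet> u < 0 then insert u {u'\<in>U - {u}. y \<bullet> u' < 0} else {u'\<in>U - {u}. y \<bullet> u' < 0})"
        using elim(1) U(2) by auto
      hence "zonotope_vertex l U (y + \<tau> *\<^sub>R v) = (if v \<bullet> u < 0 then l u *\<^sub>R u + q0 else q0)"
        using U(1) by (simp add: zonotope_vertex_def q0_def)
      moreover have "min_point P (y + \<tau> *\<^sub>R v) = p"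
        using elim(3) by (intro min_point_eq) (simp add: F face)
      ultimately show "min_point P (y + \<tau> *\<^sub>R v) - zonotope_vertex l U (y + \<tau> *\<^sub>R v) = a - q0"
        by (auto simp: p_def)
    qed
  qed
qed

lemma vertex_difference_generic:
  fixes P :: "'a::euclidean_space set"
  assumes ev: "\<forall>\<^sub>F \<tau> in at_right 0. min_face P (y + \<tau> *\<^sub>R v) = min_face (min_face P y) v"
    and U: "finite U" "\<And>u. u \<in> U \<Longrightarrow> y \<bullet> u \<noteq> 0" and F: "min_face P y = {p}"
  shows "\<forall>\<^sub>F \<tau> in at_right 0. min_point P (y + \<tau> *\<^sub>R v) - zonotope_vertex l U (y + \<tau> *\<^sub>R v)
    = min_point P y - zonotope_vertex l U y"
proof -
  have "\<forall>\<^sub>F \<tau> in at_right 0. \<forall>u\<in>U. (y + \<tau> *\<^sub>R v) \<bullet> u < 0 \<longleftrightarrow> y \<bullet> u < 0"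
    using U by (intro eventually_ball_finite ballI eventually_same_side) auto
  with ev show ?thesis
  proof eventually_elim
    case (elim \<tau>)
    have "min_face {p} v = {p}" by (auto simp: min_face_def)
    hence "min_point P (y + \<tau> *\<^sub>R v) = min_point P y" using elim(1) F by (simp add: min_point_eq)
    moreover have "{u\<in>U. (y + \<tau> *\<^sub>R v) \<bullet> u < 0} = {u\<in>U. y \<bullet> u < 0}" using elim(2) by blast
    ultimately show ?case by (simp add: zonotope_vertex_def)
  qed
qed

lemma min_face_singleton:
  assumes V: "finite V" "V \<noteq> {}" and y: "\<And>a b. a \<in> V \<Longrightarrow> b \<in> V \<Longrightarrow> a \<noteq> b \<Longrightarrow> y \<bullet> (a - b) \<noteq> 0"
  obtains p where "p \<in> V" "min_face (convex hull V) y = {p}"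
proof -
  obtain p where p: "p \<in> min_face V y" using min_face_finite_nonempty[OF V, of y] by blast
  have "x = p" if x: "x \<in> min_face V y" for x
  proof (rule ccontr)
    assume "x \<noteq> p"
    moreover have "y \<bullet> x = y \<bullet> p" using x p by (auto simp: min_face_def intro: antisym)
    ultimately show False using y[of x p] x p by (auto simp: min_face_def inner_diff_right)
  qed
  hence "min_face V y = {p}" using p by blast
  moreover have "p \<in> V" using p by (simp add: min_face_def)
  ultimately show ?thesis using that[of p] by (simp add: min_face_convex_hull[OF V])
qed

lemma min_face_segment:
  fixes V :: "'a::euclidean_space set"
  assumes V: "finite V" "V \<noteq> {}" and u: "norm u = 1"
    and y: "\<forall>a\<in>V. \<forall>b\<in>V. y \<bullet> (b - a) = 0 \<longrightarrow> b - a \<in> span {u}"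
  shows "\<exists>a l. 0 \<le> l \<and> a \<in> V \<and> a + l *\<^sub>R u \<in> V \<and>
    min_face (convex hull V) y = closed_segment a (a + l *\<^sub>R u)"
proof -
  define W where "W = min_face V y"
  have WV: "W \<subseteq> V" by (auto simp: W_def min_face_def)
  have W: "finite W" "W \<noteq> {}"
    using WV V finite_subset min_face_finite_nonempty[OF V, of y] by (auto simp: W_def)
  have "\<forall>a\<in>W. \<forall>b\<in>W. b - a \<in> span {u}"
  proof (intro ballI)
    fix a b assume ab: "a \<in> W" "b \<in> W"
    have "y \<bullet> a = y \<bullet> b" using ab by (auto simp: W_def min_face_def intro: antisym)
    hence "y \<bullet> (b - a) = 0" by (simp add: inner_diff_right)
    thus "b - a \<in> span {u}" using y ab WV by blast
  qed
  from collinear_hull_eq_segment[OF W u this]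
  obtain a l where "0 \<le> l" "a \<in> W" "a + l *\<^sub>R u \<in> W" "convex hull W = closed_segment a (a + l *\<^sub>R u)"
    by blast
  thus ?thesis using WV by (auto simp: min_face_convex_hull[OF V] W_def)
qed

text \<open>The condition on differences says that \<open>y\<close> is generic within the hyperplane
  orthogonal to \<open>u\<close>. One such functional fixes the length and
  \<open>edge_length_unique\<close> carries it to all others; if there is none, 0 serves
  vacuously.\<close>

lemma exists_edge_length:
  fixes P V :: "(real ^ 'd) set"
  assumes P: "unit_invariant P" "lattice_hull P"
    and V: "finite V" "V \<noteq> {}" "V \<subseteq> integer_points" "P = convex hull V" and u: "norm u = 1"
  shows "\<exists>l\<ge>0. \<forall>y. y \<bullet> u = 0 \<longrightarrow> (\<forall>a\<in>V. \<forall>b\<in>V. y \<bullet> (b - a) = 0 \<longrightarrow> b - a \<in> span {u}) \<longrightarrow>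
    (\<exists>a. min_face P y = closed_segment a (a + l *\<^sub>R u))"
proof (cases "\<exists>y. y \<bullet> u = 0 \<and> (\<forall>a\<in>V. \<forall>b\<in>V. y \<bullet> (b - a) = 0 \<longrightarrow> b - a \<in> span {u})")
  case False
  thus ?thesis by (intro exI[of _ 0]) auto
next
  case True
  then obtain y where y: "y \<bullet> u = 0" "\<forall>a\<in>V. \<forall>b\<in>V. y \<bullet> (b - a) = 0 \<longrightarrow> b - a \<in> span {u}"
    by blast
  obtain a l where al: "0 \<le> l" "a \<in> V" "a + l *\<^sub>R u \<in> V" "min_face P y = closed_segment a (a + l *\<^sub>R u)"
    using min_face_segment[OF V(1,2) u y(2)] V(4) by blast
  have "\<exists>a. min_face P y' = closed_segment a (a + l *\<^sub>R u)"
    if y': "y' \<bullet> u = 0" "\<forall>a\<in>V. \<forall>b\<in>V. y' \<bullet> (b - a) = 0 \<longrightarrow> b - a \<in> span {u}" for y'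
  proof -
    obtain a' l' where al': "0 \<le> l'" "a' \<in> V" "a' + l' *\<^sub>R u \<in> V" "min_face P y' = closed_segment a' (a' + l' *\<^sub>R u)"
      using min_face_segment[OF V(1,2) u y'(2)] V(4) by blast
    have "u \<noteq> 0" using u by auto
    hence "l = l'"
      using al al' V(3) y(1) y'(1) by (intro edge_length_unique[OF P, of y a l u y' a' l']) auto
    thus ?thesis using al'(4) by blast
  qed
  thus ?thesis using al(1) by blast
qed

text \<open>Generic minimisers determine a compact convex set, so it suffices that the minimisers on
  \<open>P\<close> and on the candidate zonotope differ by a constant vector. Their difference
  \<psi> could change only where the functional becomes orthogonal to a difference of two points of
  \<open>V\<close>.\<close>

lemma unit_invariant_imp_zonotope:
  fixes P :: "(real ^ 'd) set"
  assumes P: "unit_invariant P" "lattice_hull P"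
  shows "zonotope_up_to_translation P"
proof -
  obtain V where V: "finite V" "V \<noteq> {}" "V \<subseteq> integer_points" "P = convex hull V"
    using P(2) by (auto simp: lattice_hull_def)
  \<comment> \<open>Every edge of \<open>P\<close> is parallel to an element of \<open>D\<close>,
    and a functional that vanishes nowhere on \<open>D\<close> has a unique minimiser.\<close>
  define D where "D = {b - a | a b. a \<in> V \<and> b \<in> V \<and> a \<noteq> b}"
  have D: "finite D" "0 \<notin> D"
  proof -
    have "D \<subseteq> (\<lambda>(a, b). b - a) ` (V \<times> V)" by (auto simp: D_def)
    thus "finite D" using V(1) by (meson finite_SigmaI finite_imageI finite_subset)
  qed (auto simp: D_def)
  have Dneg: "- d \<in> D" if d: "d \<in> D" for d
  proof -
    obtain a b where ab: "d = b - a" "a \<in> V" "b \<in> V" "a \<noteq> b" using d by (auto simp: D_def)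
    have "- d = a - b" using ab by simp
    thus ?thesis using ab unfolding D_def by blast
  qed
  define generic where "generic y \<longleftrightarrow> (\<forall>d\<in>D. y \<bullet> d \<noteq> 0)" for y
  have single: "\<exists>p\<in>V. min_face P y = {p}" if "generic y" for y
  proof -
    have "y \<bullet> (a - b) \<noteq> 0" if "a \<in> V" "b \<in> V" "a \<noteq> b" for a b
      using that \<open>generic y\<close> unfolding generic_def D_def by blast
    from min_face_singleton[OF V(1,2) this] show ?thesis using V(4) by metis
  qed
  obtain y0 where "\<And>d. d \<in> D \<Longrightarrow> y0 \<bullet> d \<noteq> 0" using exists_nonorthogonal[OF D] by blast
  hence y0: "generic y0" by (simp add: generic_def)
  \<comment> \<open>Unit vectors, one from each opposite pair; \<open>y0\<close> decides the
    orientation.\<close>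
  define U where "U = sgn ` {d\<in>D. y0 \<bullet> d > 0}"
  have U: "finite U" "\<And>u. u \<in> U \<Longrightarrow> norm u = 1" "\<And>u. u \<in> U \<Longrightarrow> y0 \<bullet> u > 0"
  proof -
    show "finite U" using D by (simp add: U_def)
    fix u assume "u \<in> U"
    then obtain d where d: "d \<in> D" "y0 \<bullet> d > 0" "u = sgn d" by (auto simp: U_def)
    have "d \<noteq> 0" using d(2) by auto
    thus "norm u = 1" "y0 \<bullet> u > 0" using d by (auto simp: norm_sgn sgn_div_norm divide_simps)
  qed
  have UD: "\<exists>d\<in>D. u = sgn d \<and> y0 \<bullet> d > 0" if "u \<in> U" for u using that by (auto simp: U_def)
  have Uzero: "y \<bullet> sgn d = 0 \<longleftrightarrow> y \<bullet> d = 0" for y d :: "real ^ 'd"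
    by (auto simp: sgn_div_norm)
  have dir: "\<exists>u\<in>U. d \<in> span {u}" if d: "d \<in> D" for d
  proof -
    have "y0 \<bullet> d > 0 \<or> y0 \<bullet> (- d) > 0" using y0 d by (auto simp: generic_def)
    moreover have "d \<in> span {sgn d}" "d \<in> span {sgn (- d)}"
    proof -
      have "d \<noteq> 0" using d D by auto
      hence "d = norm d *\<^sub>R sgn d" "d = (- norm d) *\<^sub>R sgn (- d)" by (simp_all add: sgn_div_norm)
      thus "d \<in> span {sgn d}" "d \<in> span {sgn (- d)}" by (metis span_base span_scale singletonI)+
    qed
    ultimately show ?thesis using d Dneg[OF d] unfolding U_def by blast
  qed
  have par: "u = u'" if u: "u \<in> U" "u' \<in> U" "u' \<in> span {u}" for u u'
  proof -
    obtain c where c: "u' = c *\<^sub>R u" using u(3) by (auto simp: span_singleton)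
    have "\<bar>c\<bar> = 1" using U(2)[OF u(1)] U(2)[OF u(2)] c by simp
    moreover have "c > 0" using U(3)[OF u(1)] U(3)[OF u(2)] c by (simp add: zero_less_mult_iff)
    ultimately show ?thesis using c by simp
  qed
  \<comment> \<open>Stated for all \<open>u\<close>, so that the chosen \<open>l\<close> is
    nonnegative outside \<open>U\<close> as well.\<close>
  have "\<forall>u. \<exists>l\<ge>0. u \<in> U \<longrightarrow> (\<forall>y. y \<bullet> u = 0 \<longrightarrow> (\<forall>a\<in>V. \<forall>b\<in>V. y \<bullet> (b - a) = 0 \<longrightarrow> b - a \<in> span {u}) \<longrightarrow>
      (\<exists>a. min_face P y = closed_segment a (a + l *\<^sub>R u)))"
    using exists_edge_length[OF P V] U(2) by (metis order_refl)
  then obtain l where l: "\<And>u. 0 \<le> l u" "\<And>u y. u \<in> U \<Longrightarrow> y \<bullet> u = 0 \<Longrightarrow>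
      (\<And>a b. a \<in> V \<Longrightarrow> b \<in> V \<Longrightarrow> y \<bullet> (b - a) = 0 \<Longrightarrow> b - a \<in> span {u}) \<Longrightarrow>
      \<exists>a. min_face P y = closed_segment a (a + l u *\<^sub>R u)" by metis
  define \<psi> where "\<psi> y = min_point P y - zonotope_vertex l U y" for y
  have genU: "y \<bullet> u \<noteq> 0" if "generic y" "u \<in> U" for y u
    using UD[OF that(2)] that(1) Uzero by (auto simp: generic_def)
  have gen_ev: "\<forall>\<^sub>F \<tau> in at_right 0. \<psi> (y + \<tau> *\<^sub>R v) = \<psi> y" if g: "generic y" for y v
  proof -
    obtain p where "min_face P y = {p}" using single[OF g] by blast
    from vertex_difference_generic[OF eventually_min_face_hull[OF P(2)] U(1) genU[OF g] this]
    show ?thesis by (simp add: \<psi>_def)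
  qed
  text \<open>A segment along which no two edge directions are crossed at the same time.\<close>
  have line: "\<psi> y1 = \<psi> y0"
    if y1: "generic y1" and E: "\<And>d d'. d \<in> D \<Longrightarrow> d' \<in> D \<Longrightarrow>
        y1 \<bullet> ((y0 \<bullet> d) *\<^sub>R d' - (y0 \<bullet> d') *\<^sub>R d) = 0 \<Longrightarrow> (y0 \<bullet> d) *\<^sub>R d' - (y0 \<bullet> d') *\<^sub>R d = 0" for y1
  proof -
    define v where "v = y1 - y0"
    define f where "f s = \<psi> (y0 + s *\<^sub>R v)" for s
    have cross: "\<exists>c. (\<forall>\<^sub>F \<tau> in at_right 0. \<psi> (y + \<tau> *\<^sub>R v) = c) \<and> (\<forall>\<^sub>F \<tau> in at_right 0. \<psi> (y + \<tau> *\<^sub>R (- v)) = c)"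
      if ydef: "y = y0 + s *\<^sub>R v" for y s
    proof (cases "generic y")
      case True
      thus ?thesis using gen_ev by blast
    next
      case False
      then obtain d where d: "d \<in> D" "y \<bullet> d = 0" by (auto simp: generic_def)
      obtain u where u: "u \<in> U" "d \<in> span {u}" using dir[OF d(1)] by blast
      then obtain k where k: "d = k *\<^sub>R u" by (auto simp: span_singleton)
      have k0: "k \<noteq> 0" using k d D by auto
      have yu: "y \<bullet> u = 0" using d k k0 by simp
      \<comment> \<open>If \<open>d\<close> and \<open>d'\<close> are both orthogonal to the point
        \<open>y\<close> of the line, then \<open>y1\<close> annihilates the combination in
        \<open>E\<close>. The assumption makes \<open>d'\<close> a multiple of \<open>d\<close>, so
        no direction other than \<open>u\<close> is crossed here.\<close>
      have only: "d' \<in> span {u}" if d': "d' \<in> D" "y \<bullet> d' = 0" for d'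
      proof -
        have e: "(1 - s) * (y0 \<bullet> e) + s * (y1 \<bullet> e) = 0" if "y \<bullet> e = 0" for e
          using that by (simp add: ydef v_def algebra_simps inner_add_left inner_diff_left)
        have s0: "s \<noteq> 0" using e[OF d(2)] y0 d(1) by (auto simp: generic_def)
        have "s * (y1 \<bullet> ((y0 \<bullet> d) *\<^sub>R d' - (y0 \<bullet> d') *\<^sub>R d))
            = (y0 \<bullet> d) * (s * (y1 \<bullet> d')) - (y0 \<bullet> d') * (s * (y1 \<bullet> d))"
          by (simp add: inner_diff_right algebra_simps)
        also have "s * (y1 \<bullet> d') = - (1 - s) * (y0 \<bullet> d')" using e[OF d'(2)] by (simp add: algebra_simps)
        also have "s * (y1 \<bullet> d) = - (1 - s) * (y0 \<bullet> d)" using e[OF d(2)] by (simp add: algebra_simps)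
        finally have "y1 \<bullet> ((y0 \<bullet> d) *\<^sub>R d' - (y0 \<bullet> d') *\<^sub>R d) = 0" using s0 by simp
        from E[OF d(1) d'(1) this] have "(y0 \<bullet> d) *\<^sub>R d' = (y0 \<bullet> d') *\<^sub>R d" by simp
        hence "d' = ((y0 \<bullet> d') / (y0 \<bullet> d)) *\<^sub>R d"
          using y0 d(1)
          by (metis generic_def divideR_right divide_inverse_commute inverse_eq_divide scaleR_scaleR times_divide_eq_left mult_1)
        thus ?thesis using u(2) by (metis span_scale)
      qed
      have yU: "\<forall>u'\<in>U. u' \<noteq> u \<longrightarrow> y \<bullet> u' \<noteq> 0"
      proof (intro ballI impI notI)
        fix u' assume u': "u' \<in> U" "u' \<noteq> u" and "y \<bullet> u' = 0"
        obtain d' where d': "d' \<in> D" "u' = sgn d'" using UD[OF u'(1)] by blast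
        have "d' \<in> span {u}" using only[OF d'(1)] \<open>y \<bullet> u' = 0\<close> d'(2) Uzero by simp
        hence "u' \<in> span {u}" by (simp add: d'(2) sgn_div_norm span_scale)
        thus False using par[OF u(1) u'(1)] u'(2) by simp
      qed
      obtain a where F: "min_face P y = closed_segment a (a + l u *\<^sub>R u)"
      proof -
        have "b - a \<in> span {u}" if "a \<in> V" "b \<in> V" "y \<bullet> (b - a) = 0" for a b
          using only[of "b - a"] that by (cases "a = b") (auto simp: D_def span_zero)
        from l(2)[OF u(1) yu this] show ?thesis using that by blast
      qed
      from vertex_difference_locally_constant[where l = l and y = y and u = u, OF eventually_min_face_hull[OF P(2)] U(1) u(1) yU l(1) F]
      obtain c where c: "\<And>v. v \<bullet> u \<noteq> 0 \<Longrightarrow> \<forall>\<^sub>F \<tau> in at_right 0. y \<bullet> u = 0 \<longrightarrow>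
          min_point P (y + \<tau> *\<^sub>R v) - zonotope_vertex l U (y + \<tau> *\<^sub>R v) = c"
        by blast
      \<comment> \<open>The line cannot run inside the hyperplane orthogonal to \<open>u\<close>, as
        it starts at \<open>y0\<close>.\<close>
      have "v \<bullet> u \<noteq> 0"
      proof
        assume "v \<bullet> u = 0"
        hence "y0 \<bullet> u = 0" using yu by (simp add: ydef inner_add_left)
        thus False using U(3)[OF u(1)] by simp
      qed
      thus ?thesis using c[of v] c[of "- v"] yu by (auto simp: \<psi>_def)
    qed
    have f: "\<exists>c. (\<forall>\<^sub>F \<tau> in at_right 0. f (s + \<tau>) = c) \<and> (\<forall>\<^sub>F \<tau> in at_right 0. f (s - \<tau>) = c)" for s
      using cross[OF refl, of s] by (simp add: f_def scaleR_add_left scaleR_diff_left add.assoc add_diff_eq)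
    have "\<forall>\<^sub>F \<tau> in at_right 0. f (0 + \<tau>) = f (1 + \<tau>)"
      by (rule one_sided_constant_on_line[OF f]) simp
    moreover have "\<forall>\<^sub>F \<tau> in at_right 0. f (0 + \<tau>) = \<psi> y0"
      using gen_ev[OF y0, of v] by (simp add: f_def)
    moreover have "\<forall>\<^sub>F \<tau> in at_right 0. f (1 + \<tau>) = \<psi> y1"
      using gen_ev[OF y1, of v] by (simp add: f_def v_def scaleR_add_left add.assoc[symmetric])
    ultimately have "\<forall>\<^sub>F \<tau> in at_right (0::real). \<psi> y1 = \<psi> y0" by eventually_elim simp
    thus ?thesis by (simp add: eventually_const)
  qed
  have const: "\<psi> y1 = \<psi> y0" if y1: "generic y1" for y1
  proof -
    \<comment> \<open>The nonzero combinations are those on which the line argument must not vanish.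
      Moving \<open>y1\<close> slightly away from all orthogonal hyperplanes leaves \<psi>
      unchanged.\<close>
    define E where "E = D \<union> ((\<lambda>(d, d'). (y0 \<bullet> d) *\<^sub>R d' - (y0 \<bullet> d') *\<^sub>R d) ` (D \<times> D) - {0})"
    have E: "finite E" "0 \<notin> E" using D by (auto simp: E_def)
    obtain v where v: "\<And>e. e \<in> E \<Longrightarrow> v \<bullet> e \<noteq> 0" using exists_nonorthogonal[OF E] by blast
    have "\<forall>\<^sub>F \<tau> in at_right 0. \<forall>e\<in>E. (y1 + \<tau> *\<^sub>R v) \<bullet> e \<noteq> 0"
      using E v by (intro eventually_ball_finite ballI eventually_inner_nonzero) auto
    with gen_ev[OF y1, of v]
    have "\<forall>\<^sub>F \<tau> in at_right 0. \<psi> (y1 + \<tau> *\<^sub>R v) = \<psi> y1 \<and> (\<forall>e\<in>E. (y1 + \<tau> *\<^sub>R v) \<bullet> e \<noteq> 0)"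
      by eventually_elim simp
    from eventually_happens'[OF trivial_limit_at_right_real this]
    obtain \<tau> where t: "\<psi> (y1 + \<tau> *\<^sub>R v) = \<psi> y1" "\<And>e. e \<in> E \<Longrightarrow> (y1 + \<tau> *\<^sub>R v) \<bullet> e \<noteq> 0" by blast
    have "\<psi> (y1 + \<tau> *\<^sub>R v) = \<psi> y0"
    proof (rule line)
      show "generic (y1 + \<tau> *\<^sub>R v)" using t(2) by (auto simp: generic_def E_def)
      show "(y0 \<bullet> d) *\<^sub>R d' - (y0 \<bullet> d') *\<^sub>R d = 0"
        if "d \<in> D" "d' \<in> D" "(y1 + \<tau> *\<^sub>R v) \<bullet> ((y0 \<bullet> d) *\<^sub>R d' - (y0 \<bullet> d') *\<^sub>R d) = 0" for d d'
        using t(2)[of "(y0 \<bullet> d) *\<^sub>R d' - (y0 \<bullet> d') *\<^sub>R d"] that by (force simp: E_def)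
    qed
    thus ?thesis using t(1) by simp
  qed
  define Z where "Z = zonotope_on U (\<lambda>u. l u *\<^sub>R u)"
  have Z: "compact Z" "convex Z" using zonotope_on_compact_convex[OF U(1)] by (auto simp: Z_def)
  have q: "zonotope_vertex l U y \<in> Z" "\<And>x. x \<in> Z \<Longrightarrow> y \<bullet> zonotope_vertex l U y \<le> y \<bullet> x" if g: "generic y" for y
  proof -
    \<comment> \<open>Directions with \<open>l u = 0\<close> are selected by only one of the two
      sign conditions, but their summand is zero.\<close>
    have sub: "{u\<in>U. y \<bullet> (l u *\<^sub>R u) < 0} \<subseteq> {u\<in>U. y \<bullet> u < 0}"
      using l(1) by (auto simp: mult_less_0_iff not_less[symmetric])
    have "l u = 0" if "y \<bullet> u < 0" "\<not> y \<bullet> (l u *\<^sub>R u) < 0" for u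
      using that l(1)[of u] by (auto simp: mult_less_0_iff)
    hence "zonotope_vertex l U y = (\<Sum>u\<in>{u\<in>U. y \<bullet> (l u *\<^sub>R u) < 0}. l u *\<^sub>R u)"
      unfolding zonotope_vertex_def using U(1) sub by (intro sum.mono_neutral_right) auto
    thus "zonotope_vertex l U y \<in> Z" "\<And>x. x \<in> Z \<Longrightarrow> y \<bullet> zonotope_vertex l U y \<le> y \<bullet> x"
      using zonotope_on_minimizer[OF U(1), of _ "\<lambda>u. l u *\<^sub>R u" y] zonotope_on_memI[of U "\<lambda>_. 0"]
      unfolding Z_def by fastforce+
  qed
  define c where "c = \<psi> y0"
  have p: "min_point P y = c + zonotope_vertex l U y" "min_point P y \<in> P" "\<And>x. x \<in> P \<Longrightarrow> y \<bullet> min_point P y \<le> y \<bullet> x"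
    if g: "generic y" for y
  proof -
    show "min_point P y = c + zonotope_vertex l U y"
      using const[OF g] by (simp add: c_def[symmetric] \<psi>_def[of y] algebra_simps)
    obtain x where "min_face P y = {x}" using single[OF g] by blast
    hence "min_point P y \<in> min_face P y" by (simp add: min_point_eq)
    thus "min_point P y \<in> P" "\<And>x. x \<in> P \<Longrightarrow> y \<bullet> min_point P y \<le> y \<bullet> x" by (auto simp: min_face_def)
  qed
  have "P = (+) c ` Z"
  proof
    show "P \<subseteq> (+) c ` Z"
    proof (rule subset_if_generic_minimizers[OF _ _ D])
      show "compact ((+) c ` Z)" "convex ((+) c ` Z)"
        using Z by (auto intro: compact_translation convex_translation)
      fix y assume "\<And>d. d \<in> D \<Longrightarrow> y \<bullet> d \<noteq> 0"
      hence g: "generic y" by (simp add: generic_def)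
      show "\<exists>p\<in>(+) c ` Z. \<forall>x\<in>P. y \<bullet> p \<le> y \<bullet> x"
        using p[OF g] q(1)[OF g] by (intro bexI[of _ "min_point P y"]) auto
    qed
    show "(+) c ` Z \<subseteq> P"
    proof (rule subset_if_generic_minimizers[OF lattice_hull_props(1,2)[OF P(2)] D])
      fix y assume "\<And>d. d \<in> D \<Longrightarrow> y \<bullet> d \<noteq> 0"
      hence g: "generic y" by (simp add: generic_def)
      show "\<exists>p\<in>P. \<forall>x\<in>(+) c ` Z. y \<bullet> p \<le> y \<bullet> x"
        using p(1,2)[OF g] q(2)[OF g] by (intro bexI[of _ "min_point P y"]) (auto simp: inner_add_right)
    qed
  qed
  thus ?thesis unfolding Z_def using U(1) by (rule zonotope_up_to_translationI[rotated])
qed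

subsection \<open>Lexicographically maximal representations\<close>

definition lex_pos :: "nat \<Rightarrow> (nat \<Rightarrow> real) \<Rightarrow> bool" where
  "lex_pos n \<mu> \<longleftrightarrow> (\<exists>i<n. \<mu> i > 0 \<and> (\<forall>j<i. \<mu> j = 0))"

text \<open>A canonical choice among the coefficient vectors of a point; the order of the generators
  plays the part of a generic height function in a subdivision.\<close>

definition lex_maximal :: "nat \<Rightarrow> (nat \<Rightarrow> real) set \<Rightarrow> (nat \<Rightarrow> real) \<Rightarrow> bool" where
  "lex_maximal n K a \<longleftrightarrow> a \<in> K \<and> (\<forall>b\<in>K. \<not> lex_pos n (\<lambda>i. b i - a i))"

text \<open>Coordinates are maximised one after another, each on the compact set where the earlier
  ones are already fixed.\<close>

lemma exists_lex_maximal: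
  fixes K :: "(nat \<Rightarrow> real) set"
  assumes "compact K" "K \<noteq> {}"
  shows "\<exists>a. lex_maximal n K a"
proof (induction n)
  case 0
  thus ?case using assms by (auto simp: lex_maximal_def lex_pos_def)
next
  case (Suc n)
  then obtain a where a: "a \<in> K" "\<And>b. b \<in> K \<Longrightarrow> \<not> lex_pos n (\<lambda>i. b i - a i)"
    by (auto simp: lex_maximal_def)
  define K' where "K' = K \<inter> {b. \<forall>j\<in>{..<n}. b j = a j}"
  have "{b. \<forall>j\<in>{..<n}. b j = a j} = (\<Inter>j\<in>{..<n}. {b :: nat \<Rightarrow> real. b j = a j})" by auto
  moreover have "closed {b :: nat \<Rightarrow> real. b j = a j}" for j
    by (intro closed_Collect_eq continuous_on_product_coordinates continuous_on_const)
  ultimately have "closed {b. \<forall>j\<in>{..<n}. b j = a j}" by (simp add: closed_INT)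
  hence "compact K'" unfolding K'_def using assms(1) by (intro compact_Int_closed)
  moreover have "K' \<noteq> {}" using a(1) by (auto simp: K'_def)
  moreover have "continuous_on K' (\<lambda>b. b n)"
    by (rule continuous_on_subset[OF continuous_on_product_coordinates]) auto
  ultimately obtain c where c: "c \<in> K'" "\<And>b. b \<in> K' \<Longrightarrow> b n \<le> c n"
    using continuous_attains_sup[of K' "\<lambda>b. b n"] by blast
  have ca: "c j = a j" if "j < n" for j using c(1) that by (auto simp: K'_def)
  have "\<not> lex_pos (Suc n) (\<lambda>i. b i - c i)" if b: "b \<in> K" for b
  proof
    assume "lex_pos (Suc n) (\<lambda>i. b i - c i)"
    then obtain i where i: "i < Suc n" "b i - c i > 0" "\<And>j. j < i \<Longrightarrow> b j - c j = 0"
      by (auto simp: lex_pos_def)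
    show False
    proof (cases "i < n")
      case True
      hence "lex_pos n (\<lambda>i. b i - a i)"
        unfolding lex_pos_def using i ca by (intro exI[of _ i]) auto
      thus False using a(2)[OF b] by blast
    next
      case False
      hence "i = n" using i(1) by simp
      hence "b \<in> K'" using b i(3) ca by (auto simp: K'_def)
      thus False using c(2) i(2) \<open>i = n\<close> by fastforce
    qed
  qed
  thus ?case using c(1) by (auto simp: lex_maximal_def K'_def)
qed

lemma lex_pos_total:
  assumes "i < n" "\<mu> i \<noteq> 0"
  shows "lex_pos n \<mu> \<or> lex_pos n (\<lambda>i. - \<mu> i)"
proof -
  define k where "k = (LEAST k. \<mu> k \<noteq> 0)"
  have k: "\<mu> k \<noteq> 0" unfolding k_def using assms(2) by (rule LeastI)
  have "k \<le> i" unfolding k_def using assms(2) by (rule Least_le)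
  hence "k < n" using assms(1) by simp
  moreover have "\<mu> j = 0" if "j < k" for j using not_less_Least[of j] that unfolding k_def by blast
  moreover have "\<mu> k > 0 \<or> - \<mu> k > 0" using k by linarith
  ultimately show ?thesis unfolding lex_pos_def by auto
qed

lemma lex_maximal_unique:
  assumes "lex_maximal n K a" "lex_maximal n K b" "\<And>i. i \<ge> n \<Longrightarrow> a i = b i"
  shows "a = b"
proof (rule ccontr)
  assume "a \<noteq> b"
  then obtain i where i: "a i - b i \<noteq> 0" by (auto simp: fun_eq_iff)
  hence "i < n" using assms(3) by (metis not_le diff_self)
  from lex_pos_total[of i n "\<lambda>i. a i - b i", OF this i] show False
    using assms(1,2) by (auto simp: lex_maximal_def)
qed

text \<open>A positive factor does not change the lexicographic sign, so an improvement of
  \<open>a'\<close> would yield one of \<open>a\<close> by a small step in the same direction.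
  Maximality thus depends only on which constraints are tight.\<close>

lemma lex_maximal_transfer:
  assumes "lex_maximal n K a" "a' \<in> K'"
    and step: "\<And>b. b \<in> K' \<Longrightarrow> \<exists>\<epsilon>>0. (\<lambda>i. a i + \<epsilon> * (b i - a' i)) \<in> K"
  shows "lex_maximal n K' a'"
  unfolding lex_maximal_def
proof (intro conjI ballI notI)
  fix b assume b: "b \<in> K'" "lex_pos n (\<lambda>i. b i - a' i)"
  obtain \<epsilon> where e: "\<epsilon> > 0" "(\<lambda>i. a i + \<epsilon> * (b i - a' i)) \<in> K" using step[OF b(1)] by blast
  have "lex_pos n (\<lambda>i. (a i + \<epsilon> * (b i - a' i)) - a i)"
    using b(2) e(1) by (auto simp: lex_pos_def zero_less_mult_iff)
  thus False using assms(1) e(2) by (auto simp: lex_maximal_def)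
qed (fact assms(2))

text \<open>Setting the coefficients from \<open>n\<close> on to 0 makes the box compact in the
  product topology.\<close>

lemma compact_fun_box:
  "compact {a :: nat \<Rightarrow> real. (\<forall>i<n. 0 \<le> a i \<and> a i \<le> h) \<and> (\<forall>i\<ge>n. a i = 0)}"
proof -
  have "compactin (product_topology (\<lambda>_. euclidean) UNIV) (PiE UNIV (\<lambda>i. if i < n then {0..h} else {0::real}))"
    unfolding compactin_PiE by auto
  hence "compact (PiE (UNIV :: nat set) (\<lambda>i. if i < n then {0..h} else {0::real}))"
    by (simp add: euclidean_product_topology)
  moreover have "PiE (UNIV :: nat set) (\<lambda>i. if i < n then {0..h} else {0::real})
      = {a :: nat \<Rightarrow> real. (\<forall>i<n. 0 \<le> a i \<and> a i \<le> h) \<and> (\<forall>i\<ge>n. a i = 0)}"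
    by (auto simp: PiE_iff split: if_splits)
  ultimately show ?thesis by simp
qed

lemma closed_linear_fiber:
  fixes u :: "nat \<Rightarrow> 'a::real_normed_vector"
  shows "closed {a :: nat \<Rightarrow> real. (\<Sum>i<n. a i *\<^sub>R u i) = x}"
  by (intro closed_Collect_eq continuous_on_sum continuous_on_scaleR continuous_on_const
      continuous_on_product_coordinates)

lemma exists_small_positive:
  fixes c :: "nat \<Rightarrow> real"
  assumes "finite A" "\<And>i. i \<in> A \<Longrightarrow> c i > 0"
  shows "\<exists>\<epsilon>>0. \<forall>i\<in>A. c i + \<epsilon> * \<mu> i > 0"
proof -
  have "\<forall>\<^sub>F \<epsilon> in at_right 0. \<forall>i\<in>A. c i + \<epsilon> * \<mu> i > 0"
  proof (intro eventually_ball_finite assms(1) ballI)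
    fix i assume "i \<in> A"
    have "((\<lambda>\<epsilon>. c i + \<epsilon> * \<mu> i) \<longlongrightarrow> c i + 0 * \<mu> i) (at_right 0)" by (intro tendsto_intros)
    thus "\<forall>\<^sub>F \<epsilon> in at_right 0. c i + \<epsilon> * \<mu> i > 0"
      using assms(2)[OF \<open>i \<in> A\<close>] by (intro order_tendstoD) auto
  qed
  moreover have "\<forall>\<^sub>F \<epsilon> in at_right (0::real). \<epsilon> > 0" by (rule eventually_at_right_less)
  ultimately have "\<forall>\<^sub>F \<epsilon> in at_right 0. \<epsilon> > 0 \<and> (\<forall>i\<in>A. c i + \<epsilon> * \<mu> i > 0)" by eventually_elim simp
  from eventually_happens'[OF trivial_limit_at_right_real this] show ?thesis by blast
qed

lemma sum_lessThan_restrict: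
  fixes u :: "nat \<Rightarrow> 'a::real_vector"
  assumes "A \<subseteq> {..<n}" "\<And>i. i \<notin> A \<Longrightarrow> a i = 0"
  shows "(\<Sum>i<n. a i *\<^sub>R u i) = (\<Sum>i\<in>A. a i *\<^sub>R u i)"
  using assms by (intro sum.mono_neutral_right) auto

subsection \<open>Ehrhart polynomials of translated lattice polytopes\<close>

text \<open>The representations of the lifted point \<open>(x, t)\<close> by the lifted generators
  \<open>(v i, 1)\<close>. Coefficients from \<open>n\<close> on are 0, which makes fibres compact
  and lets lexicographic maximality single out one function.\<close>

definition cone_fiber :: "nat \<Rightarrow> (nat \<Rightarrow> 'a::real_vector) \<Rightarrow> real \<Rightarrow> 'a \<Rightarrow> (nat \<Rightarrow> real) set" where
  "cone_fiber n v t x = {a. (\<forall>i<n. 0 \<le> a i) \<and> (\<forall>i\<ge>n. a i = 0) \<and> (\<Sum>i<n. a i) = t \<and> (\<Sum>i<n. a i *\<^sub>R v i) = x}"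

lemma compact_cone_fiber:
  fixes v :: "nat \<Rightarrow> 'a::real_normed_vector"
  shows "compact (cone_fiber n v t x)"
proof -
  have le: "a i \<le> (\<Sum>i<n. a i)" if "\<forall>i<n. 0 \<le> a i" "i < n" for a :: "nat \<Rightarrow> real" and i
    using that by (intro member_le_sum) auto
  have "cone_fiber n v t x = {a. (\<forall>i<n. 0 \<le> a i \<and> a i \<le> t) \<and> (\<forall>i\<ge>n. a i = 0)} \<inter>
      ({a. (\<Sum>i<n. a i *\<^sub>R (1::real)) = t} \<inter> {a. (\<Sum>i<n. a i *\<^sub>R v i) = x})"
    using le by (auto simp: cone_fiber_def)
  thus ?thesis by (auto intro!: compact_Int_closed compact_fun_box closed_Int simp only: closed_linear_fiber)
qed

lemma scaled_hull_iff_cone_fiber: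
  fixes v :: "nat \<Rightarrow> 'a::real_vector"
  assumes "inj_on v {..<n}" "t > 0"
  shows "x \<in> (\<lambda>x. t *\<^sub>R x) ` (convex hull (v ` {..<n})) \<longleftrightarrow> cone_fiber n v t x \<noteq> {}"
proof
  assume "x \<in> (\<lambda>x. t *\<^sub>R x) ` (convex hull (v ` {..<n}))"
  then obtain c where c: "\<forall>z\<in>v ` {..<n}. 0 \<le> c z" "sum c (v ` {..<n}) = 1" "x = t *\<^sub>R (\<Sum>z\<in>v ` {..<n}. c z *\<^sub>R z)"
    by (auto simp: convex_hull_finite)
  define a where "a i = (if i < n then t * c (v i) else 0)" for i
  have "(\<Sum>i<n. a i) = t * (\<Sum>i<n. c (v i))" by (simp add: a_def sum_distrib_left)
  also have "(\<Sum>i<n. c (v i)) = 1" using c(2) assms(1) by (simp add: sum.reindex)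
  finally have "(\<Sum>i<n. a i) = t" by simp
  moreover have "(\<Sum>i<n. a i *\<^sub>R v i) = x"
    unfolding c(3) using assms(1) by (simp add: a_def sum.reindex scaleR_sum_right)
  ultimately have "a \<in> cone_fiber n v t x" using c(1) assms(2) by (auto simp: cone_fiber_def a_def)
  thus "cone_fiber n v t x \<noteq> {}" by blast
next
  assume "cone_fiber n v t x \<noteq> {}"
  then obtain a where a: "\<forall>i<n. 0 \<le> a i" "(\<Sum>i<n. a i) = t" "(\<Sum>i<n. a i *\<^sub>R v i) = x"
    by (auto simp: cone_fiber_def)
  have "(\<Sum>i<n. (a i / t) *\<^sub>R v i) \<in> convex hull (v ` {..<n})"
    using a(1,2) assms(2) by (intro convex_sum) (auto simp: hull_inc simp flip: sum_divide_distrib)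
  moreover have "x = t *\<^sub>R (\<Sum>i<n. (a i / t) *\<^sub>R v i)"
    using assms(2) a(3) by (simp add: scaleR_sum_right)
  ultimately show "x \<in> (\<lambda>x. t *\<^sub>R x) ` (convex hull (v ` {..<n}))" by blast
qed

section \<open>Counting compositions\<close>

text \<open>Stars and bars, transported to lists of length \<open>card A\<close> along an
  enumeration of \<open>A\<close>.\<close>

lemma card_compositions:
  assumes "finite A" "A \<noteq> {}"
  shows "finite {m :: nat \<Rightarrow> nat. (\<forall>i. i \<notin> A \<longrightarrow> m i = 0) \<and> sum m A = s}"
    and "card {m :: nat \<Rightarrow> nat. (\<forall>i. i \<notin> A \<longrightarrow> m i = 0) \<and> sum m A = s} = (s + card A - 1) choose (card A - 1)"
proof -
  let ?M = "{m :: nat \<Rightarrow> nat. (\<forall>i. i \<notin> A \<longrightarrow> m i = 0) \<and> sum m A = s}"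
  let ?L = "{l :: nat list. length l = card A \<and> sum_list l = s}"
  obtain f where f: "bij_betw f {..<card A} A"
    using ex_bij_betw_nat_finite[OF assms(1)] by (auto simp: lessThan_atLeast0)
  have fA: "f j \<in> A" if "j < card A" for j using f that by (auto dest: bij_betwE)
  define g where "g = inv_into {..<card A} f"
  have g: "g i < card A" "f (g i) = i" if "i \<in> A" for i
    using that bij_betw_apply[OF bij_betw_inv_into[OF f]] bij_betw_inv_into_right[OF f] by (auto simp: g_def)
  have gf: "g (f j) = j" if "j < card A" for j using bij_betw_inv_into_left[OF f] that by (simp add: g_def)
  have bij: "bij_betw (\<lambda>m. map (\<lambda>j. m (f j)) [0..<card A]) ?M ?L"
  proof (rule bij_betw_byWitness[where f' = "\<lambda>l i. if i \<in> A then l ! g i else 0"])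
    show "\<forall>m\<in>?M. (\<lambda>i. if i \<in> A then map (\<lambda>j. m (f j)) [0..<card A] ! g i else 0) = m"
      using g by (auto simp: fun_eq_iff)
    show "\<forall>l\<in>?L. map (\<lambda>j. if f j \<in> A then l ! g (f j) else 0) [0..<card A] = l"
      using fA gf by (auto intro!: nth_equalityI)
    have "sum_list (map (\<lambda>j. m (f j)) [0..<card A]) = sum m A" for m :: "nat \<Rightarrow> nat"
      using sum.reindex_bij_betw[OF f, of m] by (simp add: interv_sum_list_conv_sum_set_nat lessThan_atLeast0)
    thus "(\<lambda>m. map (\<lambda>j. m (f j)) [0..<card A]) ` ?M \<subseteq> ?L" by auto
    have "sum (\<lambda>i. if i \<in> A then l ! g i else 0) A = s" if l: "l \<in> ?L" for l
    proof -
      have "sum (\<lambda>i. if i \<in> A then l ! g i else 0) A = (\<Sum>j<card A. l ! g (f j))"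
        using sum.reindex_bij_betw[OF f, of "\<lambda>i. l ! g i"] by simp
      also have "\<dots> = (\<Sum>j<card A. l ! j)" by (intro sum.cong) (auto simp: gf)
      also have "\<dots> = s" using l by (auto simp: sum_list_sum_nth lessThan_atLeast0)
      finally show ?thesis .
    qed
    thus "(\<lambda>l i. if i \<in> A then l ! g i else 0) ` ?L \<subseteq> ?M" by auto
  qed
  have "finite ?L"
  proof (rule finite_subset)
    show "?L \<subseteq> {l. set l \<subseteq> {..s} \<and> length l = card A}" by (auto dest: member_le_sum_list)
  qed (simp add: finite_lists_length_eq)
  thus "finite ?M" using bij_betw_finite[OF bij] by blast
  have pos: "card A > 0" using assms by (simp add: card_gt_0_iff)
  have "card ?M = (s + card A - 1) choose s"
    using bij_betw_same_card[OF bij] by (simp add: card_length_sum_list)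
  also have "\<dots> = (s + card A - 1) choose (card A - 1)"
    using pos binomial_symmetric[of s "s + card A - 1"] by simp
  finally show "card ?M = (s + card A - 1) choose (card A - 1)" .
qed

lemma binomial_shift_poly: "\<exists>q :: rat poly. \<forall>t. poly q (of_nat t) = of_nat ((t + e) choose b)"
proof -
  define q :: "rat poly" where "q = smult (1 / fact b) (\<Prod>i<b. [:of_nat e - of_nat i, 1:])"
  have "poly q (of_nat t) = of_nat ((t + e) choose b)" for t
  proof -
    have "of_nat ((t + e) choose b) = ((of_nat (t + e) :: rat) gchoose b)" by (rule binomial_gbinomial)
    also have "\<dots> = (\<Prod>i<b. of_nat (t + e) - of_nat i) / fact b"
      by (simp add: gbinomial_prod_rev lessThan_atLeast0)
    finally show ?thesis by (simp add: q_def poly_prod algebra_simps)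
  qed
  thus ?thesis by blast
qed

text \<open>The binomial coefficient gives the right value 0 also for \<open>1 \<le> t < s\<close>:
  by \<open>s \<le> card A\<close> its upper index is then a natural number below
  \<open>card A - 1\<close>. This is where positivity of \<open>t\<close> enters.\<close>

lemma compositions_poly:
  assumes A: "finite A" "A \<noteq> {}" and s: "s \<le> card A"
  shows "\<exists>q :: rat poly. \<forall>t\<ge>1. poly q (of_nat t) =
    of_nat (card {m :: nat \<Rightarrow> nat. (\<forall>i. i \<notin> A \<longrightarrow> m i = 0) \<and> sum m A + s = t})"
proof -
  have pos: "card A > 0" using A by (simp add: card_gt_0_iff)
  obtain q :: "rat poly" where q: "\<And>t. poly q (of_nat t) = of_nat ((t + (card A - s)) choose (card A - 1))"
    using binomial_shift_poly by blast
  have "poly (pcompose q [:- 1, 1:]) (of_nat t) =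
      of_nat (card {m :: nat \<Rightarrow> nat. (\<forall>i. i \<notin> A \<longrightarrow> m i = 0) \<and> sum m A + s = t})" if t: "t \<ge> 1" for t
  proof -
    have "poly (pcompose q [:- 1, 1:]) (of_nat t) = poly q (of_nat (t - 1))"
      using t by (simp add: poly_pcompose of_nat_diff)
    also have "\<dots> = of_nat ((t - 1 + (card A - s)) choose (card A - 1))" by (rule q)
    also have "(t - 1 + (card A - s)) choose (card A - 1) =
        card {m :: nat \<Rightarrow> nat. (\<forall>i. i \<notin> A \<longrightarrow> m i = 0) \<and> sum m A + s = t}"
    proof (cases "s \<le> t")
      case True
      have "{m :: nat \<Rightarrow> nat. (\<forall>i. i \<notin> A \<longrightarrow> m i = 0) \<and> sum m A + s = t}
          = {m. (\<forall>i. i \<notin> A \<longrightarrow> m i = 0) \<and> sum m A = t - s}" using True by auto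
      moreover have "t - 1 + (card A - s) = t - s + card A - 1" using True s t by simp
      ultimately show ?thesis using card_compositions(2)[OF A] by simp
    next
      case False
      hence "{m :: nat \<Rightarrow> nat. (\<forall>i. i \<notin> A \<longrightarrow> m i = 0) \<and> sum m A + s = t} = {}" by auto
      moreover have "t - 1 + (card A - s) < card A - 1" using False s t by simp
      ultimately show ?thesis by (simp only: card.empty binomial_eq_0)
    qed
    finally show ?thesis .
  qed
  thus ?thesis by blast
qed

section \<open>Cells of lexicographically maximal coefficients\<close>

text \<open>All vectors with support \<open>A\<close> are required to be maximal, so a cell consists
  of all positive coefficients on \<open>A\<close> and can be counted without reference to
  maximality.\<close>

definition cone_pattern :: "nat \<Rightarrow> (nat \<Rightarrow> 'a::real_vector) \<Rightarrow> nat set \<Rightarrow> bool" where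
  "cone_pattern n v A \<longleftrightarrow> A \<subseteq> {..<n} \<and>
     (\<forall>a. (\<forall>i. 0 < a i \<longleftrightarrow> i \<in> A) \<longrightarrow> (\<forall>i. 0 \<le> a i) \<longrightarrow>
       lex_maximal n (cone_fiber n v (\<Sum>i<n. a i) (\<Sum>i<n. a i *\<^sub>R v i)) a)"

text \<open>Whether a nonnegative combination is lexicographically maximal in its fibre depends on its
  support only; this replaces a triangulation.\<close>

lemma cone_pattern_support:
  assumes "lex_maximal n (cone_fiber n v t x) a"
  shows "cone_pattern n v {i. a i > 0}"
  unfolding cone_pattern_def
proof (intro conjI allI impI)
  have a: "a \<in> cone_fiber n v t x" using assms by (simp add: lex_maximal_def)
  have nn: "0 \<le> a i" for i using a by (cases "i < n") (auto simp: cone_fiber_def)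
  show sub: "{i. a i > 0} \<subseteq> {..<n}"
  proof
    fix i assume "i \<in> {i. a i > 0}"
    thus "i \<in> {..<n}" using a by (cases "i < n") (auto simp: cone_fiber_def)
  qed
  fix a' :: "nat \<Rightarrow> real"
  assume a': "\<forall>i. 0 < a' i \<longleftrightarrow> i \<in> {i. a i > 0}" "\<forall>i. 0 \<le> a' i"
  have out: "a' i = 0" if "i \<ge> n" for i
    using a'(1)[rule_format, of i] a'(2)[rule_format, of i] sub that by force
  let ?K = "cone_fiber n v (\<Sum>i<n. a' i) (\<Sum>i<n. a' i *\<^sub>R v i)"
  show "lex_maximal n ?K a'"
  proof (rule lex_maximal_transfer[OF assms])
    show "a' \<in> ?K" using a'(2) out by (auto simp: cone_fiber_def)
    fix b assume b: "b \<in> ?K"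
    have "finite {i. a i > 0}" using sub finite_subset by blast
    \<comment> \<open>On the support a small step keeps coefficients positive; off the support
      \<open>a'\<close> is 0, so the step towards \<open>b\<close> cannot lower them.\<close>
    hence "\<exists>\<epsilon>>0. \<forall>i\<in>{i. a i > 0}. a i + \<epsilon> * (b i - a' i) > 0" by (rule exists_small_positive) simp
    then obtain \<epsilon> where e: "\<epsilon> > 0" "\<forall>i\<in>{i. a i > 0}. a i + \<epsilon> * (b i - a' i) > 0" by blast
    have "0 \<le> a i + \<epsilon> * (b i - a' i)" if "i < n" for i
    proof (cases "a i > 0")
      case True
      thus ?thesis using e(2) by (auto intro: less_imp_le)
    next
      case False
      hence "a i = 0" "a' i = 0" using nn[of i] a'(1)[rule_format, of i] a'(2)[rule_format, of i] by auto
      thus ?thesis using e(1) b that by (auto simp: cone_fiber_def)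
    qed
    moreover have "(\<Sum>i<n. (a i + \<epsilon> * (b i - a' i)) *\<^sub>R v i)
        = (\<Sum>i<n. a i *\<^sub>R v i) + \<epsilon> *\<^sub>R ((\<Sum>i<n. b i *\<^sub>R v i) - (\<Sum>i<n. a' i *\<^sub>R v i))"
      by (simp add: scaleR_add_left sum.distrib scaleR_sum_right scaleR_diff_right scaleR_diff_left sum_subtractf right_diff_distrib)
    moreover have "(\<Sum>i<n. a i + \<epsilon> * (b i - a' i)) = (\<Sum>i<n. a i) + \<epsilon> * ((\<Sum>i<n. b i) - (\<Sum>i<n. a' i))"
      by (simp add: sum.distrib sum_distrib_left sum_subtractf right_diff_distrib)
    ultimately show "\<exists>\<epsilon>>0. (\<lambda>i. a i + \<epsilon> * (b i - a' i)) \<in> cone_fiber n v t x"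
      using e(1) a b out by (intro exI[of _ \<epsilon>]) (auto simp: cone_fiber_def)
  qed
qed

lemma unique_fractional_split:
  fixes r r' :: real and m m' :: nat
  assumes "0 < r" "r \<le> 1" "0 < r'" "r' \<le> 1" "real m + r = real m' + r'"
  shows "m = m'" "r = r'"
proof -
  have "\<bar>real m - real m'\<bar> < 1" using assms by linarith
  hence m: "m = m'" by linarith
  show "m = m'" by (rule m)
  show "r = r'" using assms(5) unfolding m by simp
qed

lemma fractional_split:
  fixes x :: real
  assumes "x > 0"
  obtains m :: nat and r where "0 < r" "r \<le> 1" "x = real m + r"
proof -
  have "\<lceil>x\<rceil> \<ge> 1" using assms by linarith
  hence "real (nat (\<lceil>x\<rceil> - 1)) = of_int \<lceil>x\<rceil> - 1" by simp
  moreover have "of_int \<lceil>x\<rceil> - 1 < x" "x \<le> of_int \<lceil>x\<rceil>" by linarith+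
  ultimately show ?thesis by (intro that[of "x - real (nat (\<lceil>x\<rceil> - 1))" "nat (\<lceil>x\<rceil> - 1)"]) auto
qed

definition cone_cell :: "(nat \<Rightarrow> real ^ 'd) \<Rightarrow> real ^ 'd \<Rightarrow> nat set \<Rightarrow> real \<Rightarrow> (nat \<Rightarrow> real) set" where
  "cone_cell v w A t = {a. (\<forall>i. 0 \<le> a i) \<and> (\<forall>i. 0 < a i \<longleftrightarrow> i \<in> A) \<and> sum a A = t \<and>
     (\<Sum>i\<in>A. a i *\<^sub>R v i) + w \<in> integer_points}"

text \<open>Each lattice point counted has exactly one lexicographically maximal coefficient vector,
  and the support of that vector names its cell.\<close>

lemma cone_cell_decomposition:
  fixes v :: "nat \<Rightarrow> real ^ 'd"
  assumes v: "inj_on v {..<n}" and t: "t > 0"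
  defines "P \<equiv> convex hull (v ` {..<n})"
  defines "\<A> \<equiv> {A. cone_pattern n v A}"
  shows "finite \<A>" and "\<And>A. A \<in> \<A> \<Longrightarrow> finite (cone_cell v w A t)"
    and "count_shift ((\<lambda>x. t *\<^sub>R x) ` P) w = (\<Sum>A\<in>\<A>. card (cone_cell v w A t))"
proof -
  have AA: "A \<subseteq> {..<n}" if "A \<in> \<A>" for A using that by (simp add: \<A>_def cone_pattern_def)
  hence "\<A> \<subseteq> Pow {..<n}" by blast
  thus finA: "finite \<A>" by (rule finite_subset) simp
  define X where "X = {x \<in> integer_points. x - w \<in> (\<lambda>x. t *\<^sub>R x) ` P}"
  define M where "M = (\<Union>A\<in>\<A>. cone_cell v w A t)"
  define g where "g a = (\<Sum>i<n. a i *\<^sub>R v i) + w" for a :: "nat \<Rightarrow> real"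
  have cell: "a \<in> cone_fiber n v t (g a - w)" "lex_maximal n (cone_fiber n v t (g a - w)) a"
    if "A \<in> \<A>" "a \<in> cone_cell v w A t" for a A
  proof -
    have A: "A \<subseteq> {..<n}" using AA that(1) .
    have a: "\<And>i. 0 \<le> a i" "\<And>i. 0 < a i \<longleftrightarrow> i \<in> A" "sum a A = t" using that(2) by (auto simp: cone_cell_def)
    have out: "a i = 0" if "i \<notin> A" for i using a(1)[of i] a(2)[of i] that by simp
    have "(\<Sum>i<n. a i) = sum a A" using A out by (intro sum.mono_neutral_right) auto
    hence st: "(\<Sum>i<n. a i) = t" using a(3) by simp
    show "lex_maximal n (cone_fiber n v t (g a - w)) a"
      using that(1) a(1,2) st unfolding \<A>_def cone_pattern_def g_def by auto
    thus "a \<in> cone_fiber n v t (g a - w)" by (simp add: lex_maximal_def)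
  qed
  have inj: "inj_on g M"
  proof (rule inj_onI)
    fix a b assume ab: "a \<in> M" "b \<in> M" "g a = g b"
    have "lex_maximal n (cone_fiber n v t (g c - w)) c" if "c \<in> M" for c
      using that cell(2) unfolding M_def by blast
    from this[OF ab(1)] this[OF ab(2)]
    have ab': "lex_maximal n (cone_fiber n v t (g b - w)) a" "lex_maximal n (cone_fiber n v t (g b - w)) b"
      by (simp_all add: ab(3))
    moreover from ab' have "a i = b i" if "i \<ge> n" for i
      using that by (auto simp: lex_maximal_def cone_fiber_def)
    ultimately show "a = b" by (rule lex_maximal_unique)
  qed
  have img: "g ` M = X"
  proof (intro set_eqI iffI)
    fix x assume "x \<in> g ` M"
    then obtain a A where a: "A \<in> \<A>" "a \<in> cone_cell v w A t" "x = g a" by (auto simp: M_def)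
    have "g a = (\<Sum>i\<in>A. a i *\<^sub>R v i) + w"
      unfolding g_def using AA[OF a(1)] a(2)
      by (subst sum_lessThan_restrict[of A]) (auto simp: cone_cell_def order_less_le)
    hence "x \<in> integer_points" using a by (simp add: cone_cell_def)
    moreover have "x - w \<in> (\<lambda>x. t *\<^sub>R x) ` P"
      unfolding P_def scaled_hull_iff_cone_fiber[OF v t] using cell(1)[OF a(1,2)] a(3) by blast
    ultimately show "x \<in> X" by (simp add: X_def)
  next
    fix x assume x: "x \<in> X"
    hence "cone_fiber n v t (x - w) \<noteq> {}"
      by (simp add: X_def P_def scaled_hull_iff_cone_fiber[OF v t])
    then obtain a where lm: "lex_maximal n (cone_fiber n v t (x - w)) a"
      using exists_lex_maximal[OF compact_cone_fiber] by blast
    hence a: "a \<in> cone_fiber n v t (x - w)" by (simp add: lex_maximal_def)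
    define A where "A = {i. a i > 0}"
    have A: "A \<in> \<A>" unfolding \<A>_def A_def using cone_pattern_support[OF lm] by simp
    have nn: "0 \<le> a i" for i using a by (cases "i < n") (auto simp: cone_fiber_def)
    have out: "a i = 0" if "i \<notin> A" for i using nn[of i] that by (simp add: A_def)
    have "(\<Sum>i<n. a i) = sum a A" using AA[OF A] out by (intro sum.mono_neutral_right) auto
    moreover have "(\<Sum>i<n. a i *\<^sub>R v i) = (\<Sum>i\<in>A. a i *\<^sub>R v i)"
      using AA[OF A] out by (rule sum_lessThan_restrict)
    moreover have "(\<Sum>i<n. a i) = t" "(\<Sum>i<n. a i *\<^sub>R v i) = x - w" using a by (auto simp: cone_fiber_def)
    ultimately have "sum a A = t" "(\<Sum>i\<in>A. a i *\<^sub>R v i) = x - w" "g a = x - w + w" by (simp_all add: g_def)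
    hence "sum a A = t" "(\<Sum>i\<in>A. a i *\<^sub>R v i) + w = x" "g a = x" by simp_all
    moreover have "x \<in> integer_points" using x by (simp add: X_def)
    ultimately have "a \<in> cone_cell v w A t" "g a = x"
      using nn by (auto simp: cone_cell_def A_def)
    thus "x \<in> g ` M" using A unfolding M_def by blast
  qed
  have "bounded ((\<lambda>x. t *\<^sub>R x) ` P)"
    unfolding P_def by (intro bounded_scaling finite_imp_bounded_convex_hull) simp
  hence "finite X" unfolding X_def by (rule finite_count_shift)
  hence finM: "finite M" using img inj finite_imageD by blast
  show fin: "finite (cone_cell v w A t)" if "A \<in> \<A>" for A
    by (rule finite_subset[OF UN_upper[OF that] finM[unfolded M_def]])
  have "count_shift ((\<lambda>x. t *\<^sub>R x) ` P) w = card X" by (simp add: count_shift_def X_def)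
  also have "\<dots> = card M" using img card_image[OF inj] by simp
  also have "\<dots> = (\<Sum>A\<in>\<A>. card (cone_cell v w A t))"
    unfolding M_def
  proof (rule card_UN_disjoint[OF finA])
    show "\<forall>A\<in>\<A>. finite (cone_cell v w A t)" using fin by blast
    show "\<forall>A\<in>\<A>. \<forall>B\<in>\<A>. A \<noteq> B \<longrightarrow> cone_cell v w A t \<inter> cone_cell v w B t = {}"
      by (auto simp: cone_cell_def)
  qed
  finally show "count_shift ((\<lambda>x. t *\<^sub>R x) ` P) w = (\<Sum>A\<in>\<A>. card (cone_cell v w A t))" .
qed

text \<open>Every coefficient on \<open>A\<close> splits into a natural number and a rest in the
  interval from 0 (excluded) to 1 (included). The rests form a finite set \<open>R\<close> of
  vectors with integral height at most \<open>card A\<close>, and for each of them the natural parts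
  are the compositions of the remaining height.\<close>

lemma card_cone_cell_poly:
  fixes v :: "nat \<Rightarrow> real ^ 'd"
  assumes A: "finite A" "A \<noteq> {}" and v: "\<And>i. i \<in> A \<Longrightarrow> v i \<in> integer_points"
    and fin: "\<And>t::nat. t > 0 \<Longrightarrow> finite (cone_cell v w A (real t))"
  shows "\<exists>q :: rat poly. \<forall>t\<ge>1. poly q (of_nat t) = of_nat (card (cone_cell v w A (real t)))"
proof -
  \<comment> \<open>Rests of all heights are collected at once. The bound 1 is attained, because
    coefficients on \<open>A\<close> have to stay positive when the natural part is 0.\<close>
  define R where "R = {r. (\<forall>i. r i \<le> 1) \<and> (\<exists>s. r \<in> cone_cell v w A (real s))}"
  have Rpos: "0 < r i" "r i \<le> 1" if "r \<in> R" "i \<in> A" for r i using that by (auto simp: R_def cone_cell_def)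
  have Rout: "r i = 0" if "r \<in> R" "i \<notin> A" for r i
  proof -
    have "0 \<le> r i" "\<not> 0 < r i" using that by (auto simp: R_def cone_cell_def)
    thus ?thesis by simp
  qed
  have "\<forall>r. \<exists>s. r \<in> R \<longrightarrow> sum r A = real s" by (auto simp: R_def cone_cell_def)
  then obtain \<sigma> where \<sigma>: "\<And>r. r \<in> R \<Longrightarrow> sum r A = real (\<sigma> r)" by metis
  have \<sigma>le: "\<sigma> r \<le> card A" if "r \<in> R" for r
  proof -
    have "sum r A \<le> (\<Sum>i\<in>A. 1)" using Rpos(2)[OF that] by (rule sum_mono)
    thus ?thesis using \<sigma>[OF that] by simp
  qed
  have \<sigma>pos: "\<sigma> r > 0" if "r \<in> R" for r
  proof -
    have "sum r A > 0" using A Rpos(1)[OF that] by (intro sum_pos) auto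
    thus ?thesis using \<sigma>[OF that] by simp
  qed
  have "R \<subseteq> (\<Union>s\<in>{1..card A}. cone_cell v w A (real s))"
  proof
    fix r assume r: "r \<in> R"
    hence "r \<in> cone_cell v w A (real (\<sigma> r))" using \<sigma>[OF r] by (auto simp: R_def cone_cell_def)
    thus "r \<in> (\<Union>s\<in>{1..card A}. cone_cell v w A (real s))" using \<sigma>le[OF r] \<sigma>pos[OF r] by (intro UN_I[of "\<sigma> r"]) auto
  qed
  hence finR: "finite R" by (rule finite_subset) (auto intro: fin)
  define C where "C s t = {m :: nat \<Rightarrow> nat. (\<forall>i. i \<notin> A \<longrightarrow> m i = 0) \<and> sum m A + s = t}" for s t
  have finC: "finite (C s t)" for s t
    by (rule finite_subset[OF _ card_compositions(1)[OF A, of "t - s"]]) (auto simp: C_def)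
  have mult: "(\<Sum>i\<in>A. real (m i) *\<^sub>R v i) \<in> integer_points" for m :: "nat \<Rightarrow> nat"
    using v by (intro integer_points_sum integer_points_scale) auto
  have card: "card (cone_cell v w A (real t)) = (\<Sum>r\<in>R. card (C (\<sigma> r) t))" for t
  proof -
    define h :: "(nat \<Rightarrow> real) \<times> (nat \<Rightarrow> nat) \<Rightarrow> nat \<Rightarrow> real" where "h = (\<lambda>(r, m) i. real (m i) + r i)"
    have inj: "inj_on h (SIGMA r:R. C (\<sigma> r) t)"
    proof (rule inj_onI)
      fix p p' assume p: "p \<in> (SIGMA r:R. C (\<sigma> r) t)" "p' \<in> (SIGMA r:R. C (\<sigma> r) t)" "h p = h p'"
      obtain r m r' m' where pp: "p = (r, m)" "p' = (r', m')" by (metis surj_pair)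
      have in_R: "r \<in> R" "r' \<in> R" using p pp by auto
      have eq: "real (m i) + r i = real (m' i) + r' i" for i using p(3) pp by (auto simp: h_def fun_eq_iff)
      have "m i = m' i \<and> r i = r' i" for i
      proof (cases "i \<in> A")
        case True
        from unique_fractional_split[OF Rpos[OF in_R(1) True] Rpos[OF in_R(2) True] eq] show ?thesis by simp
      next
        case False
        thus ?thesis using eq[of i] Rout[OF in_R(1) False] Rout[OF in_R(2) False] by simp
      qed
      thus "p = p'" using pp by (auto simp: fun_eq_iff)
    qed
    have img: "h ` (SIGMA r:R. C (\<sigma> r) t) = cone_cell v w A (real t)"
    proof (intro set_eqI iffI)
      fix a assume "a \<in> h ` (SIGMA r:R. C (\<sigma> r) t)"
      then obtain r m where rm: "r \<in> R" "m \<in> C (\<sigma> r) t" "a = (\<lambda>i. real (m i) + r i)" by (auto simp: h_def)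
      have "0 \<le> r i" for i using rm(1) by (auto simp: R_def cone_cell_def)
      hence nn: "0 \<le> a i" for i by (simp add: rm(3))
      have pos: "0 < a i \<longleftrightarrow> i \<in> A" for i
        using Rpos(1)[OF rm(1), of i] Rout[OF rm(1), of i] rm(2,3) by (cases "i \<in> A") (auto simp: C_def)
      have sum: "sum a A = real t"
        using rm(2) \<sigma>[OF rm(1)] by (auto simp: rm(3) sum.distrib C_def)
      have "(\<Sum>i\<in>A. a i *\<^sub>R v i) + w = (\<Sum>i\<in>A. real (m i) *\<^sub>R v i) + ((\<Sum>i\<in>A. r i *\<^sub>R v i) + w)"
        by (simp add: rm(3) scaleR_add_left sum.distrib)
      moreover have "(\<Sum>i\<in>A. r i *\<^sub>R v i) + w \<in> integer_points" using rm(1) by (auto simp: R_def cone_cell_def)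
      ultimately have "(\<Sum>i\<in>A. a i *\<^sub>R v i) + w \<in> integer_points"
        using integer_points_add[OF mult[of m]] by presburger
      with nn pos sum show "a \<in> cone_cell v w A (real t)"
        unfolding cone_cell_def by blast
    next
      fix a assume a: "a \<in> cone_cell v w A (real t)"
      have out: "a i = 0" if "i \<notin> A" for i
      proof -
        have "0 \<le> a i" "\<not> 0 < a i" using a that by (auto simp: cone_cell_def)
        thus ?thesis by simp
      qed
      have "\<exists>m r. (if i \<in> A then 0 < r \<and> r \<le> 1 else m = 0 \<and> r = 0) \<and> a i = real m + r" for i
      proof (cases "i \<in> A")
        case True
        hence "a i > 0" using a by (auto simp: cone_cell_def)
        from fractional_split[OF this] show ?thesis using True by metis
      qed (use out in auto)
      then obtain m r where mr: "\<And>i. if i \<in> A then 0 < r i \<and> r i \<le> 1 else m i = 0 \<and> r i = (0::real)"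
        "\<And>i. a i = real (m i) + r i" by metis
      have r1: "0 \<le> r i" "0 < r i \<longleftrightarrow> i \<in> A" "r i \<le> 1" for i using mr(1)[of i] by (auto split: if_splits)
      have m0: "m i = 0" if "i \<notin> A" for i using mr(1)[of i] that by auto
      have "real t = real (sum m A) + sum r A" using a by (simp add: cone_cell_def mr(2) sum.distrib)
      moreover have "0 \<le> sum r A" using r1 by (intro sum_nonneg) auto
      ultimately have "real (sum m A) \<le> real t" "sum r A = real t - real (sum m A)" by linarith+
      hence s: "sum m A \<le> t" "sum r A = real (t - sum m A)" by (simp_all only: of_nat_le_iff of_nat_diff)
      have "(\<Sum>i\<in>A. r i *\<^sub>R v i) + w = ((\<Sum>i\<in>A. a i *\<^sub>R v i) + w) - (\<Sum>i\<in>A. real (m i) *\<^sub>R v i)"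
        by (simp add: mr(2) scaleR_add_left sum.distrib)
      moreover have "(\<Sum>i\<in>A. a i *\<^sub>R v i) + w \<in> integer_points" using a by (simp add: cone_cell_def)
      ultimately have "(\<Sum>i\<in>A. r i *\<^sub>R v i) + w \<in> integer_points" using integer_points_diff[OF _ mult[of m]] by presburger
      hence "r \<in> cone_cell v w A (real (t - sum m A))" using r1 s(2) by (auto simp: cone_cell_def)
      hence r: "r \<in> R" using r1 by (auto simp: R_def)
      hence "\<sigma> r = t - sum m A" using \<sigma> s(2) by (metis of_nat_eq_iff)
      hence "m \<in> C (\<sigma> r) t" using m0 s(1) by (auto simp: C_def)
      moreover have "a = h (r, m)" using mr(2) by (auto simp: h_def fun_eq_iff)
      ultimately show "a \<in> h ` (SIGMA r:R. C (\<sigma> r) t)" using r by blast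
    qed
    have "card (cone_cell v w A (real t)) = card (SIGMA r:R. C (\<sigma> r) t)"
      using img card_image[OF inj] by simp
    also have "\<dots> = (\<Sum>r\<in>R. card (C (\<sigma> r) t))" using finR finC by (intro card_SigmaI) auto
    finally show ?thesis .
  qed
  have "\<forall>r. \<exists>q :: rat poly. r \<in> R \<longrightarrow> (\<forall>t\<ge>1. poly q (of_nat t) = of_nat (card (C (\<sigma> r) t)))"
    using compositions_poly[OF A] \<sigma>le by (metis C_def)
  then obtain q :: "(nat \<Rightarrow> real) \<Rightarrow> rat poly"
    where q: "\<And>r t. r \<in> R \<Longrightarrow> t \<ge> 1 \<Longrightarrow> poly (q r) (of_nat t) = of_nat (card (C (\<sigma> r) t))"
    by metis
  show ?thesis
    by (intro exI[of _ "\<Sum>r\<in>R. q r"]) (auto simp: poly_sum card q)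
qed

text \<open>The vector \<open>w\<close> stays fixed while \<open>t\<close> varies; this gives the
  constituent for the residue class in which \<open>t\<close> times the translation vector agrees
  with \<open>w\<close> modulo the lattice.\<close>

lemma translated_Ehrhart_poly:
  fixes P :: "(real ^ 'd) set"
  assumes "lattice_hull P"
  shows "\<exists>q :: rat poly. \<forall>t\<ge>1. poly q (of_nat t) = of_nat (count_shift ((\<lambda>x. real t *\<^sub>R x) ` P) w)"
proof -
  obtain V where V: "finite V" "V \<noteq> {}" "V \<subseteq> integer_points" "P = convex hull V"
    using assms by (auto simp: lattice_hull_def)
  obtain v where v: "bij_betw v {..<card V} V"
    using ex_bij_betw_nat_finite[OF V(1)] by (auto simp: lessThan_atLeast0)
  define n where "n = card V"
  have inj: "inj_on v {..<n}" and img: "v ` {..<n} = V" using v by (auto simp: n_def bij_betw_def)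
  define \<A> where "\<A> = {A. cone_pattern n v A}"
  note dec = cone_cell_decomposition[OF inj, folded \<A>_def, unfolded img, folded V(4)]
  have finA: "finite \<A>" using dec(1)[of 1] by simp
  have "\<exists>q :: rat poly. \<forall>t\<ge>1. poly q (of_nat t) = of_nat (card (cone_cell v w A (real t)))" if A: "A \<in> \<A>" for A
  proof (cases "A = {}")
    case True
    \<comment> \<open>The empty support has height 0 and so never occurs for positive
      \<open>t\<close>.\<close>
    have "cone_cell v w A (real t) = {}" if "t \<ge> 1" for t using that True by (auto simp: cone_cell_def)
    thus ?thesis by (intro exI[of _ 0]) auto
  next
    case False
    have sub: "A \<subseteq> {..<n}" using A by (simp add: \<A>_def cone_pattern_def)
    show ?thesis
    proof (rule card_cone_cell_poly[OF _ False])
      show "finite A" using sub finite_subset by blast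
      show "v i \<in> integer_points" if "i \<in> A" for i using that sub img V(3) by blast
      show "finite (cone_cell v w A (real t))" if "t > 0" for t using dec(2)[OF _ A] that by simp
    qed
  qed
  then obtain q :: "nat set \<Rightarrow> rat poly"
    where q: "\<And>A t. A \<in> \<A> \<Longrightarrow> t \<ge> 1 \<Longrightarrow> poly (q A) (of_nat t) = of_nat (card (cone_cell v w A (real t)))"
    by metis
  have "poly (\<Sum>A\<in>\<A>. q A) (of_nat t) = of_nat (count_shift ((\<lambda>x. real t *\<^sub>R x) ` P) w)" if "t \<ge> 1" for t
    using dec(3)[of "real t" w] that by (simp add: poly_sum q)
  thus ?thesis by blast
qed

subsection \<open>Lattice zonotopes\<close>

definition box_fiber :: "nat \<Rightarrow> (nat \<Rightarrow> 'a::real_vector) \<Rightarrow> 'a \<Rightarrow> (nat \<Rightarrow> real) set" where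
  "box_fiber n u x = {a. (\<forall>i<n. 0 \<le> a i \<and> a i \<le> 1) \<and> (\<forall>i\<ge>n. a i = 0) \<and> (\<Sum>i<n. a i *\<^sub>R u i) = x}"

lemma compact_box_fiber:
  fixes u :: "nat \<Rightarrow> 'a::real_normed_vector"
  shows "compact (box_fiber n u x)"
proof -
  have "box_fiber n u x = {a. (\<forall>i<n. 0 \<le> a i \<and> a i \<le> 1) \<and> (\<forall>i\<ge>n. a i = 0)} \<inter> {a. (\<Sum>i<n. a i *\<^sub>R u i) = x}"
    by (auto simp: box_fiber_def)
  thus ?thesis by (auto intro!: compact_Int_closed compact_fun_box simp only: closed_linear_fiber)
qed

lemma zonotope_on_iff_box_fiber: "x \<in> zonotope_on {..<n} u \<longleftrightarrow> box_fiber n u x \<noteq> {}"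
proof
  assume "x \<in> zonotope_on {..<n} u"
  then obtain a where a: "\<forall>i<n. 0 \<le> a i \<and> a i \<le> 1" "x = (\<Sum>i<n. a i *\<^sub>R u i)"
    by (auto simp: zonotope_on_def)
  hence "(\<lambda>i. if i < n then a i else 0) \<in> box_fiber n u x" by (auto simp: box_fiber_def)
  thus "box_fiber n u x \<noteq> {}" by blast
next
  assume "box_fiber n u x \<noteq> {}"
  thus "x \<in> zonotope_on {..<n} u" by (auto simp: zonotope_on_def box_fiber_def)
qed

definition open_cell :: "(nat \<Rightarrow> real ^ 'd) \<Rightarrow> nat set \<Rightarrow> real ^ 'd \<Rightarrow> (nat \<Rightarrow> real) set" where
  "open_cell u A w = {a. (\<forall>i\<in>A. 0 < a i \<and> a i < 1) \<and> (\<forall>i. i \<notin> A \<longrightarrow> a i = 0) \<and>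
     (\<Sum>i\<in>A. a i *\<^sub>R u i) + w \<in> integer_points}"

text \<open>On these cells coefficients can be reduced modulo 1, which makes different
  \<open>w\<close> comparable; the zonotope itself decomposes into translates of the open
  ones.\<close>

definition half_open_cell :: "(nat \<Rightarrow> real ^ 'd) \<Rightarrow> nat set \<Rightarrow> real ^ 'd \<Rightarrow> (nat \<Rightarrow> real) set" where
  "half_open_cell u A w = {a. (\<forall>i\<in>A. 0 \<le> a i \<and> a i < 1) \<and> (\<forall>i. i \<notin> A \<longrightarrow> a i = 0) \<and>
     (\<Sum>i\<in>A. a i *\<^sub>R u i) + w \<in> integer_points}"

text \<open>Independence of the indexed family: a repeated vector counts as a dependence.\<close>

definition independent_on :: "(nat \<Rightarrow> 'a::real_vector) \<Rightarrow> nat set \<Rightarrow> bool" where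
  "independent_on u A \<longleftrightarrow> (\<forall>\<mu>. (\<Sum>i\<in>A. \<mu> i *\<^sub>R u i) = 0 \<longrightarrow> (\<forall>i\<in>A. \<mu> i = 0))"

lemma independent_on_subset:
  assumes "independent_on u A" "B \<subseteq> A" "finite A"
  shows "independent_on u B"
  unfolding independent_on_def
proof (intro allI impI ballI)
  fix \<mu> i assume "(\<Sum>i\<in>B. \<mu> i *\<^sub>R u i) = 0" "i \<in> B"
  moreover have "(\<Sum>i\<in>A. (if i \<in> B then \<mu> i else 0) *\<^sub>R u i) = (\<Sum>i\<in>B. \<mu> i *\<^sub>R u i)"
    using assms(2,3) by (intro sum.mono_neutral_cong_right) auto
  ultimately show "\<mu> i = 0"
    using assms(1)[unfolded independent_on_def, rule_format, of "\<lambda>i. if i \<in> B then \<mu> i else 0" i] assms(2) by auto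
qed

lemma finite_half_open_cell:
  assumes A: "finite A" "independent_on u A"
  shows "finite (half_open_cell u A w)"
proof -
  define f where "f a = (\<Sum>i\<in>A. a i *\<^sub>R u i) + w" for a :: "nat \<Rightarrow> real"
  have "inj_on f (half_open_cell u A w)"
  proof (rule inj_onI)
    fix a b assume ab: "a \<in> half_open_cell u A w" "b \<in> half_open_cell u A w" "f a = f b"
    hence "(\<Sum>i\<in>A. (a i - b i) *\<^sub>R u i) = 0" by (simp add: f_def scaleR_diff_left sum_subtractf)
    hence "\<forall>i\<in>A. a i - b i = 0"
      using A(2)[unfolded independent_on_def, rule_format, of "\<lambda>i. a i - b i"] by simp
    thus "a = b" using ab by (fastforce simp: half_open_cell_def fun_eq_iff)
  qed
  moreover have "finite (f ` half_open_cell u A w)"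
  proof -
    define B where "B = (\<Sum>i\<in>A. norm (u i)) + norm w"
    have "norm (f a) \<le> B" if "a \<in> half_open_cell u A w" for a
    proof -
      have "norm (a i *\<^sub>R u i) \<le> norm (u i)" if "i \<in> A" for i
        using that \<open>a \<in> half_open_cell u A w\<close> by (auto simp: half_open_cell_def abs_if intro!: mult_left_le_one_le)
      hence "norm (\<Sum>i\<in>A. a i *\<^sub>R u i) \<le> (\<Sum>i\<in>A. norm (u i))"
        by (rule order_trans[OF norm_sum sum_mono])
      thus ?thesis unfolding f_def B_def by (intro order_trans[OF norm_triangle_ineq]) auto
    qed
    hence "f ` half_open_cell u A w \<subseteq> cball 0 B \<inter> integer_points"
      by (auto simp: half_open_cell_def f_def)
    thus ?thesis using finite_integer_points_bounded[OF bounded_cball] finite_subset by blast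
  qed
  ultimately show ?thesis by (metis finite_imageD)
qed

text \<open>Taking fractional parts of the coefficients moves the point by a lattice vector.
  Nonemptiness thus says that \<open>w\<close> lies in the subgroup generated by the lattice and the
  span of the generators.\<close>

lemma half_open_cell_nonempty_iff:
  assumes u: "u ` A \<subseteq> integer_points"
  shows "half_open_cell u A w \<noteq> {} \<longleftrightarrow> (\<exists>a. (\<Sum>i\<in>A. a i *\<^sub>R u i) + w \<in> integer_points)"
proof
  assume "\<exists>a. (\<Sum>i\<in>A. a i *\<^sub>R u i) + w \<in> integer_points"
  then obtain a where a: "(\<Sum>i\<in>A. a i *\<^sub>R u i) + w \<in> integer_points" by blast
  define b where "b i = (if i \<in> A then frac (a i) else 0)" for i
  have eq: "(\<Sum>i\<in>A. b i *\<^sub>R u i) + w = ((\<Sum>i\<in>A. a i *\<^sub>R u i) + w) - (\<Sum>i\<in>A. of_int \<lfloor>a i\<rfloor> *\<^sub>R u i)"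
    by (simp add: b_def frac_def scaleR_diff_left sum_subtractf)
  have "(\<Sum>i\<in>A. of_int \<lfloor>a i\<rfloor> *\<^sub>R u i) \<in> integer_points"
    using u by (intro integer_points_sum integer_points_scale) auto
  with a have "(\<Sum>i\<in>A. b i *\<^sub>R u i) + w \<in> integer_points" unfolding eq by (rule integer_points_diff)
  hence "b \<in> half_open_cell u A w" by (auto simp: half_open_cell_def b_def frac_lt_1)
  thus "half_open_cell u A w \<noteq> {}" by blast
qed (auto simp: half_open_cell_def)

lemma frac_add_frac_diff: "0 \<le> x \<Longrightarrow> x < 1 \<Longrightarrow> frac (frac (x + y) - y) = x" for x y :: real
proof -
  assume x: "0 \<le> x" "x < 1"
  have "frac (x + y) - y - x = of_int (- \<lfloor>x + y\<rfloor>)" by (simp add: frac_def)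
  thus ?thesis using x unfolding frac_unique_iff by (metis Ints_of_int)
qed

text \<open>The cell at 0 is a group under addition modulo 1, and a nonempty cell at
  \<open>w\<close> is one of its cosets.\<close>

lemma card_half_open_cell:
  assumes u: "u ` A \<subseteq> integer_points" and ne: "half_open_cell u A w \<noteq> {}"
  shows "card (half_open_cell u A w) = card (half_open_cell u A 0)"
proof -
  obtain c where c: "c \<in> half_open_cell u A w" using ne by blast
  \<comment> \<open>Adds \<open>c\<close> modulo 1, or subtracts it for
    \<open>s = - 1\<close>.\<close>
  define f where "f s a i = (if i \<in> A then frac (a i + s * c i) else 0)" for s :: real and a i
  have fl: "(\<Sum>i\<in>A. of_int (k i) *\<^sub>R u i) \<in> integer_points" for k
    using u by (intro integer_points_sum integer_points_scale) auto
  have "(\<Sum>i\<in>A. f s a i *\<^sub>R u i) = (\<Sum>i\<in>A. a i *\<^sub>R u i) + s *\<^sub>R (\<Sum>i\<in>A. c i *\<^sub>R u i) - (\<Sum>i\<in>A. of_int \<lfloor>a i + s * c i\<rfloor> *\<^sub>R u i)" for s a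
    by (simp add: f_def frac_def scaleR_diff_left scaleR_add_left sum_subtractf sum.distrib scaleR_sum_right)
  hence "(\<Sum>i\<in>A. f s a i *\<^sub>R u i) + w' = (\<Sum>i\<in>A. a i *\<^sub>R u i) + s *\<^sub>R (\<Sum>i\<in>A. c i *\<^sub>R u i) + w'
      - (\<Sum>i\<in>A. of_int \<lfloor>a i + s * c i\<rfloor> *\<^sub>R u i)" for s a w'
    by simp
  hence fsum: "(\<Sum>i\<in>A. f s a i *\<^sub>R u i) + w' \<in> integer_points"
    if "(\<Sum>i\<in>A. a i *\<^sub>R u i) + s *\<^sub>R (\<Sum>i\<in>A. c i *\<^sub>R u i) + w' \<in> integer_points" for s a w'
    using integer_points_diff[OF that fl] by presburger
  have cw: "(\<Sum>i\<in>A. c i *\<^sub>R u i) + w \<in> integer_points" using c by (simp add: half_open_cell_def)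
  have "bij_betw (f 1) (half_open_cell u A 0) (half_open_cell u A w)"
  proof (rule bij_betw_byWitness[where f' = "f (- 1)"])
    show "\<forall>a\<in>half_open_cell u A 0. f (- 1) (f 1 a) = a"
      using frac_add_frac_diff by (auto simp: f_def half_open_cell_def fun_eq_iff)
    show "\<forall>a\<in>half_open_cell u A w. f 1 (f (- 1) a) = a"
    proof (intro ballI ext)
      fix a i assume "a \<in> half_open_cell u A w"
      thus "f 1 (f (- 1) a) i = a i"
        using frac_add_frac_diff[of "a i" "- c i"] by (auto simp: f_def half_open_cell_def)
    qed
    show "f 1 ` half_open_cell u A 0 \<subseteq> half_open_cell u A w"
    proof (rule image_subsetI)
      fix a assume "a \<in> half_open_cell u A 0"
      hence "(\<Sum>i\<in>A. a i *\<^sub>R u i) \<in> integer_points" by (simp add: half_open_cell_def)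
      from integer_points_add[OF this cw]
      have "(\<Sum>i\<in>A. a i *\<^sub>R u i) + ((\<Sum>i\<in>A. c i *\<^sub>R u i) + w) \<in> integer_points" .
      hence "(\<Sum>i\<in>A. f 1 a i *\<^sub>R u i) + w \<in> integer_points" by (intro fsum) (simp add: add.assoc)
      thus "f 1 a \<in> half_open_cell u A w" by (auto simp: half_open_cell_def f_def frac_lt_1)
    qed
    show "f (- 1) ` half_open_cell u A w \<subseteq> half_open_cell u A 0"
    proof (rule image_subsetI)
      fix a assume "a \<in> half_open_cell u A w"
      hence "((\<Sum>i\<in>A. a i *\<^sub>R u i) + w) - ((\<Sum>i\<in>A. c i *\<^sub>R u i) + w) \<in> integer_points"
        using cw by (intro integer_points_diff) (auto simp: half_open_cell_def)
      hence "(\<Sum>i\<in>A. f (- 1) a i *\<^sub>R u i) + 0 \<in> integer_points" by (intro fsum) simp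
      thus "f (- 1) a \<in> half_open_cell u A 0" by (auto simp: half_open_cell_def f_def frac_lt_1)
    qed
  qed
  thus ?thesis by (simp add: bij_betw_same_card)
qed

text \<open>Nonemptiness is membership of \<open>w\<close> in a subgroup containing the lattice.
  Multiples stay in it, and an inverse of \<open>k\<close> modulo \<open>m\<close> leads back to
  \<open>w\<close> up to a lattice vector; so either both cells are empty or both have the size of
  the cell at 0.\<close>

lemma card_half_open_cell_unit_multiple:
  fixes w :: "real ^ 'd"
  assumes u: "u ` A \<subseteq> integer_points"
    and w: "m > 0" "real m *\<^sub>R w \<in> integer_points" "coprime k m"
  shows "card (half_open_cell u A (real k *\<^sub>R w)) = card (half_open_cell u A w)"
proof -
  have step: "half_open_cell u A (real j *\<^sub>R w') \<noteq> {}" if ne: "half_open_cell u A w' \<noteq> {}" for j :: nat and w'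
  proof -
    obtain a where "(\<Sum>i\<in>A. a i *\<^sub>R u i) + w' \<in> integer_points"
      using ne half_open_cell_nonempty_iff[OF u] by metis
    hence "real j *\<^sub>R ((\<Sum>i\<in>A. a i *\<^sub>R u i) + w') \<in> integer_points" by (rule integer_points_scale) auto
    hence "(\<Sum>i\<in>A. (real j * a i) *\<^sub>R u i) + real j *\<^sub>R w' \<in> integer_points"
      by (simp add: scaleR_add_right scaleR_sum_right)
    hence "\<exists>a. (\<Sum>i\<in>A. a i *\<^sub>R u i) + real j *\<^sub>R w' \<in> integer_points"
      by (rule exI[where x = "\<lambda>i. real j * a i"])
    thus ?thesis using half_open_cell_nonempty_iff[OF u] by metis
  qed
  have "half_open_cell u A w \<noteq> {}" if ne: "half_open_cell u A (real k *\<^sub>R w) \<noteq> {}"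
  proof -
    obtain j where j: "[k * j = 1] (mod m)" using cong_solve_coprime_nat[OF w(3)] by auto
    have "int m dvd int (j * k) - 1" using j by (metis cong_iff_dvd_diff cong_int_iff mult.commute of_nat_1)
    then obtain i where "int (j * k) - 1 = int m * i" by (auto elim: dvdE)
    hence i: "real j * real k - 1 = real m * of_int i"
      by (metis of_int_1 of_int_diff of_int_mult of_int_of_nat_eq of_nat_mult)
    obtain a where a: "(\<Sum>i\<in>A. a i *\<^sub>R u i) + real j *\<^sub>R (real k *\<^sub>R w) \<in> integer_points"
      using step[OF ne, of j] half_open_cell_nonempty_iff[OF u] by metis
    have "of_int i *\<^sub>R (real m *\<^sub>R w) \<in> integer_points" using w(2) by (rule integer_points_scale) auto
    moreover have "of_int i *\<^sub>R (real m *\<^sub>R w) = real j *\<^sub>R (real k *\<^sub>R w) - w"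
      using i by (simp add: mult.commute[of "of_int i"] flip: i) (simp add: scaleR_diff_left)
    ultimately have d: "real j *\<^sub>R (real k *\<^sub>R w) - w \<in> integer_points" by (simp only:)
    have "(\<Sum>i\<in>A. a i *\<^sub>R u i) + real j *\<^sub>R (real k *\<^sub>R w) - (real j *\<^sub>R (real k *\<^sub>R w) - w)
        = (\<Sum>i\<in>A. a i *\<^sub>R u i) + w" by simp
    hence "(\<Sum>i\<in>A. a i *\<^sub>R u i) + w \<in> integer_points" using integer_points_diff[OF a d] by (simp only:)
    thus ?thesis using half_open_cell_nonempty_iff[OF u] by metis
  qed
  thus ?thesis using step[of w k] card_half_open_cell[where A = A and u = u, OF u]
    by (metis card.empty)
qed

text \<open>The half-open cell of \<open>A\<close> is the disjoint union of the open cells of all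
  subsets, so the open cell of \<open>A\<close> inherits the invariance by subtracting the smaller
  ones. Independence makes all these cells finite.\<close>

lemma card_open_cell_unit_multiple:
  fixes w :: "real ^ 'd"
  assumes "finite A" "independent_on u A" and u: "u ` A \<subseteq> integer_points"
    and w: "m > 0" "real m *\<^sub>R w \<in> integer_points" "coprime k m"
  shows "card (open_cell u A (real k *\<^sub>R w)) = card (open_cell u A w)"
  using assms(1-3)
proof (induction A rule: finite_psubset_induct)
  case (psubset A)
  have split: "card (half_open_cell u A w') = card (open_cell u A w') + (\<Sum>B\<in>Pow A - {A}. card (open_cell u B w'))" for w'
  proof -
    have sumB: "(\<Sum>i\<in>A. a i *\<^sub>R u i) = (\<Sum>i\<in>B. a i *\<^sub>R u i)" if "B \<subseteq> A" "\<forall>i. i \<notin> B \<longrightarrow> a i = 0" for a :: "nat \<Rightarrow> real" and B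
      using that psubset.hyps by (intro sum.mono_neutral_right) auto
    have un: "half_open_cell u A w' = (\<Union>B\<in>Pow A. open_cell u B w')"
    proof (intro set_eqI iffI)
      fix a assume a: "a \<in> half_open_cell u A w'"
      define B where "B = {i\<in>A. 0 < a i}"
      have out: "\<forall>i. i \<notin> B \<longrightarrow> a i = 0" using a by (force simp: half_open_cell_def B_def)
      have BA: "B \<subseteq> A" by (auto simp: B_def)
      have "\<forall>i\<in>B. 0 < a i \<and> a i < 1" using a by (auto simp: half_open_cell_def B_def)
      hence "a \<in> open_cell u B w'"
        using a out sumB[OF BA out] by (simp add: half_open_cell_def open_cell_def)
      thus "a \<in> (\<Union>B\<in>Pow A. open_cell u B w')" using BA by blast
    next
      fix a assume "a \<in> (\<Union>B\<in>Pow A. open_cell u B w')"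
      then obtain B where B: "B \<subseteq> A" "a \<in> open_cell u B w'" by blast
      have out: "\<forall>i. i \<notin> B \<longrightarrow> a i = 0" using B(2) by (simp add: open_cell_def)
      have "0 \<le> a i \<and> a i < 1" for i using B(2) by (cases "i \<in> B") (auto simp: open_cell_def)
      thus "a \<in> half_open_cell u A w'"
        using B out sumB[OF B(1) out] by (auto simp: half_open_cell_def open_cell_def)
    qed
    have fin: "finite (half_open_cell u A w')" using finite_half_open_cell psubset by blast
    have "card (\<Union>B\<in>Pow A. open_cell u B w') = (\<Sum>B\<in>Pow A. card (open_cell u B w'))"
    proof (rule card_UN_disjoint)
      show "\<forall>B\<in>Pow A. finite (open_cell u B w')" using finite_subset[OF UN_upper fin[unfolded un]] by blast
      show "\<forall>B\<in>Pow A. \<forall>C\<in>Pow A. B \<noteq> C \<longrightarrow> open_cell u B w' \<inter> open_cell u C w' = {}"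
      proof (intro ballI impI equals0I)
        fix B C a assume "B \<noteq> C" "a \<in> open_cell u B w' \<inter> open_cell u C w'"
        hence "B = {i. a i \<noteq> 0}" "C = {i. a i \<noteq> 0}" by (fastforce simp: open_cell_def)+
        thus False using \<open>B \<noteq> C\<close> by simp
      qed
    qed (use psubset.hyps in auto)
    thus ?thesis unfolding un using psubset.hyps by (subst (asm) sum.remove[of _ A]) auto
  qed
  have "card (open_cell u B (real k *\<^sub>R w)) = card (open_cell u B w)" if "B \<in> Pow A - {A}" for B
  proof (rule psubset.IH)
    show "B \<subset> A" using that by blast
    thus "independent_on u B" "u ` B \<subseteq> integer_points"
      using independent_on_subset[OF psubset.prems(1) _ psubset.hyps] psubset.prems(2) by blast+
  qed
  hence "(\<Sum>B\<in>Pow A - {A}. card (open_cell u B (real k *\<^sub>R w))) = (\<Sum>B\<in>Pow A - {A}. card (open_cell u B w))"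
    by (intro sum.cong) auto
  moreover have "card (half_open_cell u A (real k *\<^sub>R w)) = card (half_open_cell u A w)"
    using psubset.prems(2) w by (rule card_half_open_cell_unit_multiple)
  ultimately show ?case using split[of w] split[of "real k *\<^sub>R w"] by simp
qed

section \<open>Decomposition of a zonotope into open cells\<close>

text \<open>\<open>A\<close> holds the free coefficients and \<open>B\<close> those at the upper
  bound. For lattice generators the part in \<open>B\<close> is a lattice translation, so only
  \<open>A\<close> influences the count.\<close>

definition box_pattern :: "nat \<Rightarrow> (nat \<Rightarrow> 'a::real_vector) \<Rightarrow> nat set \<Rightarrow> nat set \<Rightarrow> bool" where
  "box_pattern n u A B \<longleftrightarrow> A \<subseteq> {..<n} \<and> B \<subseteq> {..<n} \<and> A \<inter> B = {} \<and>
     (\<forall>a. (\<forall>i\<in>A. 0 < a i \<and> a i < 1) \<longrightarrow> (\<forall>i\<in>B. a i = 1) \<longrightarrow> (\<forall>i. i \<notin> A \<union> B \<longrightarrow> a i = 0) \<longrightarrow>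
       lex_maximal n (box_fiber n u (\<Sum>i<n. a i *\<^sub>R u i)) a)"

lemma box_pattern_of_lex_maximal:
  assumes "lex_maximal n (box_fiber n u x) a"
  shows "box_pattern n u {i. 0 < a i \<and> a i < 1} {i. a i = 1}"
  unfolding box_pattern_def
proof (intro conjI allI impI)
  let ?A = "{i. 0 < a i \<and> a i < 1}" and ?B = "{i. a i = 1}"
  have a: "a \<in> box_fiber n u x" using assms by (simp add: lex_maximal_def)
  have rng: "0 \<le> a i" "a i \<le> 1" for i using a by (cases "i < n"; auto simp: box_fiber_def)+
  have sub: "i < n" if "a i \<noteq> 0" for i using a that by (cases "i < n") (auto simp: box_fiber_def)
  show subA: "?A \<subseteq> {..<n}" and "?B \<subseteq> {..<n}" "?A \<inter> ?B = {}" using sub by force+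
  fix a' :: "nat \<Rightarrow> real"
  assume a': "\<forall>i\<in>?A. 0 < a' i \<and> a' i < 1" "\<forall>i\<in>?B. a' i = 1" "\<forall>i. i \<notin> ?A \<union> ?B \<longrightarrow> a' i = 0"
  have rng': "0 \<le> a' i \<and> a' i \<le> 1" for i
    using a' by (cases "i \<in> ?A"; cases "i \<in> ?B") (auto intro: less_imp_le)
  have out: "a' i = 0" if "i \<ge> n" for i using a'(3) sub[of i] that by force
  let ?K = "box_fiber n u (\<Sum>i<n. a' i *\<^sub>R u i)"
  show "lex_maximal n ?K a'"
  proof (rule lex_maximal_transfer[OF assms])
    show "a' \<in> ?K" using rng' out by (auto simp: box_fiber_def)
    fix b assume b: "b \<in> ?K"
    have finA: "finite ?A" using subA finite_subset by blast
    have "\<exists>\<epsilon>>0. \<forall>i\<in>?A. a i + \<epsilon> * (b i - a' i) > 0" using finA by (rule exists_small_positive) simp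
    then obtain \<epsilon>1 where e1: "\<epsilon>1 > 0" "\<And>i. i\<in>?A \<Longrightarrow> a i + \<epsilon>1 * (b i - a' i) > 0" by blast
    have "\<exists>\<epsilon>>0. \<forall>i\<in>?A. (1 - a i) + \<epsilon> * (a' i - b i) > 0" using finA by (rule exists_small_positive) simp
    then obtain \<epsilon>2 where e2: "\<epsilon>2 > 0" "\<And>i. i\<in>?A \<Longrightarrow> (1 - a i) + \<epsilon>2 * (a' i - b i) > 0" by blast
    \<comment> \<open>\<open>\<epsilon>1\<close> and \<open>\<epsilon>2\<close> keep the free
      coefficients above 0 and below 1; the bound 1 serves the coefficients that are 0 or 1, which
      move at most as far as \<open>b\<close>.\<close>
    define \<epsilon> where "\<epsilon> = min 1 (min \<epsilon>1 \<epsilon>2)"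
    have e: "0 < \<epsilon>" "\<epsilon> \<le> \<epsilon>1" "\<epsilon> \<le> \<epsilon>2" "\<epsilon> \<le> 1" using e1 e2 by (auto simp: \<epsilon>_def)
    have bn: "0 \<le> b i" "b i \<le> 1" if "i < n" for i using b that by (auto simp: box_fiber_def)
    have "0 \<le> a i + \<epsilon> * (b i - a' i) \<and> a i + \<epsilon> * (b i - a' i) \<le> 1" if i: "i < n" for i
    proof -
      consider "i \<in> ?A" | "a i = 1" | "a i = 0" using rng[of i] by force
      thus ?thesis
      proof cases
        case 1
        have "0 \<le> a i + \<epsilon> * (b i - a' i)"
        proof (cases "b i \<ge> a' i")
          case True
          thus ?thesis using e(1) rng[of i] by simp
        next
          case False
          hence "\<epsilon>1 * (b i - a' i) \<le> \<epsilon> * (b i - a' i)" using e(2) by (intro mult_right_mono_neg) auto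
          thus ?thesis using e1(2)[OF 1] by linarith
        qed
        moreover have "a i + \<epsilon> * (b i - a' i) \<le> 1"
        proof (cases "b i \<ge> a' i")
          case True
          hence "\<epsilon> * (b i - a' i) \<le> \<epsilon>2 * (b i - a' i)" using e(3) by (intro mult_right_mono) auto
          moreover have "\<epsilon>2 * (a' i - b i) = - (\<epsilon>2 * (b i - a' i))" by (simp add: algebra_simps)
          ultimately show ?thesis using e2(2)[OF 1] by linarith
        next
          case False
          hence "\<epsilon> * (b i - a' i) \<le> 0" using e(1) by (simp add: mult_le_0_iff)
          thus ?thesis using rng[of i] by simp
        qed
        ultimately show ?thesis by simp
      next
        case 2
        hence "a' i = 1" using a'(2) by simp
        have "\<epsilon> * (1 - b i) \<le> 1 * (1 - b i)" using e bn[OF i] by (intro mult_right_mono) auto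
        moreover have "0 \<le> \<epsilon> * (1 - b i)" using e bn[OF i] by simp
        ultimately show ?thesis using 2 \<open>a' i = 1\<close> bn[OF i] by (auto simp: algebra_simps)
      next
        case 3
        hence "a' i = 0" using a'(3) by simp
        have "\<epsilon> * b i \<le> 1 * 1" using e bn[OF i] by (intro mult_mono) auto
        thus ?thesis using 3 \<open>a' i = 0\<close> e bn[OF i] by simp
      qed
    qed
    moreover have "(\<Sum>i<n. (a i + \<epsilon> * (b i - a' i)) *\<^sub>R u i)
        = (\<Sum>i<n. a i *\<^sub>R u i) + \<epsilon> *\<^sub>R ((\<Sum>i<n. b i *\<^sub>R u i) - (\<Sum>i<n. a' i *\<^sub>R u i))"
      by (simp add: scaleR_add_left sum.distrib scaleR_sum_right scaleR_diff_right scaleR_diff_left sum_subtractf right_diff_distrib)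
    ultimately show "\<exists>\<epsilon>>0. (\<lambda>i. a i + \<epsilon> * (b i - a' i)) \<in> box_fiber n u x"
      using e(1) a b out by (intro exI[of _ \<epsilon>]) (auto simp: box_fiber_def)
  qed
qed

text \<open>A linear relation on \<open>A\<close> could be added in small multiples of either sign
  without changing the point, and one of the signs would be a lexicographic improvement.\<close>

lemma box_pattern_independent:
  assumes pat: "box_pattern n u A B"
  shows "independent_on u A"
  unfolding independent_on_def
proof (rule ccontr)
  assume "\<not> (\<forall>\<mu>. (\<Sum>i\<in>A. \<mu> i *\<^sub>R u i) = 0 \<longrightarrow> (\<forall>i\<in>A. \<mu> i = 0))"
  then obtain \<mu>0 k where m0: "(\<Sum>i\<in>A. \<mu>0 i *\<^sub>R u i) = 0" "k \<in> A" "\<mu>0 k \<noteq> 0" by blast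
  define \<mu> where "\<mu> i = (if i \<in> A then \<mu>0 i else 0)" for i
  have A: "A \<subseteq> {..<n}" "B \<subseteq> {..<n}" "A \<inter> B = {}" using pat by (auto simp: box_pattern_def)
  have msum: "(\<Sum>i<n. \<mu> i *\<^sub>R u i) = 0"
    using m0(1) by (subst sum_lessThan_restrict[OF A(1)]) (auto simp: \<mu>_def)
  \<comment> \<open>The value 1/2 leaves room in both directions.\<close>
  define a :: "nat \<Rightarrow> real" where "a i = (if i \<in> A then 1 / 2 else if i \<in> B then 1 else 0)" for i
  have lm: "lex_maximal n (box_fiber n u (\<Sum>i<n. a i *\<^sub>R u i)) a"
  proof -
    have "\<forall>i\<in>A. 0 < a i \<and> a i < 1" "\<forall>i\<in>B. a i = 1" "\<forall>i. i \<notin> A \<union> B \<longrightarrow> a i = 0"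
      using A(3) by (auto simp: a_def)
    thus ?thesis using pat unfolding box_pattern_def by blast
  qed
  have not_pos: "\<not> lex_pos n \<nu>" if nu: "(\<Sum>i<n. \<nu> i *\<^sub>R u i) = 0" "\<And>i. i \<notin> A \<Longrightarrow> \<nu> i = 0" for \<nu>
  proof
    assume lp: "lex_pos n \<nu>"
    have finA: "finite A" using A(1) finite_subset by blast
    have "\<exists>\<epsilon>>0. \<forall>i\<in>A. 1 / 2 + \<epsilon> * (- \<bar>\<nu> i\<bar>) > 0" using finA by (rule exists_small_positive) simp
    then obtain \<epsilon> where e: "\<epsilon> > 0" "\<And>i. i \<in> A \<Longrightarrow> \<epsilon> * \<bar>\<nu> i\<bar> < 1 / 2" by auto
    have small: "\<bar>\<epsilon> * \<nu> i\<bar> < 1 / 2" if "i \<in> A" for i using e that by (simp add: abs_mult)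
    have "(\<lambda>i. a i + \<epsilon> * \<nu> i) \<in> box_fiber n u (\<Sum>i<n. a i *\<^sub>R u i)"
    proof -
      have "0 \<le> a i + \<epsilon> * \<nu> i \<and> a i + \<epsilon> * \<nu> i \<le> 1" for i
        using small[of i] nu(2)[of i] by (cases "i \<in> A") (auto simp: a_def)
      moreover have "a i + \<epsilon> * \<nu> i = 0" if "i \<ge> n" for i
        using that A nu(2)[of i] by (auto simp: a_def)
      moreover have "(\<Sum>i<n. (a i + \<epsilon> * \<nu> i) *\<^sub>R u i) = (\<Sum>i<n. a i *\<^sub>R u i) + \<epsilon> *\<^sub>R (\<Sum>i<n. \<nu> i *\<^sub>R u i)"
        by (simp add: scaleR_add_left sum.distrib scaleR_sum_right)
      ultimately show ?thesis using nu(1) by (auto simp: box_fiber_def)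
    qed
    moreover have "lex_pos n (\<lambda>i. a i + \<epsilon> * \<nu> i - a i)"
      using lp e(1) by (auto simp: lex_pos_def zero_less_mult_iff)
    ultimately show False using lm by (auto simp: lex_maximal_def)
  qed
  have "\<mu> k \<noteq> 0" "k < n" using m0 A(1) by (auto simp: \<mu>_def)
  from lex_pos_total[where \<mu> = \<mu>, OF this(2,1)] show False
    using not_pos[of \<mu>] not_pos[of "\<lambda>i. - \<mu> i"] msum by (auto simp: \<mu>_def sum_negf)
qed

text \<open>The unique maximal coefficient vector of a point has a pattern \<open>(A, B)\<close>;
  removing the lattice vector \<open>sum u B\<close> leaves an element of the open cell of
  \<open>A\<close>. The same \<open>A\<close> may occur with several \<open>B\<close>.\<close>

lemma lattice_zonotope_count:
  fixes u :: "nat \<Rightarrow> real ^ 'd"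
  assumes u: "u ` {..<n} \<subseteq> integer_points"
  defines "\<P> \<equiv> {(A, B). box_pattern n u A B}"
  shows "count_shift (zonotope_on {..<n} u) w = (\<Sum>p\<in>\<P>. card (open_cell u (fst p) w))"
proof -
  have sub: "A \<subseteq> {..<n}" "B \<subseteq> {..<n}" "A \<inter> B = {}" if "(A, B) \<in> \<P>" for A B
    using that by (auto simp: \<P>_def box_pattern_def)
  hence "\<P> \<subseteq> Pow {..<n} \<times> Pow {..<n}" by fast
  hence finP: "finite \<P>" by (rule finite_subset) simp
  define X where "X = {x \<in> integer_points. x - w \<in> zonotope_on {..<n} u}"
  define h :: "(nat set \<times> nat set) \<times> (nat \<Rightarrow> real) \<Rightarrow> nat \<Rightarrow> real"
    where "h = (\<lambda>((A, B), a) i. if i \<in> B then 1 else a i)"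
  define S where "S = (SIGMA p:\<P>. open_cell u (fst p) w)"
  define g where "g a = (\<Sum>i<n. a i *\<^sub>R u i) + w" for a :: "nat \<Rightarrow> real"
  have hS: "{i. 0 < h p i \<and> h p i < 1} = fst (fst p)" "{i. h p i = 1} = snd (fst p)"
      "\<And>i. i \<notin> fst (fst p) \<union> snd (fst p) \<Longrightarrow> h p i = 0"
      "lex_maximal n (box_fiber n u (g (h p) - w)) (h p)" "g (h p) \<in> integer_points"
    if p: "p \<in> S" for p
  proof -
    obtain A B a where pp: "p = ((A, B), a)" by (metis surj_pair)
    have AB: "(A, B) \<in> \<P>" and a: "a \<in> open_cell u A w" using p by (auto simp: S_def pp)
    have hi: "h p i = (if i \<in> A then a i else if i \<in> B then 1 else 0)" for i
      using sub(3)[OF AB] a by (auto simp: h_def pp open_cell_def)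
    have aA: "0 < a i" "a i < 1" if "i \<in> A" for i using a that by (auto simp: open_cell_def)
    show "{i. 0 < h p i \<and> h p i < 1} = fst (fst p)" unfolding hi using aA by (auto simp: pp)
    show "{i. h p i = 1} = snd (fst p)" unfolding hi using aA sub(3)[OF AB] by (force simp: pp split: if_splits)
    show "h p i = 0" if "i \<notin> fst (fst p) \<union> snd (fst p)" for i using that unfolding hi by (auto simp: pp)
    show "lex_maximal n (box_fiber n u (g (h p) - w)) (h p)"
    proof -
      have "\<forall>i\<in>A. 0 < h p i \<and> h p i < 1" "\<forall>i\<in>B. h p i = 1" "\<forall>i. i \<notin> A \<union> B \<longrightarrow> h p i = 0"
        using aA sub(3)[OF AB] by (auto simp: hi)
      moreover have "box_pattern n u A B" using AB by (simp add: \<P>_def)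
      ultimately show ?thesis unfolding box_pattern_def g_def by simp
    qed
    have fin: "finite A" "finite B" using sub[OF AB] finite_subset by blast+
    have "(\<Sum>i<n. h p i *\<^sub>R u i) = (\<Sum>i\<in>A \<union> B. h p i *\<^sub>R u i)"
      using sub[OF AB] by (intro sum_lessThan_restrict) (auto simp: hi)
    also have "\<dots> = (\<Sum>i\<in>A. h p i *\<^sub>R u i) + (\<Sum>i\<in>B. h p i *\<^sub>R u i)"
      using fin sub(3)[OF AB] by (rule sum.union_disjoint)
    also have "(\<Sum>i\<in>A. h p i *\<^sub>R u i) = (\<Sum>i\<in>A. a i *\<^sub>R u i)" by (simp add: hi)
    also have "(\<Sum>i\<in>B. h p i *\<^sub>R u i) = sum u B" using sub(3)[OF AB] by (intro sum.cong) (auto simp: hi)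
    finally have "g (h p) = ((\<Sum>i\<in>A. a i *\<^sub>R u i) + w) + sum u B" by (simp add: g_def)
    moreover have "sum u B \<in> integer_points" using u sub(2)[OF AB] by (intro integer_points_sum) auto
    ultimately show "g (h p) \<in> integer_points"
      using a by (simp add: open_cell_def integer_points_add)
  qed
  have inj: "inj_on (\<lambda>p. g (h p)) S"
  proof (rule inj_onI)
    fix p q assume pq: "p \<in> S" "q \<in> S" "g (h p) = g (h q)"
    have lm: "lex_maximal n (box_fiber n u (g (h q) - w)) (h p)" "lex_maximal n (box_fiber n u (g (h q) - w)) (h q)"
      using hS(4)[OF pq(1)] hS(4)[OF pq(2)] by (simp_all add: pq(3))
    moreover from lm have "h p i = h q i" if "i \<ge> n" for i
      using that by (auto simp: lex_maximal_def box_fiber_def)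
    ultimately have eq: "h p = h q" by (rule lex_maximal_unique)
    have AB: "fst p = fst q" using hS(1,2)[OF pq(1)] hS(1,2)[OF pq(2)] eq by (auto intro: prod_eqI)
    obtain A B a b where pp: "p = ((A, B), a)" "q = ((A, B), b)" using AB by (metis surj_pair fst_conv)
    have in_cell: "(A, B) \<in> \<P>" "a \<in> open_cell u A w" "b \<in> open_cell u A w" using pq pp by (auto simp: S_def)
    have "a i = b i" for i
    proof (cases "i \<in> A")
      case True
      hence "i \<notin> B" using sub(3)[OF in_cell(1)] by blast
      thus ?thesis using fun_cong[OF eq, of i] by (simp add: h_def pp)
    next
      case False
      thus ?thesis using in_cell by (simp add: open_cell_def)
    qed
    thus "p = q" using pp by auto
  qed
  have img: "(\<lambda>p. g (h p)) ` S = X"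
  proof (intro set_eqI iffI)
    fix x assume "x \<in> (\<lambda>p. g (h p)) ` S"
    then obtain p where p: "p \<in> S" "x = g (h p)" by blast
    have "h p \<in> box_fiber n u (x - w)" using hS(4)[OF p(1)] p(2) by (simp add: lex_maximal_def)
    thus "x \<in> X" using hS(5)[OF p(1)] p(2) by (auto simp: X_def zonotope_on_iff_box_fiber)
  next
    fix x assume x: "x \<in> X"
    hence "box_fiber n u (x - w) \<noteq> {}" by (simp add: X_def zonotope_on_iff_box_fiber)
    then obtain a where lm: "lex_maximal n (box_fiber n u (x - w)) a"
      using exists_lex_maximal[OF compact_box_fiber] by blast
    hence a: "a \<in> box_fiber n u (x - w)" by (simp add: lex_maximal_def)
    define A where "A = {i. 0 < a i \<and> a i < 1}"
    define B where "B = {i. a i = 1}"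
    have AB: "(A, B) \<in> \<P>" using box_pattern_of_lex_maximal[OF lm] by (simp add: \<P>_def A_def B_def)
    have rng: "0 \<le> a i \<and> a i \<le> 1" for i using a by (cases "i < n") (auto simp: box_fiber_def)
    define b where "b i = (if i \<in> A then a i else 0)" for i
    have hb: "h ((A, B), b) = a"
    proof
      fix i
      show "h ((A, B), b) i = a i"
        using rng[of i] by (auto simp: h_def b_def A_def B_def)
    qed
    have fin: "finite A" "finite B" using sub[OF AB] finite_subset by blast+
    have gx: "g a = x" using a by (simp add: g_def box_fiber_def)
    have "(\<Sum>i<n. a i *\<^sub>R u i) = (\<Sum>i\<in>A \<union> B. a i *\<^sub>R u i)"
    proof (rule sum_lessThan_restrict)
      show "A \<union> B \<subseteq> {..<n}" using sub[OF AB] by blast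
      show "a i = 0" if "i \<notin> A \<union> B" for i using rng[of i] that by (auto simp: A_def B_def)
    qed
    also have "\<dots> = (\<Sum>i\<in>A. a i *\<^sub>R u i) + (\<Sum>i\<in>B. a i *\<^sub>R u i)"
      using fin sub(3)[OF AB] by (rule sum.union_disjoint)
    also have "(\<Sum>i\<in>A. a i *\<^sub>R u i) = (\<Sum>i\<in>A. b i *\<^sub>R u i)" by (simp add: b_def)
    also have "(\<Sum>i\<in>B. a i *\<^sub>R u i) = sum u B" by (simp add: B_def)
    finally have "(\<Sum>i\<in>A. b i *\<^sub>R u i) + w = x - sum u B" using gx by (simp add: g_def algebra_simps)
    moreover have "sum u B \<in> integer_points" using u sub(2)[OF AB] by (intro integer_points_sum) auto
    ultimately have "(\<Sum>i\<in>A. b i *\<^sub>R u i) + w \<in> integer_points" using x by (simp add: X_def integer_points_diff)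
    hence "b \<in> open_cell u A w" by (auto simp: open_cell_def b_def A_def)
    hence "((A, B), b) \<in> S" using AB by (simp add: S_def)
    thus "x \<in> (\<lambda>p. g (h p)) ` S" using hb gx by (metis image_eqI)
  qed
  have finS: "finite (open_cell u (fst p) w)" if "p \<in> \<P>" for p
  proof -
    have "compact (zonotope_on {..<n} u)" using zonotope_on_compact_convex[of "{..<n}" u] by simp
    hence "finite X" unfolding X_def by (intro finite_count_shift compact_imp_bounded)
    hence "finite S" using img inj finite_imageD by blast
    hence "finite (snd ` (S \<inter> {p} \<times> UNIV))" by blast
    moreover have "open_cell u (fst p) w \<subseteq> snd ` (S \<inter> {p} \<times> UNIV)" using that by (force simp: S_def)
    ultimately show ?thesis using finite_subset by blast
  qed
  have "count_shift (zonotope_on {..<n} u) w = card X" by (simp add: count_shift_def X_def)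
  also have "\<dots> = card S" using img card_image[OF inj] by simp
  also have "\<dots> = (\<Sum>p\<in>\<P>. card (open_cell u (fst p) w))"
    unfolding S_def using finP finS by (intro card_SigmaI) auto
  finally show ?thesis .
qed

lemma unit_invariant_lattice_zonotope:
  fixes u :: "nat \<Rightarrow> real ^ 'd"
  assumes u: "u ` {..<n} \<subseteq> integer_points"
  shows "unit_invariant (zonotope_on {..<n} u)"
  unfolding unit_invariant_def
proof (intro allI impI)
  fix w :: "real ^ 'd" and m k :: nat
  assume w: "m > 0" "real m *\<^sub>R w \<in> integer_points" "coprime k m"
  have "card (open_cell u A (real k *\<^sub>R w)) = card (open_cell u A w)" if "box_pattern n u A B" for A B
  proof (rule card_open_cell_unit_multiple[OF _ box_pattern_independent[OF that] _ w])
    have sub: "A \<subseteq> {..<n}" using that by (simp add: box_pattern_def)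
    thus "finite A" using finite_subset by blast
    show "u ` A \<subseteq> integer_points" using sub u by blast
  qed
  thus "count_shift (zonotope_on {..<n} u) (real k *\<^sub>R w) = count_shift (zonotope_on {..<n} u) w"
    unfolding lattice_zonotope_count[OF u] by (intro sum.cong) auto
qed

section \<open>Lattice vectors as generators\<close>

lemma zonotope_on_cong:
  "(\<And>i. i \<in> I \<Longrightarrow> u i = u' i) \<Longrightarrow> zonotope_on I u = zonotope_on I u'"
  by (simp add: zonotope_on_def cong: sum.cong)

lemma sum_parallel_segments:
  fixes z :: "'a::real_vector"
  shows "{x + y | x y. x \<in> closed_segment 0 (s *\<^sub>R z) \<and> y \<in> closed_segment 0 z}
    = (+) (if s < 0 then s *\<^sub>R z else 0) ` closed_segment 0 ((1 + \<bar>s\<bar>) *\<^sub>R z)"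
proof (intro set_eqI iffI)
  fix p assume "p \<in> {x + y | x y. x \<in> closed_segment 0 (s *\<^sub>R z) \<and> y \<in> closed_segment 0 z}"
  then obtain a b where ab: "0 \<le> a" "a \<le> 1" "0 \<le> b" "b \<le> 1" "p = (a * s + b) *\<^sub>R z"
    by (auto simp: in_segment scaleR_add_left)
  show "p \<in> (+) (if s < 0 then s *\<^sub>R z else 0) ` closed_segment 0 ((1 + \<bar>s\<bar>) *\<^sub>R z)"
  proof (cases "s < 0")
    case True
    define e where "e = (1 - a) * (- s)"
    \<comment> \<open>The solution of \<open>s + t * (1 - s) = a * s + b\<close>: for negative
      \<open>s\<close> the sum starts at \<open>s *\<^sub>R z\<close>.\<close>
    define t where "t = (b + e) / (1 - s)"
    have "e \<le> 1 * (- s)" unfolding e_def using True ab by (intro mult_right_mono) auto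
    moreover have "0 \<le> e" unfolding e_def using True ab by (intro mult_nonneg_nonneg) auto
    ultimately have t: "0 \<le> t" "t \<le> 1" using True ab by (simp_all add: t_def)
    have "t * (1 - s) = b + (1 - a) * (- s)" using True by (simp add: t_def e_def)
    hence "a * s + b = s + t * (1 + \<bar>s\<bar>)" using True by (simp add: algebra_simps)
    hence p: "p = s *\<^sub>R z + t *\<^sub>R ((1 + \<bar>s\<bar>) *\<^sub>R z)"
      using ab(5) scaleR_add_left[of s "t * (1 + \<bar>s\<bar>)" z] by (simp only: scaleR_scaleR)
    have "t *\<^sub>R ((1 + \<bar>s\<bar>) *\<^sub>R z) \<in> closed_segment 0 ((1 + \<bar>s\<bar>) *\<^sub>R z)"
      unfolding in_segment using t by (intro exI[of _ t]) simp
    hence "p \<in> (+) (s *\<^sub>R z) ` closed_segment 0 ((1 + \<bar>s\<bar>) *\<^sub>R z)" unfolding p by (rule imageI)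
    thus ?thesis using True by simp
  next
    case False
    define t where "t = (a * s + b) / (1 + s)"
    have "a * s \<le> 1 * s" using False ab by (intro mult_right_mono) auto
    hence t: "0 \<le> t" "t \<le> 1" using False ab by (auto simp: t_def divide_simps)
    have "a * s + b = t * (1 + \<bar>s\<bar>)" using False by (simp add: t_def)
    hence "p = t *\<^sub>R ((1 + \<bar>s\<bar>) *\<^sub>R z)" using ab(5) by (simp only: scaleR_scaleR)
    thus ?thesis using False t by (auto simp: in_segment)
  qed
next
  fix p assume "p \<in> (+) (if s < 0 then s *\<^sub>R z else 0) ` closed_segment 0 ((1 + \<bar>s\<bar>) *\<^sub>R z)"
  then obtain t where t: "0 \<le> t" "t \<le> 1" "p = (if s < 0 then s *\<^sub>R z else 0) + t *\<^sub>R ((1 + \<bar>s\<bar>) *\<^sub>R z)"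
    by (auto simp: in_segment)
  define a where "a = (if s < 0 then 1 - t else t)"
  have p: "p = a *\<^sub>R (s *\<^sub>R z) + t *\<^sub>R z" unfolding t(3) a_def by (simp add: algebra_simps)
  have seg: "r *\<^sub>R x \<in> closed_segment 0 x" if "0 \<le> r" "r \<le> 1" for r and x :: 'a
    unfolding in_segment using that by (intro exI[of _ r]) simp
  have "a *\<^sub>R (s *\<^sub>R z) \<in> closed_segment 0 (s *\<^sub>R z)" "t *\<^sub>R z \<in> closed_segment 0 z"
    using t(1,2) by (intro seg; simp add: a_def)+
  with p show "p \<in> {x + y | x y. x \<in> closed_segment 0 (s *\<^sub>R z) \<and> y \<in> closed_segment 0 z}" by blast
qed

lemma Minkowski_sum_assoc:
  fixes A B C :: "'a::ab_group_add set"
  shows "{x + w | x w. x \<in> A \<and> w \<in> {y + z | y z. y \<in> B \<and> z \<in> C}}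
    = {p + z | p z. p \<in> {x + y | x y. x \<in> A \<and> y \<in> B} \<and> z \<in> C}"
proof (intro set_eqI iffI)
  fix q assume "q \<in> {x + w | x w. x \<in> A \<and> w \<in> {y + z | y z. y \<in> B \<and> z \<in> C}}"
  then obtain x y z where q: "x \<in> A" "y \<in> B" "z \<in> C" "q = x + (y + z)" by blast
  hence "q = (x + y) + z" by (simp add: add.assoc)
  thus "q \<in> {p + z | p z. p \<in> {x + y | x y. x \<in> A \<and> y \<in> B} \<and> z \<in> C}" using q by blast
next
  fix q assume "q \<in> {p + z | p z. p \<in> {x + y | x y. x \<in> A \<and> y \<in> B} \<and> z \<in> C}"
  then obtain x y z where q: "x \<in> A" "y \<in> B" "z \<in> C" "q = (x + y) + z" by blast
  hence "q = x + (y + z)" by (simp add: add.assoc)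
  thus "q \<in> {x + w | x w. x \<in> A \<and> w \<in> {y + z | y z. y \<in> B \<and> z \<in> C}}" using q by blast
qed

lemma Minkowski_sum_translation:
  fixes A B :: "'a::ab_group_add set"
  shows "{p + z | p z. p \<in> (+) c ` A \<and> z \<in> B} = (+) c ` {p + z | p z. p \<in> A \<and> z \<in> B}"
proof (intro set_eqI iffI)
  fix q assume "q \<in> {p + z | p z. p \<in> (+) c ` A \<and> z \<in> B}"
  then obtain p z where q: "p \<in> A" "z \<in> B" "q = (c + p) + z" by blast
  hence "q = c + (p + z)" by (simp add: add.assoc)
  thus "q \<in> (+) c ` {p + z | p z. p \<in> A \<and> z \<in> B}" using q by blast
next
  fix q assume "q \<in> (+) c ` {p + z | p z. p \<in> A \<and> z \<in> B}"
  then obtain p z where q: "p \<in> A" "z \<in> B" "q = c + (p + z)" by blast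
  hence "q = (c + p) + z" by (simp add: add.assoc)
  thus "q \<in> {p + z | p z. p \<in> (+) c ` A \<and> z \<in> B}" using q by blast
qed

lemma zonotope_merge_parallel:
  fixes u :: "'i \<Rightarrow> 'a::real_vector"
  assumes "finite J" "i \<notin> J" "j \<notin> J" "i \<noteq> j" "u j = s *\<^sub>R u i"
  shows "zonotope_on (insert j (insert i J)) u =
    (+) (if s < 0 then u j else 0) ` zonotope_on (insert i J) (u(i := (1 + \<bar>s\<bar>) *\<^sub>R u i))"
proof -
  have J: "zonotope_on J (u(i := (1 + \<bar>s\<bar>) *\<^sub>R u i)) = zonotope_on J u"
    using assms(2) by (intro zonotope_on_cong) auto
  have "zonotope_on (insert j (insert i J)) u
      = {p + z | p z. p \<in> {x + y | x y. x \<in> closed_segment 0 (u j) \<and> y \<in> closed_segment 0 (u i)} \<and> z \<in> zonotope_on J u}"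
    unfolding Minkowski_sum_assoc[symmetric] using assms(1-4) by (simp add: zonotope_on_insert)
  also have "\<dots> = {p + z | p z. p \<in> (+) (if s < 0 then u j else 0) ` closed_segment 0 ((1 + \<bar>s\<bar>) *\<^sub>R u i) \<and> z \<in> zonotope_on J u}"
    using sum_parallel_segments[of s "u i"] by (simp add: assms(5))
  also have "\<dots> = (+) (if s < 0 then u j else 0) ` {p + z | p z. p \<in> closed_segment 0 ((1 + \<bar>s\<bar>) *\<^sub>R u i) \<and> z \<in> zonotope_on J u}"
    by (rule Minkowski_sum_translation)
  also have "{p + z | p z. p \<in> closed_segment 0 ((1 + \<bar>s\<bar>) *\<^sub>R u i) \<and> z \<in> zonotope_on J u}
      = zonotope_on (insert i J) (u(i := (1 + \<bar>s\<bar>) *\<^sub>R u i))"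
    using assms(1,2) by (simp add: zonotope_on_insert J)
  finally show ?thesis .
qed

lemma zonotope_nonparallel_generators:
  assumes "zonotope_up_to_translation (P :: (real ^ 'd) set)"
  obtains v u and I :: "nat set" where "finite I" "P = (+) v ` zonotope_on I u" "\<And>i. i \<in> I \<Longrightarrow> u i \<noteq> 0"
    "\<And>i j. i \<in> I \<Longrightarrow> j \<in> I \<Longrightarrow> i \<noteq> j \<Longrightarrow> u j \<notin> span {u i}"
proof -
  define Q where "Q k \<longleftrightarrow> (\<exists>v u. \<exists>I :: nat set. finite I \<and> card I = k \<and> P = (+) v ` zonotope_on I u)" for k
  obtain v0 n u0 where "P = (+) v0 ` zonotope_gen n u0"
    using assms by (auto simp: zonotope_up_to_translation_def)
  hence "Q n" unfolding Q_def zonotope_gen_eq by (intro exI[of _ v0] exI[of _ u0] exI[of _ "{..<n}"]) auto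
  define k where "k = (LEAST k. Q k)"
  have "Q k" unfolding k_def using \<open>Q n\<close> by (rule LeastI)
  then obtain v u and I :: "nat set" where I: "finite I" "card I = k" "P = (+) v ` zonotope_on I u" unfolding Q_def by blast
  have minimal: "\<not> Q l" if "l < k" for l using not_less_Least that by (auto simp: k_def)
  have nz: "u i \<noteq> 0" if i: "i \<in> I" for i
  proof
    assume "u i = 0"
    have "zonotope_on (insert i (I - {i})) u = zonotope_on (I - {i}) u"
      using I(1) \<open>u i = 0\<close> by (subst zonotope_on_insert) auto
    hence "P = (+) v ` zonotope_on (I - {i}) u" using I(3) i by (simp add: insert_absorb)
    hence "Q (card (I - {i}))" unfolding Q_def using I(1) by blast
    moreover have "card (I - {i}) < k" using I(1,2) i by (metis card_Diff1_less)
    ultimately show False using minimal by blast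
  qed
  moreover have "u j \<notin> span {u i}" if ij: "i \<in> I" "j \<in> I" "i \<noteq> j" for i j
  proof
    assume "u j \<in> span {u i}"
    then obtain s where s: "u j = s *\<^sub>R u i" by (auto simp: span_singleton)
    define J where "J = I - {i, j}"
    have J: "finite J" "i \<notin> J" "j \<notin> J" "I = insert j (insert i J)" "insert i J = I - {j}"
      using ij I(1) by (auto simp: J_def)
    have "P = (+) v ` (+) (if s < 0 then u j else 0) ` zonotope_on (I - {j}) (u(i := (1 + \<bar>s\<bar>) *\<^sub>R u i))"
      using zonotope_merge_parallel[OF J(1-3) ij(3) s, folded J(4), unfolded J(5)] I(3) by (simp only:)
    hence "P = (+) ((if s < 0 then u j else 0) + v) ` zonotope_on (I - {j}) (u(i := (1 + \<bar>s\<bar>) *\<^sub>R u i))"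
      by (simp only: translation_assoc)
    hence "Q (card (I - {j}))" unfolding Q_def using I(1) by blast
    moreover have "card (I - {j}) < k" using I(1,2) ij(2) by (metis card_Diff1_less)
    ultimately show False using minimal by blast
  qed
  ultimately show ?thesis using that I(1,3) by blast
qed

text \<open>For generic \<open>y\<close> every coefficient of a minimiser is forced to 0 or 1, so
  the minimiser is unique and the supporting hyperplane cuts out a vertex.\<close>

lemma zonotope_generic_vertex:
  fixes u :: "'i \<Rightarrow> 'a::euclidean_space"
  assumes I: "finite I" and y: "\<And>i. i \<in> I \<Longrightarrow> y \<bullet> u i \<noteq> 0"
  shows "(v + (\<Sum>i\<in>{i\<in>I. y \<bullet> u i < 0}. u i)) extreme_point_of ((+) v ` zonotope_on I u)"
proof -
  define p where "p = (\<Sum>i\<in>{i\<in>I. y \<bullet> u i < 0}. u i)"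
  let ?Z = "(+) v ` zonotope_on I u"
  have conv: "convex ?Z" using zonotope_on_compact_convex[OF I, of u] by (simp add: convex_translation)
  have pZ: "p \<in> zonotope_on I u"
    unfolding p_def using zonotope_on_minimizer(2)[OF I zonotope_on_memI[of I "\<lambda>_. 0" u]] by simp
  have low: "y \<bullet> p \<le> y \<bullet> x" if "x \<in> zonotope_on I u" for x
    unfolding p_def using I that by (rule zonotope_on_minimizer(1))
  have uniq: "x = p" if x: "x \<in> zonotope_on I u" "y \<bullet> x = y \<bullet> p" for x
  proof -
    obtain a where a: "\<forall>i\<in>I. 0 \<le> a i \<and> a i \<le> 1" "x = (\<Sum>i\<in>I. a i *\<^sub>R u i)"
      using x(1) by (auto simp: zonotope_on_def)
    define b where "b i = (if y \<bullet> u i < 0 then 1 else 0::real)" for i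
    have pb: "p = (\<Sum>i\<in>I. b i *\<^sub>R u i)"
      unfolding p_def sum.inter_filter[OF I] b_def by (intro sum.cong) auto
    have "(\<Sum>i\<in>I. (a i - b i) * (y \<bullet> u i)) = 0"
      using x(2) unfolding a(2) pb by (simp add: inner_sum_right left_diff_distrib sum_subtractf)
    moreover have "0 \<le> (a i - b i) * (y \<bullet> u i)" if "i \<in> I" for i
      using a(1) that by (auto simp: b_def intro: mult_nonneg_nonneg mult_nonpos_nonpos)
    ultimately have "\<forall>i\<in>I. (a i - b i) * (y \<bullet> u i) = 0"
      using sum_nonneg_eq_0_iff[OF I, of "\<lambda>i. (a i - b i) * (y \<bullet> u i)"] by simp
    hence "\<forall>i\<in>I. a i = b i" using y by simp
    thus ?thesis unfolding a(2) pb by (intro sum.cong) auto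
  qed
  have "?Z \<inter> {x. y \<bullet> x = y \<bullet> (v + p)} face_of ?Z"
    using low by (intro face_of_Int_supporting_hyperplane_ge conv) (auto simp: inner_add_right)
  moreover have "?Z \<inter> {x. y \<bullet> x = y \<bullet> (v + p)} = {v + p}"
    using uniq pZ by (auto simp: inner_add_right)
  ultimately show ?thesis by (simp add: face_of_singleton p_def)
qed

text \<open>If \<open>y\<close> is orthogonal to \<open>u i\<close> alone, the vertices selected by
  slight turns towards \<open>u i\<close> and \<open>- u i\<close> differ by exactly
  \<open>u i\<close>, and both are lattice points. Such a \<open>y\<close> exists because no other
  generator is parallel to \<open>u i\<close>.\<close>

lemma lattice_zonotope_generators:
  fixes P :: "(real ^ 'd) set" and I :: "'i set"
  assumes P: "lattice_polytope P" "P = (+) v ` zonotope_on I u" and I: "finite I"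
    and nz: "\<And>i. i \<in> I \<Longrightarrow> u i \<noteq> 0"
    and np: "\<And>i j. i \<in> I \<Longrightarrow> j \<in> I \<Longrightarrow> i \<noteq> j \<Longrightarrow> u j \<notin> span {u i}"
  shows "v \<in> integer_points" "u ` I \<subseteq> integer_points"
proof -
  have vert: "v + (\<Sum>i\<in>{i\<in>I. y \<bullet> u i < 0}. u i) \<in> integer_points" if "\<forall>i\<in>I. y \<bullet> u i \<noteq> 0" for y
    using zonotope_generic_vertex[OF I, of y u v] that P by (auto simp: lattice_polytope_def)
  have gen: "u i \<in> integer_points" if i: "i \<in> I" for i
  proof -
    have "\<exists>y\<in>{y. u i \<bullet> y = 0}. \<forall>e\<in>u ` (I - {i}). y \<bullet> e \<noteq> 0"
    proof (rule exists_nonorthogonal_in_subspace)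
      show "subspace {y. u i \<bullet> y = 0}" by (rule subspace_hyperplane)
      show "finite (u ` (I - {i}))" using I by simp
      fix e assume "e \<in> u ` (I - {i})"
      hence e: "e \<notin> span {u i}" using np[OF i] by auto
      \<comment> \<open>\<open>s\<close> becomes the component of \<open>e\<close> orthogonal to
        \<open>u i\<close>; it is nonzero because \<open>e\<close> is not parallel to
        \<open>u i\<close>.\<close>
      define c where "c = (e \<bullet> u i) / (u i \<bullet> u i)"
      define s where "s = e - c *\<^sub>R u i"
      have "s \<noteq> 0" using e by (auto simp: s_def span_singleton)
      have su: "s \<bullet> u i = 0" using nz[OF i] by (simp add: s_def c_def inner_diff_left)
      have "s \<bullet> e = s \<bullet> (s + c *\<^sub>R u i)" by (simp add: s_def)
      also have "\<dots> = s \<bullet> s" using su by (simp add: inner_add_right)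
      finally have "s \<bullet> e \<noteq> 0" using \<open>s \<noteq> 0\<close> by simp
      thus "\<exists>s\<in>{y. u i \<bullet> y = 0}. s \<bullet> e \<noteq> 0" using su by (auto simp: inner_commute)
    qed
    then obtain y where y: "y \<bullet> u i = 0" "\<And>j. j \<in> I - {i} \<Longrightarrow> y \<bullet> u j \<noteq> 0"
      by (auto simp: inner_commute)
    have ev: "\<forall>\<^sub>F \<tau> in at_right 0. \<forall>j\<in>I - {i}. (y + \<tau> *\<^sub>R z) \<bullet> u j < 0 \<longleftrightarrow> y \<bullet> u j < 0"
      "\<forall>\<^sub>F \<tau> in at_right 0. \<forall>j\<in>I - {i}. (y + \<tau> *\<^sub>R z) \<bullet> u j \<noteq> 0" for z
      using I y(2) by (auto intro!: eventually_ball_finite eventually_same_side eventually_inner_nonzero)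
    have "\<forall>\<^sub>F \<tau> in at_right (0::real). \<tau> > 0" by (rule eventually_at_right_less)
    with ev(1)[of "u i"] ev(2)[of "u i"] ev(1)[of "- u i"] ev(2)[of "- u i"]
    have "\<forall>\<^sub>F \<tau> in at_right 0. (\<forall>j\<in>I - {i}. (y + \<tau> *\<^sub>R u i) \<bullet> u j < 0 \<longleftrightarrow> y \<bullet> u j < 0) \<and>
        (\<forall>j\<in>I - {i}. (y + \<tau> *\<^sub>R u i) \<bullet> u j \<noteq> 0) \<and>
        (\<forall>j\<in>I - {i}. (y + \<tau> *\<^sub>R (- u i)) \<bullet> u j < 0 \<longleftrightarrow> y \<bullet> u j < 0) \<and>
        (\<forall>j\<in>I - {i}. (y + \<tau> *\<^sub>R (- u i)) \<bullet> u j \<noteq> 0) \<and> \<tau> > 0"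
      by eventually_elim blast
    from eventually_happens'[OF trivial_limit_at_right_real this]
    obtain \<tau> where elim: "\<forall>j\<in>I - {i}. (y + \<tau> *\<^sub>R u i) \<bullet> u j < 0 \<longleftrightarrow> y \<bullet> u j < 0"
        "\<forall>j\<in>I - {i}. (y + \<tau> *\<^sub>R u i) \<bullet> u j \<noteq> 0"
        "\<forall>j\<in>I - {i}. (y + \<tau> *\<^sub>R (- u i)) \<bullet> u j < 0 \<longleftrightarrow> y \<bullet> u j < 0"
        "\<forall>j\<in>I - {i}. (y + \<tau> *\<^sub>R (- u i)) \<bullet> u j \<noteq> 0" "\<tau> > 0" by blast
    show ?thesis
    proof -
      have ui: "(y + \<tau> *\<^sub>R u i) \<bullet> u i > 0" "(y + \<tau> *\<^sub>R (- u i)) \<bullet> u i < 0"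
        using y(1) elim(5) nz[OF i] by (auto simp: inner_add_left inner_diff_left)
      have "(y + \<tau> *\<^sub>R u i) \<bullet> u j < 0 \<longleftrightarrow> j \<noteq> i \<and> y \<bullet> u j < 0" if "j \<in> I" for j
        using elim(1) ui(1) that by (cases "j = i") (simp, blast)
      hence "{j\<in>I. (y + \<tau> *\<^sub>R u i) \<bullet> u j < 0} = {j\<in>I - {i}. y \<bullet> u j < 0}" by blast
      moreover have "(y + \<tau> *\<^sub>R (- u i)) \<bullet> u j < 0 \<longleftrightarrow> j = i \<or> y \<bullet> u j < 0" if "j \<in> I" for j
        using elim(3) ui(2) that by (cases "j = i") (simp, blast)
      hence "{j\<in>I. (y + \<tau> *\<^sub>R (- u i)) \<bullet> u j < 0} = insert i {j\<in>I - {i}. y \<bullet> u j < 0}" using i by blast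
      moreover have "v + (\<Sum>j\<in>{j\<in>I. (y + \<tau> *\<^sub>R u i) \<bullet> u j < 0}. u j) \<in> integer_points"
        using elim(2) ui(1) by (intro vert) auto
      moreover have "v + (\<Sum>j\<in>{j\<in>I. (y + \<tau> *\<^sub>R (- u i)) \<bullet> u j < 0}. u j) \<in> integer_points"
        using elim(4) ui(2) by (intro vert) auto
      ultimately have "v + (\<Sum>j\<in>{j\<in>I - {i}. y \<bullet> u j < 0}. u j) \<in> integer_points"
        "v + (\<Sum>j\<in>insert i {j\<in>I - {i}. y \<bullet> u j < 0}. u j) \<in> integer_points" by simp_all
      from integer_points_diff[OF this(2,1)] show ?thesis using I by simp
    qed
  qed
  thus "u ` I \<subseteq> integer_points" by blast
  have "finite (u ` I)" "0 \<notin> u ` I" using I nz by auto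
  then obtain y where y: "\<And>e. e \<in> u ` I \<Longrightarrow> y \<bullet> e \<noteq> 0" by (rule exists_nonorthogonal) blast
  have "v + (\<Sum>i\<in>{i\<in>I. y \<bullet> u i < 0}. u i) \<in> integer_points" using y by (intro vert) auto
  moreover have "(\<Sum>i\<in>{i\<in>I. y \<bullet> u i < 0}. u i) \<in> integer_points" using gen by (intro integer_points_sum) auto
  ultimately show "v \<in> integer_points" using integer_points_diff by fastforce
qed

lemma zonotope_on_scale: "(\<lambda>x. t *\<^sub>R x) ` zonotope_on I u = zonotope_on I (\<lambda>i. t *\<^sub>R u i)"
proof -
  have eq: "t *\<^sub>R (\<Sum>i\<in>I. a i *\<^sub>R u i) = (\<Sum>i\<in>I. a i *\<^sub>R (t *\<^sub>R u i))" for a :: "'b \<Rightarrow> real"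
    by (simp add: scaleR_sum_right mult.commute)
  show ?thesis
  proof (intro set_eqI iffI)
    fix x assume "x \<in> (\<lambda>x. t *\<^sub>R x) ` zonotope_on I u"
    then obtain a where a: "\<forall>i\<in>I. 0 \<le> a i \<and> a i \<le> 1" "x = t *\<^sub>R (\<Sum>i\<in>I. a i *\<^sub>R u i)" by (auto simp: zonotope_on_def)
    show "x \<in> zonotope_on I (\<lambda>i. t *\<^sub>R u i)" unfolding a(2) eq by (rule zonotope_on_memI) (use a(1) in blast)
  next
    fix x assume "x \<in> zonotope_on I (\<lambda>i. t *\<^sub>R u i)"
    then obtain a where a: "\<forall>i\<in>I. 0 \<le> a i \<and> a i \<le> 1" "x = t *\<^sub>R (\<Sum>i\<in>I. a i *\<^sub>R u i)"
      unfolding zonotope_on_def eq by blast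
    have "(\<Sum>i\<in>I. a i *\<^sub>R u i) \<in> zonotope_on I u" by (rule zonotope_on_memI) (use a(1) in blast)
    thus "x \<in> (\<lambda>x. t *\<^sub>R x) ` zonotope_on I u" unfolding a(2) by (rule imageI)
  qed
qed

text \<open>Dilation scales the lattice generators and the lattice translation by an integer, so
  each \<open>t P\<close> is again a lattice zonotope up to a lattice translation.\<close>

lemma zonotope_imp_unit_invariant:
  fixes P :: "(real ^ 'd) set" and t :: nat
  assumes "lattice_polytope P" "zonotope_up_to_translation P"
  shows "unit_invariant ((\<lambda>x. real t *\<^sub>R x) ` P)"
proof -
  obtain v u and I :: "nat set" where I: "finite I" "P = (+) v ` zonotope_on I u" "\<And>i. i \<in> I \<Longrightarrow> u i \<noteq> 0"
    "\<And>i j. i \<in> I \<Longrightarrow> j \<in> I \<Longrightarrow> i \<noteq> j \<Longrightarrow> u j \<notin> span {u i}"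
    by (rule zonotope_nonparallel_generators[OF assms(2)]) blast
  have int: "v \<in> integer_points" "u ` I \<subseteq> integer_points"
    using lattice_zonotope_generators[OF assms(1) I(2,1)] I(3,4) by blast+
  obtain f where f: "bij_betw f {..<card I} I"
    using ex_bij_betw_nat_finite[OF I(1)] by (auto simp: lessThan_atLeast0)
  define u' where "u' = (\<lambda>i. real t *\<^sub>R u i) \<circ> f"
  have "(\<lambda>x. real t *\<^sub>R x) ` P = (+) (real t *\<^sub>R v) ` (\<lambda>x. real t *\<^sub>R x) ` zonotope_on I u"
    unfolding I(2) image_image by (simp add: scaleR_add_right)
  also have "(\<lambda>x. real t *\<^sub>R x) ` zonotope_on I u = zonotope_on {..<card I} u'"
    unfolding zonotope_on_scale u'_def by (rule zonotope_on_reindex[OF f])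
  finally have P: "(\<lambda>x. real t *\<^sub>R x) ` P = (+) (real t *\<^sub>R v) ` zonotope_on {..<card I} u'" .
  have "u' ` {..<card I} \<subseteq> integer_points"
  proof (rule image_subsetI)
    fix i assume "i \<in> {..<card I}"
    hence "u (f i) \<in> integer_points" using int(2) f by (auto dest: bij_betwE)
    thus "u' i \<in> integer_points" by (simp add: u'_def integer_points_scale)
  qed
  hence "unit_invariant (zonotope_on {..<card I} u')" by (rule unit_invariant_lattice_zonotope)
  moreover have "real t *\<^sub>R v \<in> integer_points" using int(1) by (simp add: integer_points_scale)
  ultimately show ?thesis unfolding P unit_invariant_def by (simp add: count_shift_translate)
qed

subsection \<open>The GCD-property\<close>

text \<open>With \<open>a\<close> the product of the primes of \<open>M\<close> that do not divide
  \<open>k\<close>, each prime of \<open>M\<close> divides exactly one of \<open>k\<close> and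
  \<open>a * n\<close>, hence not their sum.\<close>

lemma exists_cong_coprime:
  fixes k n M :: nat
  assumes "coprime k n" "M > 0"
  obtains a where "coprime (k + a * n) M"
proof -
  define S where "S = {p \<in> prime_factors M. \<not> p dvd k}"
  define a where "a = \<Prod>S"
  have S: "finite S" by (simp add: S_def)
  have "coprime (k + a * n) M"
  proof (rule ccontr)
    assume "\<not> coprime (k + a * n) M"
    then obtain p where p: "prime p" "p dvd k + a * n" "p dvd M"
      by (metis coprime_iff_gcd_eq_1 gcd_nat.bounded_iff prime_factor_nat)
    show False
    proof (cases "p dvd k")
      case True
      hence "p dvd a * n" using p(2) by (simp add: dvd_add_right_iff)
      moreover have "\<not> p dvd n" using True assms(1) p(1) by (meson coprime_common_divisor not_prime_unit)
      ultimately have "p dvd a" using p(1) by (simp add: prime_dvd_mult_iff)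
      then obtain q where "q \<in> S" "p dvd q" unfolding a_def using prime_dvd_prod_iff[OF S p(1), of "\<lambda>x. x"] by auto
      hence "p = q" using p(1) by (auto simp: S_def intro: primes_dvd_imp_eq)
      thus False using True \<open>q \<in> S\<close> by (simp add: S_def)
    next
      case False
      hence "p \<in> S" using p assms(2) by (simp add: S_def prime_factors_dvd)
      hence "p dvd a" unfolding a_def using S by (simp add: dvd_prodI[of S p "\<lambda>x. x", simplified])
      hence "p dvd k" using p(2) by (metis dvd_add_left_iff dvd_mult2)
      thus False using False by simp
    qed
  qed
  thus ?thesis using that by blast
qed

text \<open>After division by the gcd \<open>k\<close> becomes coprime to the modulus and can be
  moved within its class to a number coprime to \<open>M\<close>.\<close>

lemma exists_cong_same_gcd:
  fixes k n M :: nat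
  assumes "n dvd M" "M > 0"
  obtains k' where "[k' = k] (mod n)" "gcd k' M = gcd k n"
proof -
  define g where "g = gcd k n"
  have n: "n > 0" using assms by (auto intro: Nat.gr0I)
  have g: "g > 0" using n by (simp add: g_def)
  obtain k1 n1 where kn: "k = k1 * g" "n = n1 * g" "coprime k1 n1"
    using gcd_coprime_exists[of k n, folded g_def] g by auto
  obtain a where a: "coprime (k1 + a * n1) M" using exists_cong_coprime[OF kn(3) assms(2)] by blast
  define k' where "k' = k + a * n"
  obtain M1 where M1: "M = g * M1" using assms(1) kn(2) by (metis dvd_mult_right dvdE)
  have "k' = g * (k1 + a * n1)" by (simp add: k'_def kn algebra_simps)
  moreover have "coprime (k1 + a * n1) M1" using a M1 by simp
  ultimately have "gcd k' M = g" by (simp add: M1 gcd_mult_left)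
  moreover have "[k' = k] (mod n)" by (simp add: k'_def cong_def)
  ultimately show ?thesis using that by (simp add: g_def)
qed

text \<open>Equal gcds mean that \<open>k\<close> and \<open>l\<close> generate the same subgroup
  modulo \<open>m\<close>. The quotient of the reduced parts is a unit modulo \<open>m1\<close>
  only, and is lifted to a unit modulo \<open>m\<close>.\<close>

lemma gcd_eq_imp_unit_multiple:
  fixes k l m :: nat
  assumes "m > 0" "gcd k m = gcd l m"
  obtains j where "coprime j m" "[j * k = l] (mod m)"
proof -
  define g where "g = gcd k m"
  have g: "g > 0" using assms(1) by (simp add: g_def)
  obtain k1 m1 where k: "k = k1 * g" "m = m1 * g" "coprime k1 m1"
    using gcd_coprime_exists[of k m, folded g_def] g by auto
  obtain l1 m2 where l: "l = l1 * g" "m = m2 * g" "coprime l1 m2"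
    using gcd_coprime_exists[of l m, folded assms(2) g_def] g by auto
  have "m2 = m1" using k(2) l(2) g by simp
  obtain i where i: "[k1 * i = 1] (mod m1)" using cong_solve_coprime_nat[OF k(3)] by auto
  have "coprime (k1 * i) m1" using i by (metis cong_imp_coprime cong_sym coprime_1_left)
  hence "coprime (l1 * i) m1" using l(3) \<open>m2 = m1\<close> by simp
  then obtain a where a: "coprime (l1 * i + a * m1) m" using exists_cong_coprime[OF _ assms(1)] by blast
  define j where "j = l1 * i + a * m1"
  have "j * k1 = l1 * (k1 * i) + (a * k1) * m1" by (simp add: j_def algebra_simps)
  hence "[j * k1 = l1 * (k1 * i)] (mod m1)" by (simp only: cong_def mod_mult_self1)
  also have "[l1 * (k1 * i) = l1 * 1] (mod m1)" using i by (rule cong_scalar_left)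
  finally have "[j * k1 = l1] (mod m1)" by simp
  hence "[j * k1 * g = l1 * g] (mod m1 * g)" using g by (simp add: cong_def flip: mult_mod_left)
  hence "[j * k = l] (mod m)" by (simp add: k l(1) mult.assoc)
  thus ?thesis using that a by (simp add: j_def)
qed

lemma poly_eq_if_infinitely_often:
  fixes p q :: "rat poly"
  assumes "infinite T" "\<And>t. t \<in> T \<Longrightarrow> poly p (of_nat t) = poly q (of_nat t)"
  shows "p = q"
proof (rule ccontr)
  assume "p \<noteq> q"
  hence "finite {x. poly (p - q) x = 0}" by (intro poly_roots_finite) simp
  moreover have "of_nat ` T \<subseteq> {x. poly (p - q) x = 0}" using assms(2) by auto
  ultimately have "finite (of_nat ` T :: rat set)" using finite_subset by blast
  hence "finite T" by (rule finite_imageD) (simp add: inj_on_def)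
  thus False using assms(1) by simp
qed

text \<open>A quasi-polynomial given by residue classes modulo \<open>m\<close>; the minimal period need not be
  compared with \<open>m\<close>, as every class modulo one period meets suitable classes modulo the other.\<close>

locale residue_polys =
  fixes L :: "nat \<Rightarrow> rat" and m :: nat and F :: "nat \<Rightarrow> rat poly"
  assumes m: "m > 0" and F_cong: "[k = l] (mod m) \<Longrightarrow> F k = F l"
    and L: "t > 0 \<Longrightarrow> L t = poly (F t) (of_nat t)"
begin

lemma constituents_F: "constituents L m F"
  unfolding constituents_def using m L F_cong by metis

text \<open>Both polynomials give the values of \<open>L\<close> on the infinite progression of
  \<open>k'\<close> modulo \<open>\<rho> * m\<close>, which lies in one class for either
  period.\<close>

lemma constituent_eq:
  assumes f: "constituents L \<rho> f" and k: "k \<in> {1..\<rho>}" "[k' = k] (mod \<rho>)"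
  shows "f k = F k'"
proof (rule poly_eq_if_infinitely_often)
  have \<rho>: "\<rho> > 0" using f by (simp add: constituents_def)
  \<comment> \<open>The summand 1 keeps the arguments positive even for
    \<open>k' = 0\<close>.\<close>
  let ?T = "(\<lambda>j. k' + (j + 1) * (\<rho> * m)) ` UNIV"
  have "inj (\<lambda>j. k' + (j + 1) * (\<rho> * m))" using \<rho> m by (auto simp: inj_def)
  thus "infinite ?T" using finite_imageD infinite_UNIV_nat by blast
  fix t assume "t \<in> ?T"
  then obtain j where t: "t = k' + (j + 1) * (\<rho> * m)" by blast
  have "t > 0" using \<rho> m by (simp add: t)
  have "t = k' + ((j + 1) * m) * \<rho>" "t = k' + ((j + 1) * \<rho>) * m" by (simp_all add: t algebra_simps)
  hence "[t = k'] (mod \<rho>)" "[t = k'] (mod m)" unfolding cong_def by (metis mod_mult_self1)+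
  hence "[t = k] (mod \<rho>)" "F t = F k'" using k(2) cong_trans F_cong by blast+
  thus "poly (f k) (of_nat t) = poly (F k') (of_nat t)"
    using f k(1) L[OF \<open>t > 0\<close>] \<open>t > 0\<close> unfolding constituents_def by metis
qed

text \<open>The assumption concerns gcds with \<open>m\<close>, the goal gcds with the minimal
  period \<rho>. Representatives modulo \<rho> are chosen whose gcd with \<open>\<rho> * m\<close>
  is already their gcd with \<rho>, so that equal gcds with \<rho> force equal gcds with
  \<open>m\<close>.\<close>

lemma GCD_propertyI:
  assumes "\<And>k l. gcd k m = gcd l m \<Longrightarrow> F k = F l"
  shows "GCD_property L"
proof -
  have per: "quasi_period L m" using constituents_F by (auto simp: quasi_period_def)
  define \<rho> where "\<rho> = minimal_period L"
  have "quasi_period L \<rho>" unfolding \<rho>_def minimal_period_def using per by (rule LeastI)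
  then obtain f where f: "constituents L \<rho> f" by (auto simp: quasi_period_def)
  hence \<rho>: "\<rho> > 0" by (simp add: constituents_def)
  have "f k = f l" if kl: "k \<in> {1..\<rho>}" "l \<in> {1..\<rho>}" "gcd \<rho> k = gcd \<rho> l" for k l
  proof -
    have M: "\<rho> dvd \<rho> * m" "\<rho> * m > 0" using \<rho> m by auto
    obtain k' where k': "[k' = k] (mod \<rho>)" "gcd k' (\<rho> * m) = gcd k \<rho>" using exists_cong_same_gcd[OF M] by blast
    obtain l' where l': "[l' = l] (mod \<rho>)" "gcd l' (\<rho> * m) = gcd l \<rho>" using exists_cong_same_gcd[OF M] by blast
    have red: "gcd x m = gcd (gcd x (\<rho> * m)) m" for x by (metis dvd_triv_right gcd.assoc gcd_nat.absorb2)
    have "gcd k' m = gcd l' m"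
      unfolding red[of k'] red[of l'] k'(2) l'(2) using kl(3) by (simp add: gcd.commute)
    from assms[OF this] show ?thesis
      using constituent_eq[OF f kl(1) k'(1)] constituent_eq[OF f kl(2) l'(1)] by simp
  qed
  thus ?thesis unfolding GCD_property_def quasi_polynomial_def
    using per f by (metis \<rho>_def)
qed

text \<open>A unit modulo \<open>m\<close> can be moved within its class to a number that is also
  coprime to \<rho>, and there the property compares it with 1.\<close>

lemma GCD_propertyD:
  assumes "GCD_property L" "coprime k m"
  shows "F k = F 1"
proof -
  define \<rho> where "\<rho> = minimal_period L"
  obtain f where f: "constituents L \<rho> f"
    "\<And>k l. k\<in>{1..\<rho>} \<Longrightarrow> l\<in>{1..\<rho>} \<Longrightarrow> gcd \<rho> k = gcd \<rho> l \<Longrightarrow> f k = f l"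
    using assms(1) unfolding GCD_property_def \<rho>_def by blast
  have \<rho>: "\<rho> > 0" using f(1) by (simp add: constituents_def)
  obtain a where a: "coprime (k + a * m) \<rho>" using exists_cong_coprime[OF assms(2) \<rho>] by blast
  define k' where "k' = k + a * m"
  have "F k = F k'" by (rule F_cong) (simp add: k'_def cong_def)
  \<comment> \<open>Constituents are indexed from 1 to \<rho>, so the residue 0 is represented by
    \<rho>.\<close>
  define r where "r = (if k' mod \<rho> = 0 then \<rho> else k' mod \<rho>)"
  have r: "r \<in> {1..\<rho>}" "[k' = r] (mod \<rho>)" using \<rho> by (auto simp: r_def cong_def less_imp_le)
  have "gcd \<rho> r = 1" using a r(2) unfolding k'_def[symmetric]
    by (metis cong_imp_coprime coprime_iff_gcd_eq_1 gcd.commute)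
  hence "f r = f 1" using f(2)[OF r(1), of 1] \<rho> by simp
  moreover have "f r = F k'" by (rule constituent_eq[OF f(1) r])
  moreover have "f 1 = F 1" by (rule constituent_eq[OF f(1)]) (use \<rho> in auto)
  ultimately show ?thesis using \<open>F k = F k'\<close> by simp
qed

end

lemma ehrhart_translate:
  "ehrhart ((\<lambda>x. c + x) ` P) t = of_nat (count_shift ((\<lambda>x. real t *\<^sub>R x) ` P) (real t *\<^sub>R c))"
proof -
  have "(\<lambda>x. real t *\<^sub>R x) ` (\<lambda>x. c + x) ` P = (+) (real t *\<^sub>R c) ` (\<lambda>x. real t *\<^sub>R x) ` P"
    by (simp add: image_image scaleR_add_right)
  hence "x \<in> (\<lambda>x. real t *\<^sub>R x) ` (\<lambda>x. c + x) ` P \<longleftrightarrow> x - real t *\<^sub>R c \<in> (\<lambda>x. real t *\<^sub>R x) ` P" for x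
    by (simp only: in_translation_image_iff)
  hence "(\<lambda>x. real t *\<^sub>R x) ` (\<lambda>x. c + x) ` P \<inter> integer_points
      = {x \<in> integer_points. x - real t *\<^sub>R c \<in> (\<lambda>x. real t *\<^sub>R x) ` P}" by blast
  thus ?thesis by (simp add: ehrhart_def count_shift_def)
qed

lemma integer_points_cong_multiple:
  fixes c :: "real ^ 'd"
  assumes "[k = l] (mod m)" "real m *\<^sub>R c \<in> integer_points"
  shows "real k *\<^sub>R c - real l *\<^sub>R c \<in> integer_points"
proof -
  have "int m dvd int k - int l" using assms(1) by (metis cong_iff_dvd_diff cong_int_iff)
  then obtain i where "int k - int l = int m * i" by (auto elim: dvdE)
  hence "real k - real l = real m * of_int i" by (metis of_int_diff of_int_mult of_int_of_nat_eq)
  hence "real k *\<^sub>R c - real l *\<^sub>R c = of_int i *\<^sub>R (real m *\<^sub>R c)"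
    by (simp add: mult.commute flip: scaleR_diff_left)
  moreover have "of_int i *\<^sub>R (real m *\<^sub>R c) \<in> integer_points" using assms(2) by (rule integer_points_scale) simp
  ultimately show ?thesis by (simp only:)
qed

theorem theorem5p5:
  fixes P :: "(real ^ 'd) set"
  assumes "lattice_polytope P"
  shows "zonotope_up_to_translation P \<longleftrightarrow>
         (\<forall>c\<in>rational_points. GCD_property (ehrhart ((\<lambda>x. c + x) ` P)))"
proof -
  have hull: "lattice_hull P" using assms by (rule lattice_polytope_imp_lattice_hull)
  obtain E :: "real ^ 'd \<Rightarrow> rat poly" where E: "\<And>w t. t \<ge> 1 \<Longrightarrow>
      poly (E w) (of_nat t) = of_nat (count_shift ((\<lambda>x. real t *\<^sub>R x) ` P) w)"
    using translated_Ehrhart_poly[OF hull] by metis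
  have E_eqI: "E w = E w'"
    if "\<And>t. t \<ge> 1 \<Longrightarrow> count_shift ((\<lambda>x. real t *\<^sub>R x) ` P) w = count_shift ((\<lambda>x. real t *\<^sub>R x) ` P) w'" for w w'
    by (rule poly_eq_if_infinitely_often[of "{1..}"]) (auto simp: E that infinite_Ici)
  have E_cong: "E w = E w'" if "w - w' \<in> integer_points" for w w'
    using count_shift_cong_integer[OF that] by (intro E_eqI)
  \<comment> \<open>The value at \<open>t\<close> is a count for the translation vector
    \<open>real t *\<^sub>R c\<close>, which modulo the lattice depends only on the class of
    \<open>t\<close> modulo \<open>m\<close>.\<close>
  have res: "residue_polys (ehrhart ((\<lambda>x. c + x) ` P)) m (\<lambda>k. E (real k *\<^sub>R c))"
    if m: "m > 0" "real m *\<^sub>R c \<in> integer_points" for m c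
    by unfold_locales (use m in \<open>auto simp: ehrhart_translate E intro!: E_cong integer_points_cong_multiple\<close>)
  show ?thesis
  proof
    assume zono: "zonotope_up_to_translation P"
    show "\<forall>c\<in>rational_points. GCD_property (ehrhart ((\<lambda>x. c + x) ` P))"
    proof
      fix c :: "real ^ 'd"
      assume "c \<in> rational_points"
      then obtain m :: nat where m: "m > 0" "real m *\<^sub>R c \<in> integer_points"
        by (rule rational_points_common_denominator)
      show "GCD_property (ehrhart ((\<lambda>x. c + x) ` P))"
      proof (rule residue_polys.GCD_propertyI[OF res[OF m]])
        fix k l assume "gcd k m = gcd l m"
        then obtain j where j: "coprime j m" "[j * k = l] (mod m)"
          using gcd_eq_imp_unit_multiple[OF m(1)] by blast
        have mk: "real m *\<^sub>R (real k *\<^sub>R c) \<in> integer_points"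
          using integer_points_scale[OF m(2), of "real k"] by (simp add: mult.commute)
        \<comment> \<open>Equal gcds are bridged by a unit \<open>j\<close>: the invariance replaces
          \<open>k\<close> by \<open>j * k\<close>, and periodicity replaces that by
          \<open>l\<close>.\<close>
        have "E (real k *\<^sub>R c) = E (real j *\<^sub>R (real k *\<^sub>R c))"
        proof (rule E_eqI)
          fix t :: nat
          show "count_shift ((\<lambda>x. real t *\<^sub>R x) ` P) (real k *\<^sub>R c)
              = count_shift ((\<lambda>x. real t *\<^sub>R x) ` P) (real j *\<^sub>R (real k *\<^sub>R c))"
            using zonotope_imp_unit_invariant[OF assms zono, of t] m(1) mk j(1)
            unfolding unit_invariant_def by metis
        qed
        also have "\<dots> = E (real l *\<^sub>R c)"
          using integer_points_cong_multiple[OF j(2) m(2)] by (intro E_cong) simp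
        finally show "E (real k *\<^sub>R c) = E (real l *\<^sub>R c)" .
      qed
    qed
  next
    assume gcd: "\<forall>c\<in>rational_points. GCD_property (ehrhart ((\<lambda>x. c + x) ` P))"
    have "count_shift P (real k *\<^sub>R w) = count_shift P w"
      if w: "m > 0" "real m *\<^sub>R w \<in> integer_points" "coprime k m" for w :: "real ^ 'd" and m k :: nat
    proof -
      have "w $ i \<in> \<rat>" for i
      proof -
        have "real m * w $ i \<in> \<int>" using w(2) by (simp add: integer_points_def)
        hence "(real m * w $ i) / real m \<in> \<rat>" using Ints_subset_Rats by (intro Rats_divide) auto
        thus ?thesis using w(1) by simp
      qed
      hence "w \<in> rational_points" by (simp add: rational_points_def)
      hence "E (real k *\<^sub>R w) = E (real 1 *\<^sub>R w)"
        using residue_polys.GCD_propertyD[OF res[OF w(1,2)] _ w(3)] gcd by blast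
      \<comment> \<open>At 1 the polynomials count the lattice points of the translates of
        \<open>P\<close> itself.\<close>
      hence "poly (E (real k *\<^sub>R w)) (of_nat 1) = poly (E w) (of_nat 1)" by simp
      thus ?thesis unfolding E[OF order_refl] by simp
    qed
    hence "unit_invariant P" by (simp add: unit_invariant_def)
    thus "zonotope_up_to_translation P" using hull by (rule unit_invariant_imp_zonotope)
  qed
qed

end
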